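(* There exists a function $\mathcal{A}:\{0,1\}^{\mathbb{N}}\to\mathbb{N}$ such that for every infinite, connected, locally finite graph $G$ on which simple random walk is recurrent, every vertex $o$ of $G$, and every integer $k\ge 1$, the following holds. Let $X_1,\dots,X_k$ be $k$ independent simple random walks on $G$ in discrete time (all with the same clock), each started at $o$ at time $0$, and let $\xi\in\{0,1\}^{\mathbb{N}}$ be the observation sequence defined by $\xi(t)=1$ if there is some $j\in\{1,\dots,k\}$ with $X_j(t)=o$, and $\xi(t)=0$ otherwise. Then $\mathcal{A}(\xi)=k$ with probability $1$. (The function $\mathcal{A}$ depends on none of $G$, $o$, $k$.)
   Context: Simple random walk (SRW) on a locally finite graph: at each integer time step the walker moves to a uniformly chosen neighbour of its current vertex. The graph is recurrent if SRW returns to its starting vertex almost surely. The index set $\mathbb{N}$ of the observation sequence is the set of discrete times. The observation records only whether $o$ is occupied at each time, not how many walkers are there. *)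

theory Defs
  imports "HOL-Probability.Probability"
begin

section \<open>Graphs\<close>

text \<open>A graph is given by a vertex set \<open>V\<close> and an adjacency relation \<open>E\<close>.\<close>

definition simple_graph :: "'v set \<Rightarrow> ('v \<Rightarrow> 'v \<Rightarrow> bool) \<Rightarrow> bool" where
  "simple_graph V E \<longleftrightarrow> symp E \<and> irreflp E \<and> (\<forall>u w. E u w \<longrightarrow> u \<in> V \<and> w \<in> V)"

definition neighbours :: "('v \<Rightarrow> 'v \<Rightarrow> bool) \<Rightarrow> 'v \<Rightarrow> 'v set" where
  "neighbours E u = {w. E u w}"

definition locally_finite_graph :: "'v set \<Rightarrow> ('v \<Rightarrow> 'v \<Rightarrow> bool) \<Rightarrow> bool" where
  "locally_finite_graph V E \<longleftrightarrow> (\<forall>u\<in>V. finite (neighbours E u))"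

definition connected_graph :: "'v set \<Rightarrow> ('v \<Rightarrow> 'v \<Rightarrow> bool) \<Rightarrow> bool" where
  "connected_graph V E \<longleftrightarrow> V \<noteq> {} \<and> (\<forall>u\<in>V. \<forall>w\<in>V. E\<^sup>*\<^sup>* u w)"


section \<open>Simple random walk\<close>

text \<open>The conditional law of the position at time \<open>n\<close>, given the trajectory \<open>\<omega>\<close> up to
  time \<open>n - 1\<close>. \<^const>\<open>pmf_of_set\<close> is the uniform distribution only for a finite nonempty set;
  in an infinite, connected, locally finite graph every vertex has such a neighbourhood.\<close>

definition srw_kernel :: "('v \<Rightarrow> 'v \<Rightarrow> bool) \<Rightarrow> 'v \<Rightarrow> nat \<Rightarrow> (nat \<Rightarrow> 'v) \<Rightarrow> 'v measure" where
  "srw_kernel E v n \<omega> =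
     measure_pmf (if n = 0 then return_pmf v else pmf_of_set (neighbours E (\<omega> (n - 1))))"

text \<open>The law of the walk started at \<open>v\<close>, on the space of trajectories with the product
  \<open>\<sigma>\<close>-algebra: the measure that the Ionescu-Tulcea theorem assigns to the kernels above. Its
  finite-dimensional distributions are computed in \<open>emeasure_srw_cylinder\<close> below.\<close>

definition srw :: "('v \<Rightarrow> 'v \<Rightarrow> bool) \<Rightarrow> 'v \<Rightarrow> (nat \<Rightarrow> 'v) measure" where
  "srw E v = projective_family.lim UNIV
     (Ionescu_Tulcea.CI (srw_kernel E v) (\<lambda>_. count_space UNIV)) (\<lambda>_. count_space UNIV)"

definition recurrent_graph :: "'v set \<Rightarrow> ('v \<Rightarrow> 'v \<Rightarrow> bool) \<Rightarrow> bool" where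
  "recurrent_graph V E \<longleftrightarrow> (\<forall>v\<in>V. AE \<omega> in srw E v. \<exists>t>0. \<omega> t = v)"


section \<open>Counting walkers from the observation at their starting vertex\<close>

text \<open>The joint law of \<open>k\<close> independent walks; \<open>X j t\<close> is the position of walker \<open>j\<close> at
  time \<open>t\<close>.\<close>

definition srws :: "('v \<Rightarrow> 'v \<Rightarrow> bool) \<Rightarrow> 'v \<Rightarrow> nat \<Rightarrow> (nat \<Rightarrow> nat \<Rightarrow> 'v) measure" where
  "srws E v k = PiM {1..k} (\<lambda>_. srw E v)"

definition observation :: "'v \<Rightarrow> nat \<Rightarrow> (nat \<Rightarrow> nat \<Rightarrow> 'v) \<Rightarrow> nat \<Rightarrow> bool" where
  "observation v k X t \<longleftrightarrow> (\<exists>j\<in>{1..k}. X j t = v)"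

text \<open>\<open>A\<close> recovers the number of walkers on one given graph. HOL cannot quantify over the
  type of vertices below the existential quantifier for \<open>A\<close>, so a single \<open>A\<close> for all graphs,
  whatever their vertices, is expressed in two parts: some \<open>A\<close> has this property for all graphs
  in question with vertices in \<^typ>\<open>nat\<close> (which are all of them up to isomorphism, since a connected
  locally finite graph is countable), and every such \<open>A\<close> has it for all of them with vertices in
  an arbitrary type.\<close>

definition counts_walkers ::
    "((nat \<Rightarrow> bool) \<Rightarrow> nat) \<Rightarrow> 'v set \<Rightarrow> ('v \<Rightarrow> 'v \<Rightarrow> bool) \<Rightarrow> bool" where
  "counts_walkers A V E \<longleftrightarrow>
     (\<forall>v\<in>V. \<forall>k\<ge>1. AE X in srws E v k. A (observation v k X) = k)"


section \<open>The law of the walk is well defined\<close>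

lemma Ionescu_Tulcea_srw_kernel: "Ionescu_Tulcea (srw_kernel E v) (\<lambda>_. count_space UNIV)"
proof (rule Ionescu_Tulcea.intro)
  fix n :: nat
  show "srw_kernel E v n \<in> PiM {0..<n} (\<lambda>_. count_space UNIV) \<rightarrow>\<^sub>M subprob_algebra (count_space UNIV)"
  proof (cases n)
    case 0
    have "srw_kernel E v 0 = (\<lambda>_. measure_pmf (return_pmf v))"
      by (simp add: srw_kernel_def fun_eq_iff)
    with 0 show ?thesis
      by (simp add: measure_pmf_in_subprob_algebra)
  next
    case (Suc m)
    have "(\<lambda>\<omega>. \<omega> m) \<in> PiM {0..<n} (\<lambda>_. count_space UNIV) \<rightarrow>\<^sub>M count_space UNIV"
      using Suc by (intro measurable_component_singleton) auto
    moreover have "(\<lambda>u. measure_pmf (pmf_of_set (neighbours E u)))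
        \<in> count_space UNIV \<rightarrow>\<^sub>M subprob_algebra (count_space UNIV)"
      by (simp add: measure_pmf_in_subprob_algebra)
    ultimately have "(\<lambda>\<omega>. measure_pmf (pmf_of_set (neighbours E (\<omega> m))))
        \<in> PiM {0..<n} (\<lambda>_. count_space UNIV) \<rightarrow>\<^sub>M subprob_algebra (count_space UNIV)"
      by (rule measurable_compose)
    moreover have "srw_kernel E v n = (\<lambda>\<omega>. measure_pmf (pmf_of_set (neighbours E (\<omega> m))))"
      using Suc by (simp add: srw_kernel_def fun_eq_iff)
    ultimately show ?thesis
      by simp
  qed
next
  show "prob_space (srw_kernel E v n \<omega>)" if "\<omega> \<in> space (PiM {0..<n} (\<lambda>_. count_space UNIV))" for n \<omega>
    unfolding srw_kernel_def by (rule measure_pmf.prob_space_axioms)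
qed

interpretation srw_IT: Ionescu_Tulcea "srw_kernel E v" "\<lambda>_. count_space UNIV" for E v
  by (rule Ionescu_Tulcea_srw_kernel)

lemma sets_srw [measurable_cong]: "sets (srw E v) = sets (PiM UNIV (\<lambda>_. count_space UNIV))"
  by (simp add: srw_def srw_IT.PF.sets_lim)

lemma space_srw [simp]: "space (srw E v) = UNIV"
  by (simp add: srw_def srw_IT.PF.space_lim space_PiM)

lemma emeasure_srw_emb:
  assumes "X \<in> sets (PiM {0..<n} (\<lambda>_. count_space UNIV))"
  shows "emeasure (srw E v) (prod_emb UNIV (\<lambda>_. count_space UNIV) {0..<n} X) =
         emeasure (srw_IT.C E v 0 n (\<lambda>_. undefined)) X"
proof -
  have "emeasure (srw E v) (prod_emb UNIV (\<lambda>_. count_space UNIV) {0..<n} X) =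
        emeasure (srw_IT.CI E v {0..<n}) X"
    unfolding srw_def using assms by (intro srw_IT.lim) auto
  also have "\<dots> = emeasure (srw_IT.C E v 0 n (\<lambda>_. undefined))
        (prod_emb {0..<n} (\<lambda>_. count_space UNIV) {0..<n} X)"
    using assms by (intro srw_IT.emeasure_CI) auto
  finally show ?thesis
    using sets.sets_into_space[OF assms] by (simp add: prod_emb_id space_PiM)
qed

lemma prob_space_srw: "prob_space (srw E v)"
proof
  have *: "prod_emb UNIV (\<lambda>_. count_space UNIV) {0..<0::nat} (space (PiM {0..<0} (\<lambda>_. count_space UNIV))) = (UNIV :: (nat \<Rightarrow> 'a) set)"
    by (auto simp: prod_emb_def space_PiM restrict_def)
  have "emeasure (srw E v) UNIV = emeasure (srw_IT.C E v 0 0 (\<lambda>_. undefined)) (space (PiM {0..<0} (\<lambda>_. count_space UNIV)))"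
    by (subst *[symmetric], rule emeasure_srw_emb) auto
  also have "\<dots> = 1"
    by (simp add: space_PiM emeasure_return sets_PiM_empty)
  finally show "emeasure (srw E v) (space (srw E v)) = 1" by simp
qed

lemma emeasure_srw_cylinder:
  "emeasure (srw E v) {\<omega>. \<forall>i\<le>n. \<omega> i = x i} =
     (if x 0 = v then \<Prod>i<n. ennreal (pmf (pmf_of_set (neighbours E (x i))) (x (Suc i))) else 0)"
proof -
  let ?M = "\<lambda>_::nat. count_space (UNIV :: 'a set)"
  define S where "S n = {\<lambda>i\<in>{0..<n}. x i}" for n :: nat
  have S_PiE: "S n = (\<Pi>\<^sub>E i\<in>{0..<n}. {x i})" for n
    unfolding S_def by (auto simp: PiE_iff extensional_def restrict_def fun_eq_iff)
  have S_sets: "S n \<in> sets (PiM {0..<n} ?M)" for n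
    unfolding S_PiE by (intro sets_PiM_I_finite) auto
  have step: "emeasure (srw_IT.C E v 0 (Suc m) (\<lambda>_. undefined)) (S (Suc m)) =
     emeasure (srw_kernel E v m (\<lambda>i\<in>{0..<m}. x i)) {x m} *
     emeasure (srw_IT.C E v 0 m (\<lambda>_. undefined)) (S m)" for m
  proof -
    have u: "(\<lambda>_. undefined) \<in> space (PiM {0..<0} ?M)" by (simp add: space_PiM)
    have meas: "srw_IT.eP E v m \<in> srw_IT.C E v 0 m (\<lambda>_. undefined) \<rightarrow>\<^sub>M
        subprob_algebra (PiM {0..<Suc m} ?M)"
      unfolding measurable_cong_sets[OF srw_IT.sets_C[of _ 0 E v m, OF u] refl] add_0
      by (rule srw_IT.measurable_eP)
    have "emeasure (srw_IT.C E v 0 (Suc m) (\<lambda>_. undefined)) (S (Suc m)) =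
      (\<integral>\<^sup>+\<omega>. emeasure (srw_IT.eP E v m \<omega>) (S (Suc m)) \<partial>srw_IT.C E v 0 m (\<lambda>_. undefined))"
      using srw_IT.space_C[of _ 0 E v m, OF u] meas S_sets[of "Suc m"]
      by (simp, subst emeasure_bind[where N="PiM {0..<Suc m} ?M"]) (auto simp: space_PiM)
    also have "\<dots> = (\<integral>\<^sup>+\<omega>. emeasure (srw_kernel E v m (\<lambda>i\<in>{0..<m}. x i)) {x m} * indicator (S m) \<omega>
        \<partial>srw_IT.C E v 0 m (\<lambda>_. undefined))"
    proof (intro nn_integral_cong)
      fix \<omega> assume "\<omega> \<in> space (srw_IT.C E v 0 m (\<lambda>_. undefined))"
      then have w: "\<omega> \<in> space (PiM {0..<m} ?M)"
        using srw_IT.space_C[of _ 0 E v m, OF u] by simp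
      have ext: "\<omega> i = undefined" if "\<not> i < m" for i
        using w that by (auto simp: space_PiM PiE_iff extensional_def)
      have "fun_upd \<omega> m -` S (Suc m) = (if \<omega> \<in> S m then {x m} else {})"
      proof -
        have "fun_upd \<omega> m y \<in> S (Suc m) \<longleftrightarrow> \<omega> \<in> S m \<and> y = x m" for y
          unfolding S_def by (auto simp: fun_eq_iff restrict_def ext less_Suc_eq split: if_splits)
        then show ?thesis by auto
      qed
      then have "emeasure (srw_IT.eP E v m \<omega>) (S (Suc m)) =
          emeasure (srw_kernel E v m \<omega>) (if \<omega> \<in> S m then {x m} else {})"
        using srw_IT.emeasure_eP[OF w S_sets] by simp
      then show "emeasure (srw_IT.eP E v m \<omega>) (S (Suc m)) =
          emeasure (srw_kernel E v m (\<lambda>i\<in>{0..<m}. x i)) {x m} * indicator (S m) \<omega>"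
        by (auto simp: S_def)
    qed
    also have "\<dots> = emeasure (srw_kernel E v m (\<lambda>i\<in>{0..<m}. x i)) {x m} *
      emeasure (srw_IT.C E v 0 m (\<lambda>_. undefined)) (S m)"
      using S_sets[of m] srw_IT.sets_C[of _ 0 E v m, OF u] by (intro nn_integral_cmult_indicator) auto
    finally show ?thesis .
  qed
  have C: "emeasure (srw_IT.C E v 0 (Suc m) (\<lambda>_. undefined)) (S (Suc m)) =
      (if x 0 = v then \<Prod>i<m. ennreal (pmf (pmf_of_set (neighbours E (x i))) (x (Suc i))) else 0)" for m
  proof (induction m)
    case 0
    have "emeasure (srw_IT.C E v 0 0 (\<lambda>_. undefined)) (S 0) = 1"
      using S_sets[of 0] by (simp add: emeasure_return S_def restrict_def)
    then show ?case
      unfolding step[of 0] by (simp add: srw_kernel_def emeasure_pmf_single pmf_return)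
  next
    case (Suc m)
    have "emeasure (srw_kernel E v (Suc m) (\<lambda>i\<in>{0..<Suc m}. x i)) {x (Suc m)} =
        ennreal (pmf (pmf_of_set (neighbours E (x m))) (x (Suc m)))"
      by (simp add: srw_kernel_def emeasure_pmf_single)
    then show ?case
      unfolding step[of "Suc m"] Suc.IH by (simp add: mult.commute)
  qed
  have "{\<omega>. \<forall>i\<le>n. \<omega> i = x i} = prod_emb UNIV ?M {0..<Suc n} (S (Suc n))"
    unfolding S_PiE by (auto simp: prod_emb_def space_PiM PiE_iff less_Suc_eq_le)
  then have "emeasure (srw E v) {\<omega>. \<forall>i\<le>n. \<omega> i = x i} =
      emeasure (srw_IT.C E v 0 (Suc n) (\<lambda>_. undefined)) (S (Suc n))"
    using emeasure_srw_emb[OF S_sets[of "Suc n"]] by simp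
  then show ?thesis
    unfolding C .
qed

end

theory Submission
  imports Defs
begin

text \<open>Let \<open>u n\<close> be the return probabilities, \<open>N T\<close> the number of visits of a walk to the root before time
  \<open>T\<close>, and \<open>U T\<close> its expectation. Two facts determine \<open>k\<close> from the observation.

  First, the frequency of \<open>\<xi>(s + n) = 1\<close> among the times \<open>s\<close> with \<open>\<xi>(s) = 1\<close> tends to \<open>u n\<close>. For one
  walk this is a law of large numbers, because deviations at visits at least \<open>n\<close> steps apart are
  uncorrelated. Several walks do not interfere: \<open>u n\<close> decays at least like \<open>n\<close> to the power \<open>-1/4\<close> on
  every infinite graph (an energy estimate), so that along the first \<open>M\<close> visit times of one walk,
  conditionally on that walk, another one is at the root only \<open>o(M)\<close> times.

  Secondly, \<open>U\<close> is now known. Although \<open>N T / U T\<close> need not converge, its values at times \<open>b i\<close>, where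
  \<open>b i\<close> is the first time with \<open>U (b i) \<ge> 2 ^ i\<close>, have mean 1 and exponentially decaying correlations,
  so that their averages over \<open>i\<close> tend to \<open>1\<close>. Up to collisions the observation counts the visits of
  all walks, and the same average, computed from \<open>\<xi>\<close>, tends to \<open>k\<close>.\<close>

section \<open>The Markov property at the root\<close>

text \<open>Dependence between visits is controlled only through the Markov property at the root at
  fixed times, so the estimates are second moments and the almost sure limits are first taken along
  sparse subsequences. The exponent 1/4 dictates fifth powers for collisions: partial sums of the
  return probabilities over m^5 times are O(m^4), so relative second moments are O(m^-2), which is
  summable. The exponent itself comes from reversibility: \<open>u (2 * t)\<close> is a squared norm
  of the transition density, its decrement in \<open>t\<close> is an energy, and a path along which
  the density drops from its maximum to half of it carries energy of order at least
  \<open>u (2 * t) ^ 4\<close>. For a \<le> b the mean of \<open>N a * N b\<close> is at most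
  \<open>U a * U b + (U a)^2\<close>; after normalisation the covariance is at most
  \<open>U a / U b\<close>, and doubling scales make this geometric. No limit is available for the
  share of one walk in the total number of visits of all walks. Counts are therefore compared with
  that total, which is not observable but cancels in the ratio that estimates
  \<open>u n\<close>.\<close>

lemma measurable_srw_coordinate [measurable]:
  "(\<lambda>\<omega>. \<omega> t) \<in> srw E v \<rightarrow>\<^sub>M count_space UNIV"
  unfolding measurable_cong_sets[OF sets_srw refl]
  by (rule measurable_component_singleton) simp

definition cylinder :: "'v list \<Rightarrow> (nat \<Rightarrow> 'v) set" where
  "cylinder xs = {\<omega>. \<forall>i<length xs. \<omega> i = xs ! i}"

text \<open>One implication suffices, the condition being symmetric in the two trajectories. The
  index is the last time inspected, so the prefix has \<open>Suc n\<close> entries.\<close>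

definition determined_by_prefix :: "nat \<Rightarrow> (nat \<Rightarrow> 'v) set \<Rightarrow> bool" where
  "determined_by_prefix n B \<longleftrightarrow> (\<forall>\<omega> \<omega>'. (\<forall>i\<le>n. \<omega> i = \<omega>' i) \<longrightarrow> \<omega> \<in> B \<longrightarrow> \<omega>' \<in> B)"

definition prefix_lists :: "nat \<Rightarrow> (nat \<Rightarrow> 'v) set \<Rightarrow> 'v list set" where
  "prefix_lists n B = {xs. length xs = Suc n \<and> cylinder xs \<subseteq> B}"

lemma determined_by_prefix_eq_Union:
  assumes "determined_by_prefix n B"
  shows "B = (\<Union>xs\<in>prefix_lists n B. cylinder xs)"
proof
  show "B \<subseteq> (\<Union>xs\<in>prefix_lists n B. cylinder xs)"
  proof
    fix \<omega> assume "\<omega> \<in> B"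
    have "\<omega> \<in> cylinder (map \<omega> [0..<Suc n])"
      by (auto simp: cylinder_def simp del: upt_Suc)
    moreover have "cylinder (map \<omega> [0..<Suc n]) \<subseteq> B"
    proof
      fix \<omega>' assume "\<omega>' \<in> cylinder (map \<omega> [0..<Suc n])"
      then have "\<forall>i\<le>n. \<omega> i = \<omega>' i"
        by (auto simp: cylinder_def less_Suc_eq_le simp del: upt_Suc)
      with assms \<open>\<omega> \<in> B\<close> show "\<omega>' \<in> B"
        unfolding determined_by_prefix_def by blast
    qed
    ultimately show "\<omega> \<in> (\<Union>xs\<in>prefix_lists n B. cylinder xs)"
      by (auto simp: prefix_lists_def simp del: upt_Suc intro!: exI[of _ "map \<omega> [0..<Suc n]"])
  qed
qed (auto simp: prefix_lists_def)

lemma disjoint_cylinders: "disjoint_family_on cylinder (prefix_lists n B)"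
  unfolding disjoint_family_on_def
proof (intro ballI impI)
  fix xs ys
  assume *: "xs \<in> prefix_lists n B" "ys \<in> prefix_lists n B" "xs \<noteq> ys"
  then obtain i where "i < Suc n" "xs ! i \<noteq> ys ! i"
    by (auto simp: prefix_lists_def list_eq_iff_nth_eq)
  with * show "cylinder xs \<inter> cylinder ys = {}"
    by (auto simp: cylinder_def prefix_lists_def)
qed

lemma sets_srw_cylinder [measurable]: "cylinder xs \<in> sets (srw E v)"
proof -
  have "{\<omega> \<in> space (srw E v). \<forall>i<length xs. \<omega> i = xs ! i} \<in> sets (srw E v)"
    by measurable
  then show ?thesis by (simp add: cylinder_def)
qed

lemma sets_srw_determined:
  fixes B :: "(nat \<Rightarrow> 'v::countable) set"
  assumes "determined_by_prefix n B"
  shows "B \<in> sets (srw E v)"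
  by (subst determined_by_prefix_eq_Union[OF assms]) (auto intro!: sets.countable_UN')

text \<open>The cylinders of \<open>prefix_lists\<close> partition \<open>B\<close>, and the
  countable vertex type makes the partition countable. The measure \<open>N\<close> is general
  because the same decomposition later compares two laws.\<close>

lemma emeasure_Int_determined:
  fixes B :: "(nat \<Rightarrow> 'v::countable) set"
  assumes N: "sets N = sets (PiM UNIV (\<lambda>_. count_space UNIV))"
    and "determined_by_prefix n B" and D: "D \<in> sets N"
  shows "emeasure N (D \<inter> B) =
    (\<integral>\<^sup>+xs. emeasure N (D \<inter> cylinder xs) \<partial>count_space (prefix_lists n B))"
proof -
  have "D \<inter> B = (\<Union>xs\<in>prefix_lists n B. D \<inter> cylinder xs)"
    by (subst determined_by_prefix_eq_Union[OF assms(2)]) auto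
  moreover have "disjoint_family_on (\<lambda>xs. D \<inter> cylinder xs) (prefix_lists n B)"
    using disjoint_cylinders[of n B] by (auto simp: disjoint_family_on_def)
  moreover have "cylinder xs \<in> sets N" for xs :: "'v list"
    using sets_srw_cylinder[of xs] by (simp only: N sets_srw)
  ultimately show ?thesis
    using D by (simp only:) (intro emeasure_UN_countable, auto)
qed

lemmas emeasure_srw_Int_determined = emeasure_Int_determined[OF sets_srw]

definition path_shift :: "nat \<Rightarrow> (nat \<Rightarrow> 'v) \<Rightarrow> nat \<Rightarrow> 'v" where
  "path_shift t \<omega> = (\<lambda>i. \<omega> (t + i))"

lemma determined_by_prefix_shift:
  assumes "determined_by_prefix n C"
  shows "determined_by_prefix (t + n) (path_shift t -` C)"
  using assms unfolding determined_by_prefix_def path_shift_def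
  by (metis (no_types, lifting) add_le_cancel_left vimageE vimageI)

lemma emeasure_srw_cylinder_list:
  assumes "length xs = Suc n"
  shows "emeasure (srw E v) (cylinder xs) =
    (if xs ! 0 = v then \<Prod>i<n. ennreal (pmf (pmf_of_set (neighbours E (xs ! i))) (xs ! Suc i)) else 0)"
  using emeasure_srw_cylinder[of E v n "\<lambda>i. xs ! i"] assms by (simp add: cylinder_def less_Suc_eq_le)

text \<open>A history ending at the root and a future starting there concatenate to a single path,
  and path weights multiply because each factor depends on one step only.\<close>

lemma emeasure_srw_cylinder_shift:
  assumes xs: "length xs = Suc t" "xs ! t = v" and ys: "length ys = Suc n"
  shows "emeasure (srw E v) (cylinder xs \<inter> path_shift t -` cylinder ys) =
    emeasure (srw E v) (cylinder xs) * emeasure (srw E v) (cylinder ys)"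
proof (cases "ys ! 0 = v")
  case False
  have "cylinder xs \<inter> path_shift t -` cylinder ys = {}"
    using xs ys False by (force simp: cylinder_def path_shift_def)
  with False show ?thesis
    using ys by (simp add: emeasure_srw_cylinder_list)
next
  case True
  \<comment> \<open>The last entry of \<open>xs\<close> and the first of \<open>ys\<close> are the
    same vertex \<open>v\<close> at time \<open>t\<close>, hence \<open>tl\<close>.\<close>
  define zs where "zs = xs @ tl ys"
  have len: "length zs = Suc (t + n)" using xs ys by (simp add: zs_def)
  have z1: "zs ! i = xs ! i" if "i \<le> t" for i
    using that xs by (simp add: zs_def nth_append)
  have z2: "zs ! (t + i) = ys ! i" if "i \<le> n" for i
  proof (cases i)
    case 0
    then show ?thesis using z1[of t] xs True by simp
  next
    case (Suc j)
    then show ?thesis using xs ys that by (simp add: zs_def nth_append nth_tl)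
  qed
  have "cylinder xs \<inter> path_shift t -` cylinder ys = cylinder zs"
  proof (intro set_eqI iffI)
    fix \<omega> assume w: "\<omega> \<in> cylinder xs \<inter> path_shift t -` cylinder ys"
    have "\<omega> i = zs ! i" if "i < Suc (t + n)" for i
    proof (cases "i \<le> t")
      case True
      then show ?thesis using w xs z1 by (auto simp: cylinder_def)
    next
      case False
      have "\<omega> (t + j) = ys ! j" if "j < Suc n" for j
        using w ys that by (simp add: cylinder_def path_shift_def)
      from this[of "i - t"] show ?thesis using False that z2[of "i - t"] by simp
    qed
    then show "\<omega> \<in> cylinder zs" using len by (simp add: cylinder_def)
  next
    fix \<omega> assume w: "\<omega> \<in> cylinder zs"
    then have w: "\<omega> i = zs ! i" if "i < Suc (t + n)" for i
      using len that by (simp add: cylinder_def)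
    then show "\<omega> \<in> cylinder xs \<inter> path_shift t -` cylinder ys"
      using xs ys z1 z2 by (auto simp: cylinder_def path_shift_def)
  qed
  moreover have "(\<Prod>i<t + n. ennreal (pmf (pmf_of_set (neighbours E (zs ! i))) (zs ! Suc i))) =
    (\<Prod>i<t. ennreal (pmf (pmf_of_set (neighbours E (xs ! i))) (xs ! Suc i))) *
    (\<Prod>i<n. ennreal (pmf (pmf_of_set (neighbours E (ys ! i))) (ys ! Suc i)))"
  proof -
    have "(\<Prod>i<t + m. ennreal (pmf (pmf_of_set (neighbours E (zs ! i))) (zs ! Suc i))) =
      (\<Prod>i<t. ennreal (pmf (pmf_of_set (neighbours E (xs ! i))) (xs ! Suc i))) *
      (\<Prod>i<m. ennreal (pmf (pmf_of_set (neighbours E (ys ! i))) (ys ! Suc i)))" if "m \<le> n" for m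
      using that
    proof (induction m)
      case 0
      then show ?case using z1 by (auto intro!: prod.cong)
    next
      case (Suc m)
      then show ?case using z2[of m] z2[of "Suc m"] by (simp add: mult.assoc)
    qed
    then show ?thesis by simp
  qed
  ultimately show ?thesis
    using emeasure_srw_cylinder_list[OF len, of E v] emeasure_srw_cylinder_list[OF xs(1), of E v]
      emeasure_srw_cylinder_list[OF ys, of E v] True z1[of 0]
    by auto
qed

lemma determined_by_prefix_mono: "determined_by_prefix n B \<Longrightarrow> n \<le> m \<Longrightarrow> determined_by_prefix m B"
  unfolding determined_by_prefix_def by (meson le_trans)

text \<open>Both events split into cylinders, where the claim is concatenation of paths.
  Conditioning at the root makes the law of the future \<open>srw E v\<close> again, so that no walk
  from another vertex is involved.\<close>

proposition srw_markov:
  fixes B C :: "(nat \<Rightarrow> 'v::countable) set"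
  assumes B: "determined_by_prefix t B" and Bv: "B \<subseteq> {\<omega>. \<omega> t = v}"
    and C: "determined_by_prefix n C"
  shows "measure (srw E v) (B \<inter> path_shift t -` C) = measure (srw E v) B * measure (srw E v) C"
proof -
  let ?M = "srw E v"
  interpret prob_space ?M by (rule prob_space_srw)
  have shift_sets: "path_shift t -` C \<in> sets ?M" if "determined_by_prefix n C" for C n
    by (rule sets_srw_determined[OF determined_by_prefix_shift[OF that]])
  have det_cyl: "determined_by_prefix (length xs) (cylinder xs)" for xs :: "'v list"
    by (auto simp: determined_by_prefix_def cylinder_def)
  have cyl: "emeasure ?M (path_shift t -` cylinder ys \<inter> B) = emeasure ?M B * emeasure ?M (cylinder ys)"
    if ys: "length ys = Suc n" for ys
  proof -
    have "emeasure ?M (path_shift t -` cylinder ys \<inter> B) =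
      (\<integral>\<^sup>+xs. emeasure ?M (path_shift t -` cylinder ys \<inter> cylinder xs) \<partial>count_space (prefix_lists t B))"
      by (intro emeasure_srw_Int_determined B shift_sets[OF det_cyl])
    also have "\<dots> = (\<integral>\<^sup>+xs. emeasure ?M (cylinder xs) * emeasure ?M (cylinder ys) \<partial>count_space (prefix_lists t B))"
    proof (intro nn_integral_cong)
      fix xs assume "xs \<in> space (count_space (prefix_lists t B))"
      then have xs: "length xs = Suc t" "cylinder xs \<subseteq> B" by (auto simp: prefix_lists_def)
      \<comment> \<open>The cylinder is nonempty, so the constraint \<open>Bv\<close> can be read
        off on this witness and fixes the last entry of \<open>xs\<close>.\<close>
      have "(\<lambda>i. xs ! i) \<in> cylinder xs" by (simp add: cylinder_def)
      then have "xs ! t = v" using Bv xs by blast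
      then show "emeasure ?M (path_shift t -` cylinder ys \<inter> cylinder xs) = emeasure ?M (cylinder xs) * emeasure ?M (cylinder ys)"
        using emeasure_srw_cylinder_shift[OF xs(1) _ ys] by (simp add: Int_commute)
    qed
    also have "\<dots> = (\<integral>\<^sup>+xs. emeasure ?M (UNIV \<inter> cylinder xs) \<partial>count_space (prefix_lists t B)) * emeasure ?M (cylinder ys)"
      by (simp add: nn_integral_multc)
    also have "\<dots> = emeasure ?M (UNIV \<inter> B) * emeasure ?M (cylinder ys)"
      using sets.top[of ?M] by (subst emeasure_srw_Int_determined[OF B]) auto
    finally show ?thesis by simp
  qed
  have "path_shift t -` C = (\<Union>ys\<in>prefix_lists n C. path_shift t -` cylinder ys)"
    by (subst determined_by_prefix_eq_Union[OF C]) auto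
  then have "B \<inter> path_shift t -` C = (\<Union>ys\<in>prefix_lists n C. path_shift t -` cylinder ys \<inter> B)"
    by auto
  moreover have "disjoint_family_on (\<lambda>ys. path_shift t -` cylinder ys \<inter> B) (prefix_lists n C)"
    using disjoint_cylinders[of n C] by (fastforce simp: disjoint_family_on_def)
  ultimately have "emeasure ?M (B \<inter> path_shift t -` C) =
      (\<integral>\<^sup>+ys. emeasure ?M (path_shift t -` cylinder ys \<inter> B) \<partial>count_space (prefix_lists n C))"
    using shift_sets[OF det_cyl] sets_srw_determined[OF B, of E v]
    by (simp only:) (intro emeasure_UN_countable, auto)
  also have "\<dots> = (\<integral>\<^sup>+ys. emeasure ?M B * emeasure ?M (UNIV \<inter> cylinder ys) \<partial>count_space (prefix_lists n C))"
    by (intro nn_integral_cong) (auto simp: cyl prefix_lists_def)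
  also have "\<dots> = emeasure ?M B * (\<integral>\<^sup>+ys. emeasure ?M (UNIV \<inter> cylinder ys) \<partial>count_space (prefix_lists n C))"
    by (rule nn_integral_cmult) simp
  also have "\<dots> = emeasure ?M B * emeasure ?M (UNIV \<inter> C)"
    using sets.top[of ?M] by (subst emeasure_srw_Int_determined[OF C]) auto
  finally show ?thesis
    by (simp add: emeasure_eq_measure ennreal_mult[symmetric])
qed

section \<open>Visits to the root\<close>

text \<open>A countable vertex type makes every event determined by a prefix a countable union of
  cylinders; other vertex types are reached by copying the graph into the natural numbers.\<close>

locale recurrent_rooted_graph =
  fixes V :: "'v::countable set" and E :: "'v \<Rightarrow> 'v \<Rightarrow> bool" and v :: 'v
  assumes simple: "simple_graph V E" and infinite_V: "infinite V"
    and connected: "connected_graph V E" and locally_finite: "locally_finite_graph V E"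
    and recurrent: "recurrent_graph V E" and root: "v \<in> V"
begin

sublocale prob_space "srw E v"
  by (rule prob_space_srw)

definition return_prob :: "nat \<Rightarrow> real" where
  "return_prob n = prob {\<omega>. \<omega> n = v}"

text \<open>The truncated Green function at the root, called \<open>U\<close> in the
  overview.\<close>

definition green :: "nat \<Rightarrow> real" where
  "green T = (\<Sum>t<T. return_prob t)"

lemma return_prob_nonneg [simp]: "0 \<le> return_prob n"
  and return_prob_le_1 [simp]: "return_prob n \<le> 1"
  by (simp_all add: return_prob_def)

lemma events_determined: "determined_by_prefix n B \<Longrightarrow> B \<in> events"
  by (rule sets_srw_determined)

lemma determined_visit: "determined_by_prefix n {\<omega>. \<omega> n = x}"
  by (auto simp: determined_by_prefix_def)

lemma events_visit [measurable, simp]: "{\<omega>. \<omega> n = x} \<in> events"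
  by (rule events_determined[OF determined_visit])

lemma AE_start: "AE \<omega> in srw E v. \<omega> 0 = v"
proof -
  have "emeasure (srw E v) {\<omega>. \<omega> 0 = v} = 1"
    using emeasure_srw_cylinder[of E v 0 "\<lambda>_. v"] by simp
  then have "prob {\<omega>. \<omega> 0 = v} = 1"
    by (simp add: measure_def)
  then show ?thesis
    using prob_eq_1[of "{\<omega>. \<omega> 0 = v}"] by simp
qed

lemma return_prob_0 [simp]: "return_prob 0 = 1"
  using AE_start prob_eq_1[of "{\<omega>. \<omega> 0 = v}"] by (simp add: return_prob_def)

lemma prob_visit_after:
  assumes "determined_by_prefix t B" "B \<subseteq> {\<omega>. \<omega> t = v}"
  shows "prob {\<omega> \<in> B. \<omega> (t + n) = v} = prob B * return_prob n"
proof -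
  have "B \<inter> path_shift t -` {\<omega>. \<omega> n = v} = {\<omega> \<in> B. \<omega> (t + n) = v}"
    by (auto simp: path_shift_def)
  with srw_markov[where B = B and E = E, OF assms determined_visit[of n v]] show ?thesis
    by (simp add: return_prob_def)
qed

lemma prob_two_visits:
  assumes "s \<le> t"
  shows "prob {\<omega>. \<omega> s = v \<and> \<omega> t = v} = return_prob s * return_prob (t - s)"
  using prob_visit_after[OF determined_visit, of s v "t - s"] assms
  by (simp add: return_prob_def)

text \<open>Recurrence speaks of the first return only. The Markov property at time \<open>t\<close>
  applies to avoidance of the root for \<open>m\<close> further steps, an event \<open>C m\<close>
  determined by a prefix; its probability tends to 0 by recurrence.\<close>

lemma AE_returns: "AE \<omega> in srw E v. \<forall>t. \<omega> t = v \<longrightarrow> (\<exists>t'>t. \<omega> t' = v)"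
proof (subst AE_all_countable, intro allI)
  fix t
  define C where "C m = {\<omega> :: nat \<Rightarrow> 'v. \<forall>i\<in>{1..m}. \<omega> i \<noteq> v}" for m :: nat
  have det_C: "determined_by_prefix m (C m)" for m
    by (auto simp: determined_by_prefix_def C_def)
  have C_sets: "C m \<in> events" for m by (rule events_determined[OF det_C])
  have Inter: "(\<Inter>m. C m) = {\<omega>. \<forall>i>0. \<omega> i \<noteq> v}"
  proof (intro set_eqI iffI)
    fix \<omega> assume \<omega>: "\<omega> \<in> (\<Inter>m. C m)"
    have "\<omega> i \<noteq> v" if "i > 0" for i
    proof -
      have "\<omega> \<in> C i" using \<omega> by blast
      moreover have "i \<in> {1..i}" using that by simp
      ultimately show ?thesis unfolding C_def by blast
    qed
    then show "\<omega> \<in> {\<omega>. \<forall>i>0. \<omega> i \<noteq> v}" by simp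
  qed (simp add: C_def)
  have "prob {\<omega>. \<forall>i>0. \<omega> i \<noteq> v} = 0"
  proof -
    have "AE \<omega> in srw E v. \<exists>t>0. \<omega> t = v"
      using recurrent root by (auto simp: recurrent_graph_def)
    then have "AE \<omega> in srw E v. \<omega> \<notin> {\<omega>. \<forall>i>0. \<omega> i \<noteq> v}" by eventually_elim auto
    moreover have "{\<omega>. \<forall>i>0. \<omega> i \<noteq> v} \<in> events"
      unfolding Inter[symmetric] using C_sets by auto
    ultimately show ?thesis by (simp add: prob_eq_0)
  qed
  moreover have "(\<lambda>m. prob (C m)) \<longlonglongrightarrow> prob (\<Inter>m. C m)"
  proof (rule finite_Lim_measure_decseq)
    show "range C \<subseteq> events" using C_sets by blast
    show "decseq C" by (auto simp: decseq_def C_def)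
  qed
  ultimately have lim: "(\<lambda>m. prob (C m)) \<longlonglongrightarrow> 0" by (simp only: Inter)
  let ?N = "{\<omega> :: nat \<Rightarrow> 'v. \<omega> t = v \<and> (\<forall>t'>t. \<omega> t' \<noteq> v)}"
  have N_sets: "?N \<in> events"
  proof -
    have "?N = {\<omega> \<in> space (srw E v). \<omega> t = v \<and> (\<forall>t'\<in>{t<..}. \<omega> t' \<noteq> v)}" by auto
    also have "\<dots> \<in> events" by measurable
    finally show ?thesis .
  qed
  have "prob ?N \<le> prob (C m)" for m
  proof -
    have "prob ?N \<le> prob ({\<omega>. \<omega> t = v} \<inter> path_shift t -` C m)"
      by (intro finite_measure_mono events_determined[of "t + m"])
         (auto simp: path_shift_def C_def determined_by_prefix_def)
    also have "\<dots> = prob {\<omega>. \<omega> t = v} * prob (C m)"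
      by (rule srw_markov[OF determined_visit _ det_C]) simp
    also have "\<dots> \<le> 1 * prob (C m)" by (intro mult_right_mono) auto
    finally show ?thesis by simp
  qed
  then have "prob ?N \<le> 0" by (intro LIMSEQ_le_const[OF lim]) auto
  then have "prob ?N = 0" by (simp add: measure_le_0_iff)
  then have "AE \<omega> in srw E v. \<omega> \<notin> ?N" using N_sets by (simp add: prob_eq_0)
  then show "AE \<omega> in srw E v. \<omega> t = v \<longrightarrow> (\<exists>t'>t. \<omega> t' = v)" by (rule AE_mp) (intro AE_I2, blast)
qed

lemma AE_infinitely_many_visits: "AE \<omega> in srw E v. infinite {t. \<omega> t = v}"
  using AE_start AE_returns
proof eventually_elim
  fix \<omega> :: "nat \<Rightarrow> 'v" assume 0: "\<omega> 0 = v" and ret: "\<forall>t. \<omega> t = v \<longrightarrow> (\<exists>t'>t. \<omega> t' = v)"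
  show "infinite {t. \<omega> t = v}"
  proof
    assume fin: "finite {t. \<omega> t = v}"
    then have "\<omega> (Max {t. \<omega> t = v}) = v" using Max_in[OF fin] 0 by blast
    then obtain t' where "t' > Max {t. \<omega> t = v}" "\<omega> t' = v" using ret by blast
    then show False using Max_ge[OF fin, of t'] by simp
  qed
qed

lemma green_mono: "a \<le> b \<Longrightarrow> green a \<le> green b"
  unfolding green_def by (intro sum_mono2) auto

lemma green_nonneg: "0 \<le> green a"
  unfolding green_def by (intro sum_nonneg) auto

text \<open>If the return probabilities were summable, Borel-Cantelli would leave only finitely many
  visits.\<close>

lemma green_at_top: "filterlim green at_top sequentially"
proof -
  have "\<not> summable return_prob"
  proof
    assume "summable return_prob"
    then have "AE \<omega> in srw E v. eventually (\<lambda>n. \<omega> \<in> space (srw E v) - {\<omega>. \<omega> n = v}) sequentially"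
      by (intro borel_cantelli_AE1) (simp_all add: return_prob_def[abs_def] emeasure_eq_measure)
    with AE_infinitely_many_visits have "AE \<omega> in srw E v. False"
    proof eventually_elim
      fix \<omega> :: "nat \<Rightarrow> 'v" assume "infinite {t. \<omega> t = v}"
        "eventually (\<lambda>n. \<omega> \<in> space (srw E v) - {\<omega>. \<omega> n = v}) sequentially"
      then show False
        by (auto simp: eventually_sequentially infinite_nat_iff_unbounded_le)
    qed
    then show False by simp
  qed
  then have "\<exists>T. green T > Z" for Z
    using summableI_nonneg_bounded[of return_prob Z] unfolding green_def
    by (meson not_le return_prob_nonneg)
  then show ?thesis
    unfolding filterlim_at_top eventually_sequentially
    by (meson green_mono less_imp_le order.trans)
qed

section \<open>Decay of the return probabilities\<close>

definition deg :: "'v \<Rightarrow> real" where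
  "deg x = real (card (neighbours E x))"

lemma adj_sym: "E x y \<Longrightarrow> E y x"
  using simple by (auto simp: simple_graph_def symp_def)

lemma adj_in_V: "E x y \<Longrightarrow> x \<in> V \<and> y \<in> V"
  using simple by (auto simp: simple_graph_def)

lemma finite_neighbours [simp]: "finite (neighbours E x)"
proof (cases "x \<in> V")
  case True
  then show ?thesis using locally_finite by (simp add: locally_finite_graph_def)
next
  case False
  then have "neighbours E x = {}" by (auto simp: neighbours_def dest: adj_in_V)
  then show ?thesis by simp
qed

lemma neighbours_nonempty:
  assumes "x \<in> V"
  shows "neighbours E x \<noteq> {}"
proof -
  have "\<not> V \<subseteq> {x}" using infinite_V finite_subset by blast
  then obtain y where "y \<in> V" "y \<noteq> x" by blast
  then have "E\<^sup>*\<^sup>* x y" using connected assms by (simp add: connected_graph_def)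
  then show ?thesis using \<open>y \<noteq> x\<close> by (auto simp: neighbours_def elim: converse_rtranclpE)
qed

lemma deg_ge_1: "x \<in> V \<Longrightarrow> 1 \<le> deg x"
  using neighbours_nonempty[of x] by (simp add: deg_def Suc_le_eq card_gt_0_iff)

lemma deg_pos: "x \<in> V \<Longrightarrow> 0 < deg x"
  using deg_ge_1[of x] by simp

lemma deg_nonneg [simp]: "0 \<le> deg x"
  by (simp add: deg_def)

text \<open>\<open>hit t x\<close> is the probability that the walk started at \<open>x\<close> is at the root at time \<open>t\<close>. By
  reversibility it is the density of the law at time \<open>t\<close> of the walk started at the root.\<close>

primrec hit :: "nat \<Rightarrow> 'v \<Rightarrow> real" where
  "hit 0 x = (if x = v then 1 else 0)"
| "hit (Suc t) x = (\<Sum>y\<in>neighbours E x. hit t y) / deg x"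

declare hit.simps(2) [simp del]

lemma hit_nonneg [simp]: "0 \<le> hit t x"
  by (induction t arbitrary: x) (auto simp: hit.simps(2) intro!: divide_nonneg_nonneg sum_nonneg)

lemma deg_mult_hit_Suc: "deg x * hit (Suc t) x = (\<Sum>y\<in>neighbours E x. hit t y)"
  by (cases "neighbours E x = {}") (auto simp: deg_def hit.simps(2))

text \<open>\<open>srw_markov\<close> conditions at the root; the step out of a general vertex
  \<open>y\<close> comes from appending \<open>x\<close> to every prefix that ends in
  \<open>y\<close>.\<close>

lemma prob_step:
  "emeasure (srw E v) ({\<omega>. \<omega> (Suc t) = x} \<inter> {\<omega>. \<omega> t = y}) =
    emeasure (srw E v) {\<omega>. \<omega> t = y} * ennreal (pmf (pmf_of_set (neighbours E y)) x)"
proof -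
  have step: "emeasure (srw E v) ({\<omega>. \<omega> (Suc t) = x} \<inter> cylinder xs) =
      emeasure (srw E v) (UNIV \<inter> cylinder xs) * ennreal (pmf (pmf_of_set (neighbours E y)) x)"
    if "xs \<in> prefix_lists t {\<omega>. \<omega> t = y}" for xs
  proof -
    have len: "length xs = Suc t" and sub: "cylinder xs \<subseteq> {\<omega>. \<omega> t = y}"
      using that by (auto simp: prefix_lists_def)
    have "(\<lambda>i. xs ! i) \<in> cylinder xs" by (simp add: cylinder_def)
    then have y: "xs ! t = y" using sub by blast
    have "{\<omega>. \<omega> (Suc t) = x} \<inter> cylinder xs = cylinder (xs @ [x])"
      using len by (auto simp: cylinder_def nth_append less_Suc_eq)
    then show ?thesis
      using len y emeasure_srw_cylinder_list[of xs t E v]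
        emeasure_srw_cylinder_list[of "xs @ [x]" "Suc t" E v]
      by (simp add: nth_append)
  qed
  have "emeasure (srw E v) ({\<omega>. \<omega> (Suc t) = x} \<inter> {\<omega>. \<omega> t = y}) =
    (\<integral>\<^sup>+xs. emeasure (srw E v) ({\<omega>. \<omega> (Suc t) = x} \<inter> cylinder xs) \<partial>count_space (prefix_lists t {\<omega>. \<omega> t = y}))"
    by (intro emeasure_srw_Int_determined determined_visit) simp
  also have "\<dots> = (\<integral>\<^sup>+xs. emeasure (srw E v) (UNIV \<inter> cylinder xs) * ennreal (pmf (pmf_of_set (neighbours E y)) x)
      \<partial>count_space (prefix_lists t {\<omega>. \<omega> t = y}))"
    by (intro nn_integral_cong) (auto simp: step)
  also have "\<dots> = (\<integral>\<^sup>+xs. emeasure (srw E v) (UNIV \<inter> cylinder xs) \<partial>count_space (prefix_lists t {\<omega>. \<omega> t = y}))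
      * ennreal (pmf (pmf_of_set (neighbours E y)) x)"
    by (rule nn_integral_multc) simp
  also have "\<dots> = emeasure (srw E v) (UNIV \<inter> {\<omega>. \<omega> t = y}) * ennreal (pmf (pmf_of_set (neighbours E y)) x)"
    using sets.top[of "srw E v"] by (subst emeasure_srw_Int_determined[OF determined_visit]) auto
  finally show ?thesis by simp
qed

text \<open>Reversibility with respect to \<open>deg\<close>: \<open>hit\<close> recurses on the
  first step of a walk towards the root, the law on the last step of a walk from it, and the degrees
  exchange the two.\<close>

lemma prob_at: "prob {\<omega>. \<omega> t = x} = deg x * hit t x / deg v"
proof (induction t arbitrary: x)
  case 0
  show ?case
  proof (cases "x = v")
    case True
    then show ?thesis using return_prob_0 deg_pos[OF root] by (simp add: return_prob_def)
  next
    case False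
    have "AE \<omega> in srw E v. \<omega> \<notin> {\<omega>. \<omega> 0 = x}"
      using AE_start by eventually_elim (use False in auto)
    then show ?thesis using False by (simp add: prob_eq_0)
  qed
next
  case (Suc t)
  \<comment> \<open>For \<open>y\<close> outside \<open>V\<close> the set of neighbours is empty and
    \<open>pmf_of_set\<close> is meaningless there; the induction hypothesis then gives probability
    0 because \<open>deg y\<close> is 0.\<close>
  have zero: "prob {\<omega>. \<omega> t = y} * pmf (pmf_of_set (neighbours E y)) x = 0" if "y \<notin> neighbours E x" for y
  proof (cases "y \<in> V")
    case True
    then have "pmf (pmf_of_set (neighbours E y)) x = indicator (neighbours E y) x / deg y"
      unfolding deg_def by (intro pmf_of_set neighbours_nonempty finite_neighbours)
    moreover have "x \<notin> neighbours E y" using that by (auto simp: neighbours_def dest: adj_sym)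
    ultimately show ?thesis by simp
  next
    case False
    then have "neighbours E y = {}" by (auto simp: neighbours_def dest: adj_in_V)
    then have "deg y = 0" by (simp add: deg_def)
    then show ?thesis by (simp add: Suc)
  qed
  have nz: "prob {\<omega>. \<omega> t = y} * pmf (pmf_of_set (neighbours E y)) x = hit t y / deg v" if "y \<in> neighbours E x" for y
  proof -
    have y: "y \<in> V" using that adj_in_V by (auto simp: neighbours_def)
    then have "pmf (pmf_of_set (neighbours E y)) x = indicator (neighbours E y) x / deg y"
      unfolding deg_def by (intro pmf_of_set neighbours_nonempty finite_neighbours)
    moreover have "x \<in> neighbours E y" using that by (auto simp: neighbours_def dest: adj_sym)
    ultimately show ?thesis using deg_pos[OF y] by (simp add: Suc)
  qed
  have "{\<omega>. \<omega> (Suc t) = x} = (\<Union>y. {\<omega>. \<omega> (Suc t) = x} \<inter> {\<omega>. \<omega> t = y})" by auto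
  then have "emeasure (srw E v) {\<omega>. \<omega> (Suc t) = x} =
      emeasure (srw E v) (\<Union>y. {\<omega>. \<omega> (Suc t) = x} \<inter> {\<omega>. \<omega> t = y})" by simp
  also have "\<dots> = (\<integral>\<^sup>+y. emeasure (srw E v) ({\<omega>. \<omega> (Suc t) = x} \<inter> {\<omega>. \<omega> t = y}) \<partial>count_space UNIV)"
    by (intro emeasure_UN_countable) (auto simp: disjoint_family_on_def)
  also have "\<dots> = (\<integral>\<^sup>+y. ennreal (prob {\<omega>. \<omega> t = y} * pmf (pmf_of_set (neighbours E y)) x) \<partial>count_space UNIV)"
    by (intro nn_integral_cong) (simp only: prob_step, simp add: emeasure_eq_measure ennreal_mult)
  also have "\<dots> = (\<Sum>y\<in>neighbours E x. ennreal (prob {\<omega>. \<omega> t = y} * pmf (pmf_of_set (neighbours E y)) x))"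
    by (intro nn_integral_count_space') (auto simp: zero)
  also have "\<dots> = (\<Sum>y\<in>neighbours E x. ennreal (hit t y / deg v))"
    by (intro sum.cong) (simp_all add: nz)
  also have "\<dots> = ennreal (\<Sum>y\<in>neighbours E x. hit t y / deg v)"
    by (intro sum_ennreal) auto
  also have "(\<Sum>y\<in>neighbours E x. hit t y / deg v) = deg x * hit (Suc t) x / deg v"
    unfolding deg_mult_hit_Suc by (simp add: sum_divide_distrib)
  finally show ?case by (simp add: emeasure_eq_measure)
qed

lemma return_prob_eq_hit: "return_prob t = hit t v"
  using deg_pos[OF root] by (simp add: return_prob_def prob_at)

section \<open>Symmetry of the transition operator and the energy identity\<close>

text \<open>Contains the support of \<open>hit n\<close>, so that pairings over the infinite graph
  become finite sums.\<close>

primrec root_ball :: "nat \<Rightarrow> 'v set" where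
  "root_ball 0 = {v}"
| "root_ball (Suc n) = root_ball n \<union> (\<Union>x\<in>root_ball n. neighbours E x)"

lemma finite_root_ball [simp]: "finite (root_ball n)"
  by (induction n) auto

lemma root_ball_mono: "m \<le> n \<Longrightarrow> root_ball m \<subseteq> root_ball n"
  by (rule lift_Suc_mono_le[of root_ball]) auto

lemma root_in_ball [simp]: "v \<in> root_ball n"
  using root_ball_mono[of 0 n] by auto

lemma hit_outside_ball: "x \<notin> root_ball t \<Longrightarrow> hit t x = 0"
proof (induction t arbitrary: x)
  case (Suc t)
  have "hit t y = 0" if "y \<in> neighbours E x" for y
    using that Suc adj_sym by (auto simp: neighbours_def)
  then show ?case by (simp add: hit.simps(2))
qed auto

lemma sum_neighbours_eq:
  assumes "finite G" "\<And>y. y \<notin> G \<Longrightarrow> f y = (0::real)"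
  shows "(\<Sum>y\<in>neighbours E x. f y) = (\<Sum>y\<in>G. of_bool (E x y) * f y)"
proof -
  have "(\<Sum>y\<in>neighbours E x. f y) = (\<Sum>y\<in>neighbours E x \<inter> G. f y)"
    using assms by (intro sum.mono_neutral_right) auto
  also have "\<dots> = (\<Sum>y\<in>G. of_bool (E x y) * f y)"
    using assms by (intro sum.mono_neutral_cong_left) (auto simp: neighbours_def)
  finally show ?thesis .
qed

text \<open>The transition operator is self-adjoint in the inner product weighted by
  \<open>deg\<close>: with the degrees cancelled, both sides are the same double sum over adjacent
  pairs.\<close>

lemma hit_pairing_shift:
  assumes "s \<le> n" "t \<le> n"
  shows "(\<Sum>x\<in>root_ball n. deg x * hit (Suc s) x * hit t x) = (\<Sum>x\<in>root_ball n. deg x * hit s x * hit (Suc t) x)"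
proof -
  let ?G = "root_ball n"
  have out: "hit r y = 0" if "r \<le> n" "y \<notin> ?G" for r y
    using that root_ball_mono[of r n] hit_outside_ball by blast
  have adj: "E x y = E y x" for x y using adj_sym by blast
  have nb: "sum (hit r) (neighbours E x) = (\<Sum>y\<in>?G. of_bool (E x y) * hit r y)" if "r \<le> n" for r x
    by (intro sum_neighbours_eq finite_root_ball out that)
  have "(\<Sum>x\<in>?G. deg x * hit (Suc s) x * hit t x) = (\<Sum>x\<in>?G. (\<Sum>y\<in>?G. of_bool (E x y) * hit s y) * hit t x)"
    by (simp only: deg_mult_hit_Suc nb[OF assms(1)])
  also have "\<dots> = (\<Sum>x\<in>?G. \<Sum>y\<in>?G. of_bool (E x y) * hit s y * hit t x)"
    by (simp only: sum_distrib_right)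
  also have "\<dots> = (\<Sum>y\<in>?G. \<Sum>x\<in>?G. of_bool (E x y) * hit s y * hit t x)"
    by (rule sum.swap)
  also have "\<dots> = (\<Sum>y\<in>?G. hit s y * (\<Sum>x\<in>?G. of_bool (E y x) * hit t x))"
    unfolding sum_distrib_left by (intro sum.cong refl) (simp add: adj)
  also have "\<dots> = (\<Sum>y\<in>?G. hit s y * (deg y * hit (Suc t) y))"
    by (simp only: deg_mult_hit_Suc nb[OF assms(2)])
  finally show ?thesis by (simp add: mult_ac)
qed

text \<open>Self-adjointness moves all steps to one factor until the other is the indicator of the
  root. For \<open>s = t\<close> this exhibits an even return probability as a squared norm.\<close>

lemma hit_pairing:
  assumes "s + t \<le> n"
  shows "(\<Sum>x\<in>root_ball n. deg x * hit s x * hit t x) = deg v * return_prob (s + t)"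
  using assms
proof (induction s arbitrary: t)
  case 0
  have "(\<Sum>x\<in>root_ball n. deg x * hit 0 x * hit t x) = (\<Sum>x\<in>{v}. deg x * hit 0 x * hit t x)"
    by (intro sum.mono_neutral_right) auto
  then show ?case by (simp add: return_prob_eq_hit)
next
  case (Suc s)
  then have "(\<Sum>x\<in>root_ball n. deg x * hit (Suc s) x * hit t x) = (\<Sum>x\<in>root_ball n. deg x * hit s x * hit (Suc t) x)"
    by (intro hit_pairing_shift) auto
  also have "\<dots> = deg v * return_prob (s + Suc t)" using Suc by (intro Suc.IH) auto
  finally show ?case by simp
qed

text \<open>\<open>hit (Suc t) x\<close> is the mean of \<open>hit t\<close> over the neighbours of
  \<open>x\<close>, so each inner sum is \<open>deg x\<close> times a variance: mean of the squares
  minus square of the mean. Summation gives the difference of two squared norms.\<close>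

lemma return_prob_energy:
  assumes "2 * t + 2 \<le> n"
  shows "(\<Sum>x\<in>root_ball n. \<Sum>y\<in>neighbours E x. (hit t y - hit (Suc t) x)\<^sup>2) =
    deg v * (return_prob (2 * t) - return_prob (2 * t + 2))"
proof -
  let ?G = "root_ball n"
  have out: "hit t y = 0" if "y \<notin> root_ball t" for y
    using that hit_outside_ball by blast
  have "(\<Sum>y\<in>neighbours E x. (hit t y - hit (Suc t) x)\<^sup>2) =
      (\<Sum>y\<in>neighbours E x. (hit t y)\<^sup>2) - deg x * hit (Suc t) x * hit (Suc t) x" for x
  proof -
    have "(\<Sum>y\<in>neighbours E x. (hit t y - hit (Suc t) x)\<^sup>2) =
       (\<Sum>y\<in>neighbours E x. (hit t y)\<^sup>2) - 2 * hit (Suc t) x * (\<Sum>y\<in>neighbours E x. hit t y)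
         + deg x * (hit (Suc t) x)\<^sup>2"
      by (simp only: power2_diff sum.distrib sum_subtractf sum_distrib_left sum_constant)
         (simp add: mult_ac deg_def)
    then show ?thesis unfolding deg_mult_hit_Suc[symmetric] by (simp add: power2_eq_square algebra_simps)
  qed
  then have "(\<Sum>x\<in>?G. \<Sum>y\<in>neighbours E x. (hit t y - hit (Suc t) x)\<^sup>2) =
     (\<Sum>x\<in>?G. \<Sum>y\<in>neighbours E x. (hit t y)\<^sup>2) - deg v * return_prob (2 * t + 2)"
    using hit_pairing[of "Suc t" "Suc t" n] assms by (simp add: sum_subtractf mult_2 add_ac)
  moreover have "(\<Sum>x\<in>?G. \<Sum>y\<in>neighbours E x. (hit t y)\<^sup>2) = deg v * return_prob (2 * t)"
  proof -
    \<comment> \<open>All neighbours of a point of \<open>root_ball t\<close> lie in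
      \<open>root_ball (Suc t)\<close>, hence in \<open>?G\<close>, so no part of the degree is lost
      by truncation.\<close>
    have card: "(\<Sum>x\<in>?G. of_bool (E x y)) = deg y" if "y \<in> root_ball t" for y
    proof -
      have "neighbours E y \<subseteq> root_ball (Suc t)" using that by auto
      then have "neighbours E y \<subseteq> ?G" using root_ball_mono[of "Suc t" n] assms by auto
      then have "neighbours E y = {x \<in> ?G. E x y}" by (auto simp: neighbours_def dest: adj_sym)
      then show ?thesis by (simp add: Int_def sum.If_cases of_bool_def deg_def)
    qed
    have "(\<Sum>x\<in>?G. \<Sum>y\<in>neighbours E x. (hit t y)\<^sup>2) = (\<Sum>x\<in>?G. \<Sum>y\<in>root_ball t. of_bool (E x y) * (hit t y)\<^sup>2)"
      by (intro sum.cong refl sum_neighbours_eq) (auto simp: out)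
    also have "\<dots> = (\<Sum>y\<in>root_ball t. \<Sum>x\<in>?G. of_bool (E x y) * (hit t y)\<^sup>2)" by (rule sum.swap)
    also have "\<dots> = (\<Sum>y\<in>root_ball t. deg y * hit t y * hit t y)"
      by (intro sum.cong refl) (simp only: sum_distrib_right[symmetric] card power2_eq_square mult.assoc)
    also have "\<dots> = (\<Sum>y\<in>?G. deg y * hit t y * hit t y)"
      using root_ball_mono[of t n] assms by (intro sum.mono_neutral_left) (auto simp: out)
    also have "\<dots> = deg v * return_prob (2 * t)" using hit_pairing[of t t n] assms by (simp add: mult_2)
    finally show ?thesis .
  qed
  ultimately show ?thesis by (simp add: algebra_simps)
qed

lemma return_prob_even_decseq: "decseq (\<lambda>t. return_prob (2 * t))"
proof (rule decseq_SucI)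
  fix t
  have "0 \<le> (\<Sum>x\<in>root_ball (2*t+2). \<Sum>y\<in>neighbours E x. (hit t y - hit (Suc t) x)\<^sup>2)"
    by (intro sum_nonneg) auto
  then show "return_prob (2 * Suc t) \<le> return_prob (2 * t)"
    using deg_pos[OF root] unfolding return_prob_energy[OF order_refl]
    by (simp add: zero_le_mult_iff)
qed

text \<open>Expanding the squared norm of \<open>hit t - hit (Suc t)\<close> bounds the odd value by
  the average of its two even neighbours, the larger of which is the earlier one.\<close>

lemma return_prob_odd_le: "return_prob (2 * t + 1) \<le> return_prob (2 * t)"
proof -
  let ?G = "root_ball (2 * t + 2)"
  have "0 \<le> (\<Sum>x\<in>?G. deg x * (hit t x - hit (Suc t) x)\<^sup>2)" by (intro sum_nonneg) auto
  also have "\<dots> = (\<Sum>x\<in>?G. deg x * hit t x * hit t x) + (\<Sum>x\<in>?G. deg x * hit (Suc t) x * hit (Suc t) x)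
     - 2 * (\<Sum>x\<in>?G. deg x * hit t x * hit (Suc t) x)"
  proof -
    have "(\<Sum>x\<in>?G. deg x * (hit t x - hit (Suc t) x)\<^sup>2) = (\<Sum>x\<in>?G. deg x * hit t x * hit t x
        + deg x * hit (Suc t) x * hit (Suc t) x - 2 * (deg x * hit t x * hit (Suc t) x))"
      by (intro sum.cong refl) (simp add: power2_eq_square algebra_simps)
    then show ?thesis by (simp only: sum.distrib sum_subtractf sum_distrib_left[symmetric])
  qed
  also have "\<dots> = deg v * (return_prob (2 * t) + return_prob (2 * Suc t) - 2 * return_prob (2 * t + 1))"
  proof -
    have e: "t + t = 2 * t" "Suc t + Suc t = 2 * Suc t" "t + Suc t = 2 * t + 1" by auto
    show ?thesis
      using hit_pairing[of t t "2*t+2", unfolded e] hit_pairing[of "Suc t" "Suc t" "2*t+2", unfolded e]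
        hit_pairing[of t "Suc t" "2*t+2", unfolded e]
      by (simp add: right_diff_distrib distrib_left)
  qed
  finally have "2 * return_prob (2 * t + 1) \<le> return_prob (2 * t) + return_prob (2 * Suc t)"
    using deg_pos[OF root] by (simp add: zero_le_mult_iff)
  also have "return_prob (2 * Suc t) \<le> return_prob (2 * t)"
    by (rule decseq_SucD[OF return_prob_even_decseq])
  finally show ?thesis by simp
qed

declare root_ball.simps(2) [simp del]

section \<open>From energy to decay\<close>

text \<open>Balls around \<open>x0\<close> grow strictly, since a ball that stops growing would be
  all of the infinite set \<open>V\<close>. The ball of radius \<open>card B\<close> thus has more
  than \<open>card B\<close> points and does not fit into \<open>B\<close>.\<close>

lemma short_path_out_of_finite_set:
  assumes "x0 \<in> V" "finite B"
  obtains f L where "L \<le> card B" "f 0 = x0" "\<And>i. i < L \<Longrightarrow> E (f i) (f (Suc i))" "f L \<notin> B"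
proof -
  define R where "R i = {y. \<exists>j\<le>i. (E ^^ j) x0 y}" for i :: nat
  have "\<not> R (card B) \<subseteq> B"
  proof
    assume sub: "R (card B) \<subseteq> B"
    have fin: "finite (R i)" if "i \<le> card B" for i
    proof -
      have "R i \<subseteq> R (card B)" using that by (auto simp: R_def intro: le_trans)
      then show ?thesis using sub assms(2) by (meson finite_subset)
    qed
    have "i + 1 \<le> card (R i)" if "i \<le> card B" for i
      using that
    proof (induction i)
      case 0
      have "R 0 = {x0}" by (auto simp: R_def)
      then show ?case by simp
    next
      case (Suc i)
      have "R i \<noteq> R (Suc i)"
      proof
        assume eq: "R i = R (Suc i)"
        have "y \<in> R i" if "E\<^sup>*\<^sup>* x0 y" for y
          using that
        proof (induction rule: rtranclp_induct)
          case base
          have "(E ^^ 0) x0 x0" by simp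
          then show ?case unfolding R_def by blast
        next
          case (step y z)
          then obtain j where "j \<le> i" "(E ^^ j) x0 y" by (auto simp: R_def)
          then have "Suc j \<le> Suc i" "(E ^^ Suc j) x0 z" using step by auto
          then have "z \<in> R (Suc i)" unfolding R_def by blast
          then show ?case using eq by simp
        qed
        then have "V \<subseteq> R i" using connected assms(1) by (auto simp: connected_graph_def)
        then show False using fin[of i] Suc infinite_V finite_subset by auto
      qed
      moreover have "R i \<subseteq> R (Suc i)" unfolding R_def by (blast intro: le_SucI)
      ultimately have "R i \<subset> R (Suc i)" by blast
      then have "card (R i) < card (R (Suc i))" using fin[of "Suc i"] Suc by (intro psubset_card_mono) auto
      then show ?case using Suc by simp
    qed
    then have "card B + 1 \<le> card (R (card B))" by simp
    then show False using card_mono[OF assms(2) sub] by simp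
  qed
  then obtain L y where L: "L \<le> card B" "(E ^^ L) x0 y" "y \<notin> B" by (auto simp: R_def)
  then obtain f where "f 0 = x0" "f L = y" "\<And>i. i < L \<Longrightarrow> E (f i) (f (Suc i))"
    by (auto simp: relpowp_fun_conv)
  then show ?thesis using that[of L f] L by auto
qed

lemma sum_deg_hit_le:
  assumes "t \<le> n"
  shows "(\<Sum>x\<in>root_ball n. deg x * hit t x) \<le> deg v"
proof -
  have "(\<Sum>x\<in>root_ball n. deg x * hit t x / deg v) = (\<Sum>x\<in>root_ball n. prob {\<omega>. \<omega> t = x})"
    by (simp add: prob_at)
  also have "\<dots> = prob (\<Union>x\<in>root_ball n. {\<omega>. \<omega> t = x})"
    by (intro finite_measure_finite_Union[symmetric]) (auto simp: disjoint_family_on_def)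
  also have "\<dots> \<le> 1" by simp
  finally show ?thesis using deg_pos[OF root] by (simp add: sum_divide_distrib[symmetric])
qed

lemma exists_large_step:
  fixes a :: "nat \<Rightarrow> real"
  assumes "a 0 - a L \<ge> h" "h > 0"
  obtains i where "i < L" "a i - a (Suc i) \<ge> h / L"
proof -
  have "L \<noteq> 0" using assms by (intro notI) auto
  have "\<exists>i<L. a i - a (Suc i) \<ge> h / L"
  proof (rule ccontr)
    assume "\<not> ?thesis"
    then have "(\<Sum>i<L. a i - a (Suc i)) < (\<Sum>i<L. h / L)"
      using \<open>L \<noteq> 0\<close> by (intro sum_strict_mono) auto
    then show False using assms \<open>L \<noteq> 0\<close> by (simp add: sum_lessThan_telescope')
  qed
  then show ?thesis using that by blast
qed

text \<open>Starting from a point where \<^term>\<open>hit t\<close> is largest, a path of length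
  \<open>O(1 / return_prob (2 * t))\<close> must leave the set where \<^term>\<open>hit t\<close> or \<^term>\<open>hit (Suc t)\<close> is at least
  half of that value, so that some edge on it carries a definite part of the energy.\<close>

lemma return_prob_decrement:
  "return_prob (2 * t) ^ 4 \<le> 64 * deg v ^ 3 * (return_prob (2 * t) - return_prob (2 * t + 2))"
proof (cases "return_prob (2 * t) = 0")
  case True
  then have "return_prob (2 * t + 2) = 0"
    using decseq_SucD[OF return_prob_even_decseq, of t] return_prob_nonneg[of "2 * t + 2"] by (intro antisym) simp_all
  with True show ?thesis by simp
next
  case False
  define M where "M = return_prob (2 * t)"
  define G where "G = root_ball (2 * t + 2)"
  define D where "D = deg v"
  have M: "M > 0" using False return_prob_nonneg[of "2 * t"] unfolding M_def by linarith
  have D: "D > 0" unfolding D_def by (rule deg_pos[OF root])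
  have fin: "finite G" by (simp add: G_def)
  have G: "x \<in> G" if "hit t x > 0 \<or> hit (Suc t) x > 0" for x
  proof -
    have "x \<in> root_ball t \<or> x \<in> root_ball (Suc t)"
      using that hit_outside_ball[of x t] hit_outside_ball[of x "Suc t"] by (metis less_irrefl)
    then show ?thesis
      using root_ball_mono[of t "2*t+2"] root_ball_mono[of "Suc t" "2*t+2"] unfolding G_def by auto
  qed
  \<comment> \<open>\<open>D * M\<close> is the sum of \<open>hit t\<close> against weights
    \<open>deg x * hit t x\<close> of total mass at most \<open>D\<close>, so the maximum of
    \<open>hit t\<close> is at least \<open>M\<close>.\<close>
  obtain x0 where x0: "hit t x0 \<ge> M"
  proof -
    have "\<exists>x0. hit t x0 \<ge> M"
    proof (rule ccontr)
      assume less: "\<not> ?thesis"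
      define m where "m = Max (hit t ` G)"
      have ne: "hit t ` G \<noteq> {}" using root_in_ball[of "2*t+2"] unfolding G_def by blast
      have m: "hit t x \<le> m" if "x \<in> G" for x unfolding m_def using that fin by auto
      have "m \<in> hit t ` G" unfolding m_def by (rule Max_in) (use fin ne in auto)
      then have "m < M" using less by (metis imageE not_le)
      have "D * M = (\<Sum>x\<in>G. deg x * hit t x * hit t x)"
        using hit_pairing[of t t "2*t+2"] by (simp add: D_def M_def G_def mult_2)
      also have "\<dots> \<le> (\<Sum>x\<in>G. deg x * hit t x * m)"
        by (intro sum_mono mult_left_mono m mult_nonneg_nonneg) auto
      also have "\<dots> = (\<Sum>x\<in>G. deg x * hit t x) * m" by (simp add: sum_distrib_right)
      also have "\<dots> \<le> D * m"
      proof (rule mult_right_mono)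
        show "(\<Sum>x\<in>G. deg x * hit t x) \<le> D" using sum_deg_hit_le[of t] by (simp add: G_def D_def)
        have "0 \<le> hit t v" by simp
        also have "\<dots> \<le> m" by (rule m) (simp add: G_def)
        finally show "0 \<le> m" .
      qed
      finally show False using \<open>m < M\<close> D by simp
    qed
    then show ?thesis using that by blast
  qed
  define h where "h = M / 2"
  have h: "h > 0" using M by (simp add: h_def)
  \<comment> \<open>The sum of the two values is used because leaving \<open>B\<close> must make
    both small: the parity of the path length decides which of them is needed. The total mass is at
    most \<open>2 * D\<close>, whence the bound \<open>4 * D / M\<close> on the cardinality.\<close>
  define B where "B = {x \<in> G. hit t x + hit (Suc t) x \<ge> h}"
  have finB: "finite B" using fin by (simp add: B_def)
  have GV: "G \<subseteq> V"
  proof -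
    have "root_ball n \<subseteq> V" for n
      by (induction n) (use root in \<open>auto simp: neighbours_def root_ball.simps(2) dest: adj_in_V\<close>)
    then show ?thesis by (simp add: G_def)
  qed
  have cardB: "card B \<le> 4 * D / M"
  proof -
    have "card B * h = (\<Sum>x\<in>B. h)" by simp
    also have "\<dots> \<le> (\<Sum>x\<in>B. deg x * hit t x + deg x * hit (Suc t) x)"
    proof (rule sum_mono)
      fix x assume x: "x \<in> B"
      then have "h \<le> 1 * (hit t x + hit (Suc t) x)" by (simp add: B_def)
      also have "\<dots> \<le> deg x * (hit t x + hit (Suc t) x)"
        using deg_ge_1[of x] GV x by (intro mult_right_mono) (auto simp: B_def)
      finally show "h \<le> deg x * hit t x + deg x * hit (Suc t) x" by (simp add: distrib_left)
    qed
    also have "\<dots> \<le> (\<Sum>x\<in>G. deg x * hit t x + deg x * hit (Suc t) x)"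
      using fin by (intro sum_mono2) (auto simp: B_def)
    also have "\<dots> \<le> D + D"
      using sum_deg_hit_le[of t "2*t+2"] sum_deg_hit_le[of "Suc t" "2*t+2"]
      by (simp add: sum.distrib D_def G_def)
    finally show ?thesis using M by (simp add: h_def field_simps)
  qed
  have "x0 \<in> V" using GV G[of x0] x0 M by auto
  then obtain f L where f: "L \<le> card B" "f 0 = x0" "\<And>i. i < L \<Longrightarrow> E (f i) (f (Suc i))" "f L \<notin> B"
    using short_path_out_of_finite_set[OF _ finB] by metis
  \<comment> \<open>An edge term of the energy compares \<open>hit t\<close> at one end with
    \<open>hit (Suc t)\<close> at the other, so the time index alternates along the path.\<close>
  define a where "a i = hit (if even i then t else Suc t) (f i)" for i
  have out: "a L \<le> h"
  proof (cases "f L \<in> G")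
    case True
    then have "hit t (f L) + hit (Suc t) (f L) < h" using f(4) by (auto simp: B_def)
    then have "hit t (f L) < h" "hit (Suc t) (f L) < h"
      using hit_nonneg[of t "f L"] hit_nonneg[of "Suc t" "f L"] by linarith+
    then show ?thesis by (simp add: a_def)
  next
    case False
    then have "hit t (f L) = 0" "hit (Suc t) (f L) = 0"
      using G[of "f L"] hit_nonneg[of t "f L"] hit_nonneg[of "Suc t" "f L"] by linarith+
    then show ?thesis using h by (simp add: a_def)
  qed
  have "a 0 - a L \<ge> h" using out x0 f(2) by (simp add: a_def h_def)
  then obtain i where i: "i < L" "a i - a (Suc i) \<ge> h / L"
    by (rule exists_large_step) (use h in auto)
  have L: "L > 0" using i by simp
  define energy where "energy = (\<Sum>x\<in>G. \<Sum>y\<in>neighbours E x. (hit t y - hit (Suc t) x)\<^sup>2)"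
  have edge: "(hit t y - hit (Suc t) x)\<^sup>2 \<le> energy" if "x \<in> G" "E x y" for x y
  proof -
    have "(hit t y - hit (Suc t) x)\<^sup>2 \<le> (\<Sum>y\<in>neighbours E x. (hit t y - hit (Suc t) x)\<^sup>2)"
      using that by (intro member_le_sum) (auto simp: neighbours_def[symmetric], simp add: neighbours_def)
    also have "\<dots> \<le> energy"
      unfolding energy_def using that fin by (intro member_le_sum) (auto intro: sum_nonneg)
    finally show ?thesis .
  qed
  have ai: "0 < a i" 
  proof -
    have "0 \<le> a (Suc i)" by (simp add: a_def)
    moreover have "0 < h / L" using h L by simp
    ultimately show ?thesis using i(2) by linarith
  qed
  have "(a i - a (Suc i))\<^sup>2 \<le> energy"
  proof (cases "even i")
    case True
    \<comment> \<open>For even \<open>i\<close> the outer vertex of the energy term is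
      \<open>f (Suc i)\<close>, where the density may vanish; it lies in \<open>G\<close> because
      its neighbour \<open>f i\<close> is in the smaller ball.\<close>
    have "f i \<in> root_ball t" using ai True hit_outside_ball[of "f i" t] by (auto simp: a_def)
    then have "f (Suc i) \<in> root_ball (Suc t)" using f(3)[OF i(1)] by (auto simp: neighbours_def root_ball.simps(2))
    then have "f (Suc i) \<in> G" using root_ball_mono[of "Suc t" "2*t+2"] by (auto simp: G_def)
    then show ?thesis using edge[of "f (Suc i)" "f i"] adj_sym[OF f(3)[OF i(1)]] True by (simp add: a_def)
  next
    case False
    then have "f i \<in> G" using ai by (intro G) (auto simp: a_def)
    then show ?thesis using edge[OF _ f(3)[OF i(1)]] False by (simp add: a_def power2_commute)
  qed
  moreover have "(h / L)\<^sup>2 \<le> (a i - a (Suc i))\<^sup>2"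
    using i(2) h by (intro power_mono) auto
  \<comment> \<open>The drop \<open>M / 2\<close> is divided by the length bound
    \<open>4 * D / M\<close>. Squaring, and the factor \<open>D\<close> in the energy identity,
    produce the constant \<open>64 * D ^ 3\<close>.\<close>
  moreover have "M\<^sup>2 / (8 * D) \<le> h / L"
  proof -
    have "real L \<le> 4 * D / M" using cardB f(1) by (meson of_nat_le_iff order.trans)
    then show ?thesis using L M D by (simp add: h_def field_simps power2_eq_square)
  qed
  then have "(M\<^sup>2 / (8 * D))\<^sup>2 \<le> (h / L)\<^sup>2"
    using D by (intro power_mono) auto
  ultimately have "(M\<^sup>2 / (8 * D))\<^sup>2 \<le> energy" by linarith
  also have "energy = D * (M - return_prob (2 * t + 2))"
    unfolding energy_def G_def D_def M_def by (rule return_prob_energy) simp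
  finally have *: "M ^ 4 / (64 * D\<^sup>2) \<le> D * (M - return_prob (2 * t + 2))"
    by (simp add: power_divide power_mult_distrib flip: power_mult)
  have "M ^ 4 \<le> D * (M - return_prob (2 * t + 2)) * (64 * D\<^sup>2)"
    using * D by (subst (asm) pos_divide_le_eq) auto
  also have "\<dots> = 64 * D ^ 3 * (M - return_prob (2 * t + 2))"
    by (simp add: power2_eq_square power3_eq_cube)
  finally show ?thesis by (simp add: M_def D_def)
qed

text \<open>Monotonicity replaces \<open>t\<close> equal terms by the earlier, larger ones, and the
  decrement bound makes their sum telescope. This is the source of the exponent 1/4; any positive
  power would do, with other subsequences.\<close>

lemma return_prob_even_decay: "t * return_prob (2 * t) ^ 4 \<le> 64 * deg v ^ 3"
proof -
  have "t * return_prob (2 * t) ^ 4 = (\<Sum>s<t. return_prob (2 * t) ^ 4)" by simp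
  also have "\<dots> \<le> (\<Sum>s<t. return_prob (2 * s) ^ 4)"
    using decseqD[OF return_prob_even_decseq] by (intro sum_mono power_mono) auto
  also have "\<dots> \<le> (\<Sum>s<t. 64 * deg v ^ 3 * (return_prob (2 * s) - return_prob (2 * Suc s)))"
    using return_prob_decrement by (intro sum_mono) simp
  also have "\<dots> = 64 * deg v ^ 3 * (\<Sum>s<t. return_prob (2 * s) - return_prob (2 * Suc s))"
    by (simp add: sum_distrib_left)
  also have "(\<Sum>s<t. return_prob (2 * s) - return_prob (2 * Suc s)) = 1 - return_prob (2 * t)"
    using sum_lessThan_telescope'[of "\<lambda>s. return_prob (2 * s)" t] by simp
  also have "64 * deg v ^ 3 * (1 - return_prob (2 * t)) \<le> 64 * deg v ^ 3 * 1"
    by (intro mult_left_mono) auto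
  finally show ?thesis by simp
qed

section \<open>A monotone majorant of the return probabilities\<close>

text \<open>Return probabilities oscillate with parity, and vanish at odd times on bipartite graphs.
  Rounding down to an even time gives a decreasing majorant.\<close>

definition return_bound :: "nat \<Rightarrow> real" where
  "return_bound t = return_prob (2 * (t div 2))"

lemma return_bound_nonneg [simp]: "0 \<le> return_bound t"
  by (simp add: return_bound_def)

lemma return_prob_le_bound: "return_prob t \<le> return_bound t"
proof (cases "even t")
  case False
  then have "t = 2 * (t div 2) + 1" by presburger
  then show ?thesis using return_prob_odd_le[of "t div 2"] by (metis return_bound_def)
qed (simp add: return_bound_def)

lemma return_bound_antimono: "s \<le> t \<Longrightarrow> return_bound t \<le> return_bound s"
  unfolding return_bound_def using decseqD[OF return_prob_even_decseq, of "s div 2" "t div 2"]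
  by (simp add: div_le_mono)

text \<open>Split at \<open>2 * m ^ 4\<close>: earlier terms are at most 1, and each of the at most
  \<open>m ^ 5\<close> later ones is at most \<open>K / m\<close> by the decay estimate. Both parts
  are of order \<open>m ^ 4\<close>.\<close>

lemma sum_return_bound:
  obtains K where "K > 0" "\<And>m. (\<Sum>t<m ^ 5. return_bound t) \<le> K * real m ^ 4"
proof -
  define K where "K = 64 * deg v ^ 3"
  have K: "1 \<le> K" using one_le_power[OF deg_ge_1[OF root], of 3] by (simp add: K_def)
  have tail: "return_bound t \<le> K / m" if "m > 0" "2 * m ^ 4 \<le> t" for t m :: nat
  proof -
    let ?r = "return_prob (2 * m ^ 4)"
    have "(m * ?r) ^ 4 = real (m ^ 4) * ?r ^ 4" by (simp add: power_mult_distrib)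
    also have "\<dots> \<le> K" unfolding K_def by (rule return_prob_even_decay)
    \<comment> \<open>As \<open>K\<close> is at least 1, passing to \<open>K ^ 4\<close> is allowed
      and lets the fourth power be removed from both sides.\<close>
    also have "\<dots> \<le> K ^ 4" using K self_le_power[of K 4] by simp
    finally have "m * ?r \<le> K" using power_mono_iff[of "m * ?r" K 4] K by simp
    then have "?r \<le> K / m" using that by (simp add: field_simps)
    moreover have "return_bound t \<le> ?r" using return_bound_antimono[OF that(2)] by (simp add: return_bound_def)
    ultimately show ?thesis by simp
  qed
  have "(\<Sum>t<m ^ 5. return_bound t) \<le> (2 + K) * real m ^ 4" for m :: nat
  proof (cases "m = 0")
    case False
    have "(\<Sum>t<m ^ 5. return_bound t) \<le> (\<Sum>t<m ^ 5. of_bool (t < 2 * m ^ 4) + K / m)"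
    proof (rule sum_mono)
      fix t
      show "return_bound t \<le> of_bool (t < 2 * m ^ 4) + K / m"
      proof (cases "t < 2 * m ^ 4")
        case True
        have "return_bound t \<le> 1" by (simp add: return_bound_def)
        moreover have "0 \<le> K / m" using K by simp
        ultimately show ?thesis using True by simp
      next
        case False
        then show ?thesis using tail[of m t] \<open>m \<noteq> 0\<close> by simp
      qed
    qed
    also have "\<dots> = (\<Sum>t<m ^ 5. of_bool (t < 2 * m ^ 4)) + real (m ^ 5) * (K / m)"
      by (simp add: sum.distrib)
    also have "(\<Sum>t<m ^ 5. of_bool (t < 2 * m ^ 4)) \<le> real (2 * m ^ 4)"
    proof -
      have "(\<Sum>t<m ^ 5. of_bool (t < 2 * m ^ 4)) = real (card ({..<m ^ 5} \<inter> {..<2 * m ^ 4}))"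
        by (simp add: of_bool_def sum.If_cases Int_def)
      also have "card ({..<m ^ 5} \<inter> {..<2 * m ^ 4}) \<le> card {..<2 * m ^ 4}"
        by (intro card_mono) auto
      finally show ?thesis by simp
    qed
    also have "real (m ^ 5) * (K / m) = K * real m ^ 4"
      using False by (simp add: field_simps eval_nat_numeral)
    finally show ?thesis by (simp add: distrib_right)
  qed simp
  then show ?thesis using that[of "2 + K"] K by simp
qed

end

section \<open>Collisions of two walks\<close>

text \<open>A series of nonnegative functions with finite total expectation converges almost surely,
  so its terms tend to 0. This takes the place of Chebyshev with Borel-Cantelli.\<close>

lemma (in prob_space) AE_tendsto_0_if_summable:
  fixes g :: "nat \<Rightarrow> 'a \<Rightarrow> real"
  assumes [measurable]: "\<And>m. g m \<in> borel_measurable M" and nonneg: "\<And>m x. 0 \<le> g m x"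
    and le: "\<And>m. (\<integral>\<^sup>+x. ennreal (g m x) \<partial>M) \<le> ennreal (c m)" and c: "summable c" "\<And>m. 0 \<le> c m"
  shows "AE x in M. (\<lambda>m. g m x) \<longlonglongrightarrow> 0"
proof -
  have "(\<integral>\<^sup>+x. (\<Sum>m. ennreal (g m x)) \<partial>M) = (\<Sum>m. \<integral>\<^sup>+x. ennreal (g m x) \<partial>M)"
    by (rule nn_integral_suminf) simp
  also have "\<dots> \<le> (\<Sum>m. ennreal (c m))" by (intro suminf_le le) auto
  also have "\<dots> = ennreal (\<Sum>m. c m)" by (rule suminf_ennreal2) (use c in auto)
  also have "\<dots> < \<infinity>" by simp
  finally have "(\<integral>\<^sup>+x. (\<Sum>m. ennreal (g m x)) \<partial>M) \<noteq> \<infinity>" by simp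
  then have "AE x in M. (\<Sum>m. ennreal (g m x)) \<noteq> \<infinity>" by (intro nn_integral_PInf_AE) auto
  then show ?thesis
  proof eventually_elim
    fix x assume "(\<Sum>m. ennreal (g m x)) \<noteq> \<infinity>"
    then have "summable (\<lambda>m. g m x)" by (intro summable_suminf_not_top) (auto simp: nonneg)
    then show "(\<lambda>m. g m x) \<longlonglongrightarrow> 0" by (rule summable_LIMSEQ_zero)
  qed
qed

lemma summable_const_over_Suc_squared: "summable (\<lambda>m. K / real (Suc m) ^ 2)"
proof -
  have "summable (\<lambda>m. K * inverse (real (Suc m) ^ 2))"
    by (intro summable_mult) (subst summable_Suc_iff, rule inverse_power_summable, simp)
  then show ?thesis by (simp add: divide_inverse)
qed

lemma power2_tendsto_0_imp:
  fixes f :: "nat \<Rightarrow> real"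
  assumes "(\<lambda>m. (f m)\<^sup>2) \<longlonglongrightarrow> 0"
  shows "f \<longlonglongrightarrow> 0"
proof -
  have "(\<lambda>m. sqrt ((f m)\<^sup>2)) \<longlonglongrightarrow> sqrt 0" by (intro tendsto_real_sqrt assms)
  then show ?thesis by (simp add: tendsto_rabs_zero_iff)
qed

lemma between_consecutive_powers:
  fixes M p :: nat
  assumes "p > 0"
  obtains m where "m ^ p \<le> M" "M < Suc m ^ p"
proof -
  have "\<exists>m. m ^ p \<le> M \<and> M < Suc m ^ p"
  proof (induction M)
    case 0
    then show ?case using assms by (intro exI[of _ 0]) auto
  next
    case (Suc M)
    then obtain m where m: "m ^ p \<le> M" "M < Suc m ^ p" by blast
    show ?case
    proof (cases "Suc M < Suc m ^ p")
      case True
      then show ?thesis using m by (intro exI[of _ m]) auto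
    next
      case False
      then have "Suc M = Suc m ^ p" using m by simp
      moreover have "Suc m ^ p < Suc (Suc m) ^ p" using assms by (intro power_strict_mono) auto
      ultimately show ?thesis by (intro exI[of _ "Suc m"]) auto
    qed
  qed
  then show ?thesis using that by blast
qed

text \<open>Between consecutive \<open>p\<close>-th powers a monotone count is bounded by its value
  at the upper one, which exceeds \<open>M\<close> by a factor of at most \<open>2 ^ p\<close>. The
  extra factor 2 in \<open>2 ^ Suc p\<close> leaves room below \<open>e\<close>.\<close>

lemma mono_average_tendsto_0:
  fixes C :: "nat \<Rightarrow> real"
  assumes "mono C" "\<And>M. 0 \<le> C M" "p > 0"
    and lim: "(\<lambda>m. C (Suc m ^ p) / real (Suc m ^ p)) \<longlonglongrightarrow> 0"
  shows "(\<lambda>M. C M / M) \<longlonglongrightarrow> 0"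
proof (rule LIMSEQ_I)
  fix e :: real assume e: "e > 0"
  have "e / 2 ^ Suc p > 0" using e by simp
  from LIMSEQ_D[OF lim this] obtain N where N: "\<And>m. m \<ge> N \<Longrightarrow> C (Suc m ^ p) / real (Suc m ^ p) < e / 2 ^ Suc p"
    using assms(2) by force
  have "norm (C M / M - 0) < e" if M: "M \<ge> Suc N ^ p" for M
  proof -
    obtain m where m: "m ^ p \<le> M" "M < Suc m ^ p" using between_consecutive_powers[OF assms(3)] by blast
    have "Suc N ^ p < Suc m ^ p" using m M by simp
    then have "Suc N < Suc m" by (rule power_less_imp_less_base) simp
    then have mN: "N \<le> m" "1 \<le> m" by auto
    have "real (Suc m ^ p) \<le> real ((2 * m) ^ p)" using mN by (intro of_nat_mono power_mono) auto
    also have "\<dots> = 2 ^ p * real (m ^ p)" by (simp add: power_mult_distrib)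
    also have "\<dots> \<le> 2 ^ p * real M" using m by (intro mult_left_mono) (auto simp del: of_nat_power)
    finally have le: "real (Suc m ^ p) \<le> 2 ^ p * real M" .
    have M0: "M > 0" using m mN by (metis One_nat_def Suc_le_lessD gr0I less_le_trans nat_zero_less_power_iff)
    have "C M \<le> C (Suc m ^ p)" using m assms(1) by (simp add: monoD)
    also have "\<dots> < e / 2 ^ Suc p * real (Suc m ^ p)"
      using N[OF mN(1)] by (simp add: pos_divide_less_eq del: of_nat_power power_Suc of_nat_Suc)
    also have "\<dots> \<le> e / 2 ^ Suc p * (2 ^ p * real M)" using e le by (intro mult_left_mono) auto
    also have "\<dots> = e / 2 * real M" by simp
    also have "\<dots> \<le> e * real M" using e by simp
    finally have "C M < e * real M" .
    then show ?thesis using M0 assms(2)[of M] by (simp add: field_simps)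
  qed
  then show "\<exists>N. \<forall>M\<ge>N. norm (C M / M - 0) < e" by blast
qed

lemma card_Int_lessThan_enumerate:
  assumes "infinite (S :: nat set)"
  shows "card (S \<inter> {..<enumerate S n}) = n"
proof (induction n)
  case 0
  have "S \<inter> {..<enumerate S 0} = {}"
    by (auto simp: enumerate_0 dest: not_less_Least)
  then show ?case by simp
next
  case (Suc n)
  have "x = enumerate S n" if "x \<in> S" "enumerate S n \<le> x" "x < enumerate S (Suc n)" for x
  proof -
    obtain k where k: "x = enumerate S k" using enumerate_Ex[OF assms \<open>x \<in> S\<close>] by metis
    then have "n \<le> k" "k < Suc n" using that assms by auto
    then have "k = n" by simp
    then show ?thesis using k by simp
  qed
  then have "S \<inter> {..<enumerate S (Suc n)} = insert (enumerate S n) (S \<inter> {..<enumerate S n})"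
    using enumerate_step[OF assms, of n] enumerate_in_set[OF assms, of n] by force
  then show ?case using Suc by simp
qed

text \<open>The dictionary between clock time and visit index: sums up to a time become sums over
  the first visits.\<close>

lemma sum_Int_lessThan_enumerate:
  fixes f :: "nat \<Rightarrow> 'b::comm_monoid_add"
  assumes "infinite S"
  shows "sum f (S \<inter> {..<T}) = (\<Sum>i<card (S \<inter> {..<T}). f (enumerate S i))"
proof (induction T)
  case (Suc T)
  show ?case
  proof (cases "T \<in> S")
    case True
    then obtain n where n: "T = enumerate S n" using enumerate_Ex[OF assms] by metis
    then have "card (S \<inter> {..<T}) = n" using card_Int_lessThan_enumerate[OF assms] by simp
    moreover have "S \<inter> {..<Suc T} = insert T (S \<inter> {..<T})" using True by auto
    ultimately show ?thesis using Suc n by (simp add: add.commute)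
  next
    case False
    then have "S \<inter> {..<Suc T} = S \<inter> {..<T}" by (auto simp: less_Suc_eq)
    then show ?thesis using Suc by simp
  qed
qed simp

lemma card_Int_lessThan_at_top:
  assumes "infinite (S :: nat set)"
  shows "filterlim (\<lambda>T. card (S \<inter> {..<T})) at_top sequentially"
  unfolding filterlim_at_top eventually_sequentially
proof (intro allI exI impI)
  fix Z T assume "enumerate S Z \<le> T"
  then have "card (S \<inter> {..<enumerate S Z}) \<le> card (S \<inter> {..<T})" by (intro card_mono) auto
  then show "Z \<le> card (S \<inter> {..<T})" using card_Int_lessThan_enumerate[OF assms] by simp
qed

section \<open>Sums over pairs of times\<close>

lemma sum_ordered_pairs_le:
  fixes R :: "nat \<Rightarrow> real"
  assumes "\<And>r. 0 \<le> R r"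
  shows "(\<Sum>a<A. \<Sum>b<B. of_bool (a \<le> b) * (R a * R (b - a))) \<le> (\<Sum>a<A. R a) * (\<Sum>b<B. R b)"
proof -
  have "(\<Sum>b<B. of_bool (a \<le> b) * (R a * R (b - a))) \<le> R a * (\<Sum>b<B. R b)" for a
  proof -
    have "(\<Sum>b<B. of_bool (a \<le> b) * (R a * R (b - a))) = (\<Sum>b\<in>{a..<B}. R a * R (b - a))"
      by (rule sum.mono_neutral_cong_right) auto
    also have "\<dots> = R a * (\<Sum>b\<in>{0..<B - a}. R b)"
      using sum.atLeastLessThan_shift_0[of "\<lambda>b. R (b - a)" a B] by (simp add: sum_distrib_left[symmetric])
    also have "\<dots> \<le> R a * (\<Sum>b<B. R b)"
      using assms by (intro mult_left_mono sum_mono2) auto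
    finally show ?thesis .
  qed
  then show ?thesis by (simp add: sum_distrib_right sum_mono)
qed

lemma min_max_le_ordered_pairs:
  fixes R :: "nat \<Rightarrow> real"
  assumes "\<And>r. 0 \<le> R r"
  shows "R (min a b) * R (max a b - min a b) \<le> of_bool (a \<le> b) * (R a * R (b - a)) + of_bool (b \<le> a) * (R b * R (a - b))"
  using assms by (cases a b rule: linorder_cases) (auto simp: min_def max_def)

text \<open>Pairs with a \<le> b give the product. Pairs with b \<le> a force both indices below
  \<open>A\<close> and give the square. Counting the diagonal in both is harmless for an upper
  bound.\<close>

lemma sum_symmetric_pairs_le:
  fixes R :: "nat \<Rightarrow> real"
  assumes "\<And>r. 0 \<le> R r" "A \<le> B"
  shows "(\<Sum>a<A. \<Sum>b<B. R (min a b) * R (max a b - min a b)) \<le>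
    (\<Sum>a<A. R a) * (\<Sum>b<B. R b) + (\<Sum>a<A. R a)\<^sup>2"
proof -
  have "(\<Sum>a<A. \<Sum>b<B. R (min a b) * R (max a b - min a b)) \<le>
     (\<Sum>a<A. \<Sum>b<B. of_bool (a \<le> b) * (R a * R (b - a)) + of_bool (b \<le> a) * (R b * R (a - b)))"
    by (intro sum_mono min_max_le_ordered_pairs assms)
  also have "\<dots> = (\<Sum>a<A. \<Sum>b<B. of_bool (a \<le> b) * (R a * R (b - a))) + (\<Sum>a<A. \<Sum>b<B. of_bool (b \<le> a) * (R b * R (a - b)))"
    by (simp only: sum.distrib)
  also have "(\<Sum>a<A. \<Sum>b<B. of_bool (b \<le> a) * (R b * R (a - b))) = (\<Sum>a<A. \<Sum>b<A. of_bool (b \<le> a) * (R b * R (a - b)))"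
    using assms(2) by (intro sum.cong refl sum.mono_neutral_right) auto
  also have "\<dots> = (\<Sum>b<A. \<Sum>a<A. of_bool (b \<le> a) * (R b * R (a - b)))"
    by (rule sum.swap)
  also have "\<dots> \<le> (\<Sum>a<A. R a)\<^sup>2"
    unfolding power2_eq_square by (intro sum_ordered_pairs_le assms)
  also have "(\<Sum>a<A. \<Sum>b<B. of_bool (a \<le> b) * (R a * R (b - a))) \<le> (\<Sum>a<A. R a) * (\<Sum>b<B. R b)"
    by (intro sum_ordered_pairs_le assms)
  finally show ?thesis by simp
qed

context recurrent_rooted_graph begin

lemma integral_of_bool_visit:
  assumes "{\<omega>. P \<omega>} \<in> events"
  shows "integrable (srw E v) (\<lambda>\<omega>. of_bool (P \<omega>) :: real)" "expectation (\<lambda>\<omega>. of_bool (P \<omega>)) = prob {\<omega>. P \<omega>}"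
proof -
  have eq: "(\<lambda>\<omega>. of_bool (P \<omega>) :: real) = indicator {\<omega>. P \<omega>}" by (auto simp: indicator_def)
  show "integrable (srw E v) (\<lambda>\<omega>. of_bool (P \<omega>) :: real)" "expectation (\<lambda>\<omega>. of_bool (P \<omega>)) = prob {\<omega>. P \<omega>}"
    unfolding eq using assms by (auto simp: emeasure_eq_measure)
qed

lemma events_two_visits [simp, measurable]: "{\<omega>. \<omega> s = v \<and> \<omega> t = v} \<in> events"
proof -
  have "{\<omega>. \<omega> s = v \<and> \<omega> t = v} = {\<omega>. \<omega> s = v} \<inter> {\<omega>. \<omega> t = v}" by auto
  then show ?thesis by auto
qed

lemma prob_two_visits_min_max:
  "prob {\<omega>. \<omega> s = v \<and> \<omega> t = v} = return_prob (min s t) * return_prob (max s t - min s t)"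
  using prob_two_visits[of s t] prob_two_visits[of t s]
  by (cases s t rule: le_cases) (auto simp: min_def max_def conj_commute)

lemma second_moment_visits:
  assumes "finite A" "finite B"
  shows "integrable (srw E v) (\<lambda>\<omega>. (\<Sum>s\<in>A. of_bool (\<omega> s = v)) * (\<Sum>t\<in>B. of_bool (\<omega> t = v)) :: real)"
    and "expectation (\<lambda>\<omega>. (\<Sum>s\<in>A. of_bool (\<omega> s = v)) * (\<Sum>t\<in>B. of_bool (\<omega> t = v))) =
      (\<Sum>s\<in>A. \<Sum>t\<in>B. return_prob (min s t) * return_prob (max s t - min s t))"
proof -
  have eq: "(\<lambda>\<omega>. (\<Sum>s\<in>A. of_bool (\<omega> s = v)) * (\<Sum>t\<in>B. of_bool (\<omega> t = v)) :: real) =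
      (\<lambda>\<omega>. \<Sum>s\<in>A. \<Sum>t\<in>B. of_bool (\<omega> s = v \<and> \<omega> t = v))"
    by (simp add: sum_product of_bool_conj)
  show "integrable (srw E v) (\<lambda>\<omega>. (\<Sum>s\<in>A. of_bool (\<omega> s = v)) * (\<Sum>t\<in>B. of_bool (\<omega> t = v)) :: real)"
    unfolding eq by (intro Bochner_Integration.integrable_sum integral_of_bool_visit) simp
  show "expectation (\<lambda>\<omega>. (\<Sum>s\<in>A. of_bool (\<omega> s = v)) * (\<Sum>t\<in>B. of_bool (\<omega> t = v))) =
      (\<Sum>s\<in>A. \<Sum>t\<in>B. return_prob (min s t) * return_prob (max s t - min s t))"
  proof -
    have "expectation (\<lambda>\<omega>. \<Sum>s\<in>A. \<Sum>t\<in>B. of_bool (\<omega> s = v \<and> \<omega> t = v)) =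
        (\<Sum>s\<in>A. expectation (\<lambda>\<omega>. \<Sum>t\<in>B. of_bool (\<omega> s = v \<and> \<omega> t = v)) :: real)"
      by (rule Bochner_Integration.integral_sum)
         (intro Bochner_Integration.integrable_sum integral_of_bool_visit events_two_visits)
    also have "\<dots> = (\<Sum>s\<in>A. \<Sum>t\<in>B. expectation (\<lambda>\<omega>. of_bool (\<omega> s = v \<and> \<omega> t = v)))"
      by (intro sum.cong refl Bochner_Integration.integral_sum integral_of_bool_visit events_two_visits)
    also have "\<dots> = (\<Sum>s\<in>A. \<Sum>t\<in>B. return_prob (min s t) * return_prob (max s t - min s t))"
      by (intro sum.cong refl) (simp only: integral_of_bool_visit(2)[OF events_two_visits] prob_two_visits_min_max)
    finally show ?thesis unfolding eq .
  qed
qed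

text \<open>Meant for the visit times of another walk, held fixed. A strictly increasing sequence of
  naturals has terms and gaps at least as large as those of its indices, so the monotone majorant
  gives a second moment bound free of \<open>s\<close>, of relative size O(m^-2) along fifth
  powers.\<close>

proposition AE_few_visits_at_given_times:
  fixes s :: "nat \<Rightarrow> nat"
  assumes "strict_mono s"
  shows "AE \<omega> in srw E v. (\<lambda>M. (\<Sum>a<M. of_bool (\<omega> (s a) = v)) / M) \<longlonglongrightarrow> (0 :: real)"
proof -
  define C :: "nat \<Rightarrow> (nat \<Rightarrow> 'v) \<Rightarrow> real" where "C M \<omega> = (\<Sum>a<M. of_bool (\<omega> (s a) = v))" for M \<omega>
  have C_alt: "C M \<omega> = (\<Sum>t\<in>s ` {..<M}. of_bool (\<omega> t = v))" for M \<omega>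
    unfolding C_def using strict_mono_imp_inj_on[OF assms] by (subst sum.reindex) (auto intro: inj_on_subset)
  obtain K where K: "K > 0" "\<And>m. (\<Sum>t<m ^ 5. return_bound t) \<le> K * real m ^ 4"
    using sum_return_bound by blast
  have moment: "expectation (\<lambda>\<omega>. (C M \<omega>)\<^sup>2) \<le> 2 * (\<Sum>a<M. return_bound a)\<^sup>2" for M
  proof -
    have "expectation (\<lambda>\<omega>. (C M \<omega>)\<^sup>2) = (\<Sum>t\<in>s ` {..<M}. \<Sum>t'\<in>s ` {..<M}.
        return_prob (min t t') * return_prob (max t t' - min t t'))"
      unfolding C_alt power2_eq_square by (rule second_moment_visits) auto
    also have "\<dots> = (\<Sum>a<M. \<Sum>b<M. return_prob (min (s a) (s b)) * return_prob (max (s a) (s b) - min (s a) (s b)))"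
      using strict_mono_imp_inj_on[OF assms] by (simp add: sum.reindex inj_on_subset)
    also have "\<dots> \<le> (\<Sum>a<M. \<Sum>b<M. return_bound (min a b) * return_bound (max a b - min a b))"
    proof (intro sum_mono mult_mono)
      fix a b
      have inc: "a \<le> s a" "b \<le> s b" using assms by (simp_all add: strict_mono_imp_increasing)
      have diff: "j - i \<le> s j - s i" if "i \<le> j" for i j
        using that
      proof (induction j rule: dec_induct)
        case (step j)
        have "s j < s (Suc j)" "s i \<le> s j" using assms step by (auto simp: strict_mono_def strict_mono_less_eq[OF assms])
        then show ?case using step by simp
      qed simp
      show "return_prob (min (s a) (s b)) \<le> return_bound (min a b)"
        using inc by (intro order.trans[OF return_prob_le_bound return_bound_antimono]) auto
      have "max a b - min a b \<le> max (s a) (s b) - min (s a) (s b)"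
        using diff[of a b] diff[of b a] strict_mono_less_eq[OF assms] by (auto simp: min_def max_def)
      then show "return_prob (max (s a) (s b) - min (s a) (s b)) \<le> return_bound (max a b - min a b)"
        by (intro order.trans[OF return_prob_le_bound return_bound_antimono])
    qed auto
    also have "\<dots> \<le> 2 * (\<Sum>a<M. return_bound a)\<^sup>2"
      using sum_symmetric_pairs_le[of return_bound M M] by (simp add: power2_eq_square)
    finally show ?thesis .
  qed
  have C_int: "integrable (srw E v) (\<lambda>\<omega>. (C M \<omega>)\<^sup>2)" for M
    unfolding C_alt power2_eq_square by (rule second_moment_visits) auto
  have C_meas: "C M \<in> borel_measurable (srw E v)" for M
    unfolding C_def[abs_def] by (intro borel_measurable_sum borel_measurable_integrable integral_of_bool_visit) simp
  have "AE \<omega> in srw E v. (\<lambda>m. (C (Suc m ^ 5) \<omega> / real (Suc m ^ 5))\<^sup>2) \<longlonglongrightarrow> 0"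
  proof (rule AE_tendsto_0_if_summable[OF _ _ _ summable_const_over_Suc_squared])
    fix m
    show "(\<lambda>\<omega>. (C (Suc m ^ 5) \<omega> / real (Suc m ^ 5))\<^sup>2) \<in> borel_measurable (srw E v)"
      using C_meas by measurable
    have "(\<integral>\<^sup>+\<omega>. ennreal ((C (Suc m ^ 5) \<omega> / real (Suc m ^ 5))\<^sup>2) \<partial>srw E v) =
       ennreal (expectation (\<lambda>\<omega>. (C (Suc m ^ 5) \<omega> / real (Suc m ^ 5))\<^sup>2))"
      by (rule nn_integral_eq_integral) (auto simp: power_divide intro!: C_int simp del: power_Suc of_nat_Suc of_nat_power)
    also have "expectation (\<lambda>\<omega>. (C (Suc m ^ 5) \<omega> / real (Suc m ^ 5))\<^sup>2) = expectation (\<lambda>\<omega>. (C (Suc m ^ 5) \<omega>)\<^sup>2) / (real (Suc m ^ 5))\<^sup>2"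
      by (simp only: power_divide integral_divide_zero)
    also have "\<dots> \<le> 2 * (K * real (Suc m) ^ 4)\<^sup>2 / (real (Suc m ^ 5))\<^sup>2"
    proof (rule divide_right_mono)
      have "(\<Sum>a<Suc m ^ 5. return_bound a)\<^sup>2 \<le> (K * real (Suc m) ^ 4)\<^sup>2"
        by (intro power_mono K sum_nonneg) auto
      then show "expectation (\<lambda>\<omega>. (C (Suc m ^ 5) \<omega>)\<^sup>2) \<le> 2 * (K * real (Suc m) ^ 4)\<^sup>2"
        using moment[of "Suc m ^ 5"] by linarith
    qed simp
    also have "\<dots> = 2 * K\<^sup>2 / real (Suc m) ^ 2"
    proof -
      have "2 * (K * x ^ 4)\<^sup>2 / (x ^ 5)\<^sup>2 = 2 * K\<^sup>2 / x ^ 2" if "x \<noteq> 0" for x :: real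
        using that by (simp add: field_simps eval_nat_numeral)
      from this[of "real (Suc m)"] show ?thesis by (simp only: of_nat_power of_nat_eq_0_iff)
    qed
    finally show "(\<integral>\<^sup>+\<omega>. ennreal ((C (Suc m ^ 5) \<omega> / real (Suc m ^ 5))\<^sup>2) \<partial>srw E v) \<le> ennreal (2 * K\<^sup>2 / real (Suc m) ^ 2)"
      by (simp add: ennreal_leI)
  qed auto
  then show ?thesis
  proof eventually_elim
    fix \<omega> assume "(\<lambda>m. (C (Suc m ^ 5) \<omega> / real (Suc m ^ 5))\<^sup>2) \<longlonglongrightarrow> 0"
    then have "(\<lambda>m. C (Suc m ^ 5) \<omega> / real (Suc m ^ 5)) \<longlonglongrightarrow> 0" by (rule power2_tendsto_0_imp)
    moreover have "mono (\<lambda>M. C M \<omega>)" "0 \<le> C M \<omega>" for M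
      unfolding mono_def C_def by (intro allI impI sum_mono2 sum_nonneg; auto)+
    ultimately have "(\<lambda>M. C M \<omega> / M) \<longlonglongrightarrow> 0"
      by (intro mono_average_tendsto_0[where p = 5]) auto
    then show "(\<lambda>M. (\<Sum>a<M. of_bool (\<omega> (s a) = v)) / M) \<longlonglongrightarrow> (0 :: real)" by (simp add: C_def)
  qed
qed

end

section \<open>Return frequencies\<close>

text \<open>The sums are not monotone, but bounded terms change them by at most \<open>2 * m\<close>
  between consecutive squares. The threshold \<open>N'\<close> makes this less than half of the
  allowed error \<open>e * m ^ 2\<close>.\<close>

lemma bounded_average_tendsto_0:
  fixes a :: "nat \<Rightarrow> real"
  assumes bound: "\<And>i. \<bar>a i\<bar> \<le> 1"
    and lim: "(\<lambda>m. (\<Sum>i<Suc m ^ 2. a i) / real (Suc m ^ 2)) \<longlonglongrightarrow> 0"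
  shows "(\<lambda>M. (\<Sum>i<M. a i) / M) \<longlonglongrightarrow> 0"
proof (rule LIMSEQ_I)
  fix e :: real assume e: "e > 0"
  obtain N where N: "\<And>m. m \<ge> N \<Longrightarrow> \<bar>(\<Sum>i<Suc m ^ 2. a i) / real (Suc m ^ 2)\<bar> < e / 2"
    using LIMSEQ_D[OF lim, of "e / 2"] e by auto
  obtain N' :: nat where N': "4 / e < N'" using reals_Archimedean2 by blast
  have "norm ((\<Sum>i<M. a i) / M - 0) < e" if M: "M \<ge> Suc (N + N') ^ 2" for M
  proof -
    obtain m where m: "m ^ 2 \<le> M" "M < Suc m ^ 2" using between_consecutive_powers[of 2 M, OF pos2] by blast
    have "Suc (N + N') ^ 2 < Suc m ^ 2" using m M by simp
    then have "Suc (N + N') < Suc m" by (rule power_less_imp_less_base) simp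
    then obtain k where k: "m = Suc k" "N \<le> k" "N' \<le> m" by (cases m) auto
    have m0: "real m > 0" using k by simp
    have "(\<Sum>i<M. a i) = (\<Sum>i<m ^ 2. a i) + (\<Sum>i\<in>{m ^ 2..<M}. a i)"
      using sum.atLeastLessThan_concat[of 0 "m ^ 2" M a] m by (simp add: atLeast0LessThan)
    moreover have "\<bar>\<Sum>i\<in>{m ^ 2..<M}. a i\<bar> \<le> 2 * m"
    proof -
      have "\<bar>\<Sum>i\<in>{m ^ 2..<M}. a i\<bar> \<le> (\<Sum>i\<in>{m ^ 2..<M}. 1)"
        using bound by (intro order.trans[OF sum_abs] sum_mono)
      also have "\<dots> = real (M - m ^ 2)" by simp
      also have "\<dots> \<le> real (2 * m)" using m by (intro of_nat_mono) (simp add: power2_eq_square)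
      finally show ?thesis by simp
    qed
    moreover have "\<bar>\<Sum>i<m ^ 2. a i\<bar> < e / 2 * real m ^ 2"
      using N[OF k(2)] m0 unfolding k(1)[symmetric] by (simp add: field_simps)
    moreover have "2 * real m < e / 2 * real m ^ 2"
    proof -
      have "4 < e * N'" using N' e by (simp add: field_simps)
      also have "\<dots> \<le> e * m" using k e by simp
      finally show ?thesis using m0 by (simp add: power2_eq_square)
    qed
    ultimately have "\<bar>\<Sum>i<M. a i\<bar> < e * real m ^ 2" by linarith
    also have "\<dots> \<le> e * M" using m e by (intro mult_left_mono) (auto simp flip: of_nat_power)
    finally have "\<bar>\<Sum>i<M. a i\<bar> < e * M" .
    moreover have "real M > 0"
      using m m0 by (metis less_le_trans of_nat_0_less_iff zero_less_power)
    ultimately show ?thesis by (simp add: field_simps)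
  qed
  then show "\<exists>N. \<forall>M\<ge>N. norm ((\<Sum>i<M. a i) / M - 0) < e" by blast
qed

context recurrent_rooted_graph begin

definition visits :: "nat \<Rightarrow> (nat \<Rightarrow> 'v) \<Rightarrow> nat" where
  "visits T \<omega> = card ({t. \<omega> t = v} \<inter> {..<T})"

lemma visits_Suc: "visits (Suc T) \<omega> = visits T \<omega> + of_bool (\<omega> T = v)"
proof -
  have "{t. \<omega> t = v} \<inter> {..<Suc T} = (if \<omega> T = v then insert T ({t. \<omega> t = v} \<inter> {..<T}) else {t. \<omega> t = v} \<inter> {..<T})"
    by (auto simp: less_Suc_eq)
  then show ?thesis by (simp add: visits_def)
qed

lemma visits_0 [simp]: "visits 0 \<omega> = 0"
  by (simp add: visits_def)

lemma visits_eq_sum: "real (visits T \<omega>) = (\<Sum>t<T. of_bool (\<omega> t = v))"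
  by (induction T) (auto simp: visits_Suc)

text \<open>Selects the first \<open>M\<close> visit times. \<open>visits s\<close> counts times
  strictly before \<open>s\<close>, hence the strict inequality, and the condition depends on the
  path up to \<open>s\<close> only.\<close>

definition early_visit :: "nat \<Rightarrow> nat \<Rightarrow> (nat \<Rightarrow> 'v) \<Rightarrow> bool" where
  "early_visit M s \<omega> \<longleftrightarrow> \<omega> s = v \<and> visits s \<omega> < M"

lemma determined_early_visit: "s \<le> t \<Longrightarrow> determined_by_prefix t {\<omega>. early_visit M s \<omega>}"
proof -
  have "visits s \<omega> = visits s \<omega>'" if "\<forall>i\<le>t. \<omega> i = \<omega>' i" "s \<le> t" for \<omega> \<omega>'
  proof -
    have "{t. \<omega> t = v} \<inter> {..<s} = {t. \<omega>' t = v} \<inter> {..<s}" using that by auto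
    then show ?thesis by (simp add: visits_def)
  qed
  then show "s \<le> t \<Longrightarrow> determined_by_prefix t {\<omega>. early_visit M s \<omega>}"
    unfolding determined_by_prefix_def early_visit_def by (metis mem_Collect_eq)
qed

lemma determined_conj:
  "determined_by_prefix t {\<omega>. P \<omega>} \<Longrightarrow> determined_by_prefix t {\<omega>. Q \<omega>} \<Longrightarrow> determined_by_prefix t {\<omega>. P \<omega> \<and> Q \<omega>}"
  unfolding determined_by_prefix_def by blast

lemma determined_at: "s \<le> t \<Longrightarrow> determined_by_prefix t {\<omega>. \<omega> s = x}"
  using determined_by_prefix_mono[OF determined_visit] .

lemma sum_early_visit_le: "(\<Sum>s<T. of_bool (early_visit M s \<omega>)) \<le> real M"
proof -
  have "(\<Sum>s<T. of_bool (early_visit M s \<omega>)) = real (min M (visits T \<omega>))"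
    by (induction T) (auto simp: early_visit_def visits_Suc)
  then show ?thesis by simp
qed

definition return_deviation :: "nat \<Rightarrow> nat \<Rightarrow> (nat \<Rightarrow> 'v) \<Rightarrow> real" where
  "return_deviation n s \<omega> = of_bool (\<omega> (s + n) = v) - return_prob n"

lemma abs_return_deviation_le_1: "\<bar>return_deviation n s \<omega>\<bar> \<le> 1"
  using return_prob_nonneg[of n] return_prob_le_1[of n] by (auto simp: return_deviation_def)

text \<open>By time \<open>t\<close> the whole term of \<open>s\<close> and the condition at
  \<open>t\<close> are decided. The walk is then at the root, so its return after \<open>n\<close>
  more steps has conditional probability exactly \<open>return_prob n\<close>. Expanding the product
  leaves four indicators, for \<open>B\<close> and \<open>B1\<close> with and without this
  return.\<close>

lemma early_deviation_orthogonal: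
  assumes "s + n \<le> t"
  shows "expectation (\<lambda>\<omega>. (of_bool (early_visit M s \<omega>) * return_deviation n s \<omega>) *
     (of_bool (early_visit M t \<omega>) * return_deviation n t \<omega>)) = 0"
proof -
  define B where "B \<omega> \<longleftrightarrow> (early_visit M s \<omega> \<and> early_visit M t \<omega>)" for \<omega>
  define B1 where "B1 \<omega> \<longleftrightarrow> (B \<omega> \<and> \<omega> (s + n) = v)" for \<omega>
  let ?u = "return_prob n"
  have det: "determined_by_prefix t {\<omega>. B \<omega>}" "determined_by_prefix t {\<omega>. B1 \<omega>}"
    unfolding B1_def B_def using assms
    by (auto intro!: determined_conj determined_early_visit determined_at)
  have sub: "{\<omega>. B \<omega>} \<subseteq> {\<omega>. \<omega> t = v}" "{\<omega>. B1 \<omega>} \<subseteq> {\<omega>. \<omega> t = v}"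
    by (auto simp: B1_def B_def early_visit_def)
  have ev: "{\<omega>. B \<omega>} \<in> events" "{\<omega>. B1 \<omega>} \<in> events"
    using events_determined det by blast+
  have ev': "{\<omega>. B \<omega> \<and> \<omega> (t + n) = v} \<in> events" "{\<omega>. B1 \<omega> \<and> \<omega> (t + n) = v} \<in> events"
    using sets.Int[OF ev(1) events_visit[of "t + n" v]] sets.Int[OF ev(2) events_visit[of "t + n" v]]
    by (simp_all add: Int_def)
  have pr: "prob {\<omega>. B \<omega> \<and> \<omega> (t + n) = v} = prob {\<omega>. B \<omega>} * ?u"
    "prob {\<omega>. B1 \<omega> \<and> \<omega> (t + n) = v} = prob {\<omega>. B1 \<omega>} * ?u"
    using prob_visit_after[OF det(1) sub(1)] prob_visit_after[OF det(2) sub(2)] by simp_all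
  have eq: "(of_bool (early_visit M s \<omega>) * return_deviation n s \<omega>) * (of_bool (early_visit M t \<omega>) * return_deviation n t \<omega>) =
      of_bool (B1 \<omega> \<and> \<omega> (t + n) = v) - ?u * of_bool (B1 \<omega>) - ?u * of_bool (B \<omega> \<and> \<omega> (t + n) = v)
      + ?u\<^sup>2 * of_bool (B \<omega>)" for \<omega>
    by (cases "early_visit M s \<omega>"; cases "early_visit M t \<omega>"; cases "\<omega> (s + n) = v"; cases "\<omega> (t + n) = v")
       (simp_all add: B1_def B_def return_deviation_def power2_eq_square algebra_simps)
  show ?thesis
    unfolding eq
    by (simp add: integral_of_bool_visit[OF ev(1)] integral_of_bool_visit[OF ev(2)]
        integral_of_bool_visit[OF ev'(1)] integral_of_bool_visit[OF ev'(2)] pr power2_eq_square)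
qed

definition early_deviation_sum :: "nat \<Rightarrow> nat \<Rightarrow> nat \<Rightarrow> (nat \<Rightarrow> 'v) \<Rightarrow> real" where
  "early_deviation_sum n M T \<omega> = (\<Sum>s<T. of_bool (early_visit M s \<omega>) * return_deviation n s \<omega>)"

lemma measurable_early_visit [measurable]:
  "(\<lambda>\<omega>. of_bool (early_visit M s \<omega>) :: real) \<in> borel_measurable (srw E v)"
  by (intro borel_measurable_integrable integral_of_bool_visit events_determined[OF determined_early_visit[OF order_refl]])

lemma measurable_return_deviation [measurable]: "return_deviation n s \<in> borel_measurable (srw E v)"
proof -
  have [measurable]: "(\<lambda>\<omega>. of_bool (\<omega> (s + n) = v) :: real) \<in> borel_measurable (srw E v)"
    by (intro borel_measurable_integrable integral_of_bool_visit events_visit)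
  show ?thesis unfolding return_deviation_def[abs_def] by measurable
qed

lemma measurable_early_deviation_sum [measurable]:
  "early_deviation_sum n M T \<in> borel_measurable (srw E v)"
  unfolding early_deviation_sum_def[abs_def] by measurable

text \<open>For each \<open>s\<close> fewer than \<open>2 * n\<close> times \<open>t\<close> can be
  correlated with it, each contributing at most the probability of \<open>early_visit M s\<close>;
  these probabilities sum to at most \<open>M\<close>. The bound does not depend on
  \<open>T\<close>.\<close>

lemma early_deviation_sum_moment:
  "integrable (srw E v) (\<lambda>\<omega>. (early_deviation_sum n M T \<omega>)\<^sup>2)"
  "expectation (\<lambda>\<omega>. (early_deviation_sum n M T \<omega>)\<^sup>2) \<le> 2 * real n * real M"
proof -
  define X where "X s \<omega> = of_bool (early_visit M s \<omega>) * return_deviation n s \<omega>" for s \<omega>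
  have [measurable]: "X s \<in> borel_measurable (srw E v)" for s unfolding X_def[abs_def] by measurable
  have X_le: "\<bar>X s \<omega>\<bar> \<le> of_bool (early_visit M s \<omega>)" for s \<omega>
    using abs_return_deviation_le_1 by (auto simp: X_def)
  have XX_le: "\<bar>X s \<omega> * X t \<omega>\<bar> \<le> of_bool (early_visit M s \<omega>)" for s t \<omega>
  proof -
    have "\<bar>X s \<omega> * X t \<omega>\<bar> \<le> of_bool (early_visit M s \<omega>) * 1"
      unfolding abs_mult using X_le[of s \<omega>] X_le[of t \<omega>] by (intro mult_mono) (auto intro: order.trans)
    then show ?thesis by simp
  qed
  have XX_int: "integrable (srw E v) (\<lambda>\<omega>. X s \<omega> * X t \<omega>)" for s t
  proof (rule integrable_const_bound[where B = 1])
    show "AE \<omega> in srw E v. norm (X s \<omega> * X t \<omega>) \<le> 1"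
    proof (rule AE_I2)
      fix \<omega>
      have "\<bar>X s \<omega> * X t \<omega>\<bar> \<le> of_bool (early_visit M s \<omega>)" by (rule XX_le)
      also have "\<dots> \<le> 1" by simp
      finally show "norm (X s \<omega> * X t \<omega>) \<le> 1" by simp
    qed
  qed measurable
  have sq: "(early_deviation_sum n M T \<omega>)\<^sup>2 = (\<Sum>s<T. \<Sum>t<T. X s \<omega> * X t \<omega>)" for \<omega>
    by (simp only: early_deviation_sum_def X_def power2_eq_square sum_product)
  show "integrable (srw E v) (\<lambda>\<omega>. (early_deviation_sum n M T \<omega>)\<^sup>2)"
    unfolding sq by (intro Bochner_Integration.integrable_sum XX_int)
  have early_int: "integrable (srw E v) (\<lambda>\<omega>. of_bool (early_visit M s \<omega>) :: real)" for s
    by (intro integral_of_bool_visit events_determined[OF determined_early_visit[OF order_refl]])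
  define p :: "nat \<Rightarrow> real" where "p s = expectation (\<lambda>\<omega>. of_bool (early_visit M s \<omega>))" for s
  have p0: "0 \<le> p s" for s unfolding p_def by (rule Bochner_Integration.integral_nonneg) simp
  \<comment> \<open>The interval consists of the \<open>t\<close> at distance less than
    \<open>n\<close> from \<open>s\<close>; truncated subtraction gives the correct lower end near
    0.\<close>
  have XX: "expectation (\<lambda>\<omega>. X s \<omega> * X t \<omega>) \<le> p s * of_bool (t \<in> {s + 1 - n..<s + n})" for s t
  proof (cases "t \<in> {s + 1 - n..<s + n}")
    case True
    have "expectation (\<lambda>\<omega>. X s \<omega> * X t \<omega>) \<le> p s"
      unfolding p_def by (intro integral_mono XX_int early_int abs_le_D1[OF XX_le])
    then show ?thesis using True by simp
  next
    case False
    then have "s + n \<le> t \<or> t + n \<le> s" by auto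
    moreover have "expectation (\<lambda>\<omega>. X s \<omega> * X t \<omega>) = expectation (\<lambda>\<omega>. X t \<omega> * X s \<omega>)"
      by (simp only: mult.commute)
    ultimately have "expectation (\<lambda>\<omega>. X s \<omega> * X t \<omega>) = 0"
      using early_deviation_orthogonal[of s n t M] early_deviation_orthogonal[of t n s M]
      unfolding X_def[symmetric] by argo
    then show ?thesis using False p0[of s] by simp
  qed
  have "expectation (\<lambda>\<omega>. (early_deviation_sum n M T \<omega>)\<^sup>2) = (\<Sum>s<T. \<Sum>t<T. expectation (\<lambda>\<omega>. X s \<omega> * X t \<omega>))"
    unfolding sq
    by (subst Bochner_Integration.integral_sum, intro Bochner_Integration.integrable_sum XX_int)
       (intro sum.cong refl Bochner_Integration.integral_sum XX_int)
  also have "\<dots> \<le> (\<Sum>s<T. \<Sum>t<T. p s * of_bool (t \<in> {s + 1 - n..<s + n}))"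
    by (intro sum_mono XX)
  also have "\<dots> = (\<Sum>s<T. p s * (\<Sum>t<T. of_bool (t \<in> {s + 1 - n..<s + n})))"
    by (simp only: sum_distrib_left)
  also have "\<dots> \<le> (\<Sum>s<T. p s * (2 * real n))"
  proof (intro sum_mono mult_left_mono p0)
    fix s
    have "(\<Sum>t<T. of_bool (t \<in> {s + 1 - n..<s + n})) = real (card ({..<T} \<inter> {s + 1 - n..<s + n}))"
      by (simp add: of_bool_def sum.If_cases Int_def)
    also have "card ({..<T} \<inter> {s + 1 - n..<s + n}) \<le> card {s + 1 - n..<s + n}" by (intro card_mono) auto
    also have "\<dots> \<le> 2 * n" by simp
    finally show "(\<Sum>t<T. of_bool (t \<in> {s + 1 - n..<s + n})) \<le> 2 * real n" by simp
  qed
  also have "\<dots> = 2 * real n * (\<Sum>s<T. p s)"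
    by (simp only: sum_distrib_right[symmetric] mult.commute)
  also have "(\<Sum>s<T. p s) = expectation (\<lambda>\<omega>. \<Sum>s<T. of_bool (early_visit M s \<omega>))"
    unfolding p_def by (rule Bochner_Integration.integral_sum[symmetric]) (rule early_int)
  also have "2 * real n * expectation (\<lambda>\<omega>. \<Sum>s<T. of_bool (early_visit M s \<omega>)) \<le> 2 * real n * real M"
  proof (rule mult_left_mono)
    have "expectation (\<lambda>\<omega>. \<Sum>s<T. of_bool (early_visit M s \<omega>)) \<le> expectation (\<lambda>\<omega>. real M)"
      by (intro integral_mono Bochner_Integration.integrable_sum early_int sum_early_visit_le) simp
    then show "expectation (\<lambda>\<omega>. \<Sum>s<T. of_bool (early_visit M s \<omega>)) \<le> real M"
      using prob_space by simp
  qed simp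
  finally show "expectation (\<lambda>\<omega>. (early_deviation_sum n M T \<omega>)\<^sup>2) \<le> 2 * real n * real M" .
qed

lemma early_deviation_sum_eq:
  assumes inf: "infinite {t. \<omega> t = v}" and "M \<le> visits T \<omega>"
  shows "early_deviation_sum n M T \<omega> = (\<Sum>i<M. return_deviation n (enumerate {t. \<omega> t = v} i) \<omega>)"
proof -
  let ?S = "{t. \<omega> t = v}"
  have "early_deviation_sum n M T \<omega> = (\<Sum>s\<in>?S \<inter> {..<T}. of_bool (visits s \<omega> < M) * return_deviation n s \<omega>)"
    unfolding early_deviation_sum_def
    by (rule sum.mono_neutral_cong_right) (auto simp: early_visit_def)
  also have "\<dots> = (\<Sum>i<visits T \<omega>. of_bool (i < M) * return_deviation n (enumerate ?S i) \<omega>)"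
    unfolding sum_Int_lessThan_enumerate[OF inf] visits_def card_Int_lessThan_enumerate[OF inf] ..
  also have "\<dots> = (\<Sum>i<M. return_deviation n (enumerate ?S i) \<omega>)"
    using assms(2) by (intro sum.mono_neutral_cong_right) auto
  finally show ?thesis .
qed

text \<open>Stopping at the \<open>M\<close>-th visit by a condition on the past avoids the strong Markov property: only
  deviations fewer than \<open>n\<close> steps apart are correlated.\<close>

proposition AE_average_return_deviation:
  "AE \<omega> in srw E v. (\<lambda>M. (\<Sum>i<M. return_deviation n (enumerate {t. \<omega> t = v} i) \<omega>) / M) \<longlonglongrightarrow> 0"
proof -
  define H where "H m T \<omega> = (early_deviation_sum n (Suc m ^ 2) T \<omega> / real (Suc m ^ 2))\<^sup>2" for m T \<omega>
  \<comment> \<open>The time needed for \<open>Suc m ^ 2\<close> visits is random, so the moment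
    bound, uniform in \<open>T\<close>, is carried to large \<open>T\<close> by Fatou's
    lemma.\<close>
  define G where "G m \<omega> = liminf (\<lambda>T. ennreal (H m T \<omega>))" for m \<omega>
  have H_meas [measurable]: "H m T \<in> borel_measurable (srw E v)" for m T
    unfolding H_def[abs_def] by measurable
  have G_meas [measurable]: "G m \<in> borel_measurable (srw E v)" for m
    unfolding G_def[abs_def] by measurable
  have H_le: "(\<integral>\<^sup>+\<omega>. ennreal (H m T \<omega>) \<partial>srw E v) \<le> ennreal (2 * n / real (Suc m) ^ 2)" for m T
  proof -
    have "(\<integral>\<^sup>+\<omega>. ennreal (H m T \<omega>) \<partial>srw E v) = ennreal (expectation (H m T))"
      unfolding H_def[abs_def] power_divide
      by (rule nn_integral_eq_integral) (auto intro!: early_deviation_sum_moment)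
    also have "expectation (H m T) = expectation (\<lambda>\<omega>. (early_deviation_sum n (Suc m ^ 2) T \<omega>)\<^sup>2) / (real (Suc m ^ 2))\<^sup>2"
      unfolding H_def[abs_def] power_divide by (rule integral_divide_zero)
    also have "\<dots> \<le> 2 * real n * real (Suc m ^ 2) / (real (Suc m ^ 2))\<^sup>2"
      by (intro divide_right_mono early_deviation_sum_moment) simp
    also have "\<dots> = 2 * n / real (Suc m) ^ 2"
    proof -
      have "2 * real n * x ^ 2 / (x ^ 2)\<^sup>2 = 2 * real n / x ^ 2" if "x \<noteq> 0" for x :: real
        using that by (simp add: field_simps)
      from this[of "real (Suc m)"] show ?thesis by (simp add: of_nat_power del: of_nat_Suc)
    qed
    finally show ?thesis by (simp add: ennreal_leI)
  qed
  have "AE \<omega> in srw E v. (\<lambda>m. enn2real (G m \<omega>)) \<longlonglongrightarrow> 0"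
  proof (rule AE_tendsto_0_if_summable[OF _ _ _ summable_const_over_Suc_squared[of "2 * n"]])
    fix m
    \<comment> \<open>\<open>enn2real\<close> sends infinity to 0 and so only lowers the integrand.
      On paths with infinitely many visits nothing is lost: \<open>H m T\<close> is eventually
      constant in \<open>T\<close>.\<close>
    have "(\<integral>\<^sup>+\<omega>. ennreal (enn2real (G m \<omega>)) \<partial>srw E v) \<le> (\<integral>\<^sup>+\<omega>. G m \<omega> \<partial>srw E v)"
      by (intro nn_integral_mono) (simp add: ennreal_enn2real_if)
    also have "\<dots> \<le> liminf (\<lambda>T. \<integral>\<^sup>+\<omega>. ennreal (H m T \<omega>) \<partial>srw E v)"
      unfolding G_def by (rule nn_integral_liminf) simp
    also have "\<dots> \<le> liminf (\<lambda>T. ennreal (2 * n / real (Suc m) ^ 2))"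
      by (intro Liminf_mono always_eventually allI H_le)
    also have "\<dots> = ennreal (2 * n / real (Suc m) ^ 2)" by (simp add: Liminf_const)
    finally show "(\<integral>\<^sup>+\<omega>. ennreal (enn2real (G m \<omega>)) \<partial>srw E v) \<le> ennreal (real (2 * n) / real (Suc m) ^ 2)" by simp
  qed auto
  with AE_infinitely_many_visits show ?thesis
  proof eventually_elim
    fix \<omega> :: "nat \<Rightarrow> 'v"
    assume inf: "infinite {t. \<omega> t = v}" and lim: "(\<lambda>m. enn2real (G m \<omega>)) \<longlonglongrightarrow> 0"
    define a where "a i = return_deviation n (enumerate {t. \<omega> t = v} i) \<omega>" for i
    have "G m \<omega> = ennreal (((\<Sum>i<Suc m ^ 2. a i) / real (Suc m ^ 2))\<^sup>2)" for m
    proof -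
      have "\<forall>\<^sub>F T in sequentially. Suc m ^ 2 \<le> visits T \<omega>"
        using card_Int_lessThan_at_top[OF inf] unfolding filterlim_at_top visits_def by blast
      then have "\<forall>\<^sub>F T in sequentially. ennreal (H m T \<omega>) = ennreal (((\<Sum>i<Suc m ^ 2. a i) / real (Suc m ^ 2))\<^sup>2)"
        by eventually_elim (simp only: H_def a_def early_deviation_sum_eq[OF inf])
      then have "(\<lambda>T. ennreal (H m T \<omega>)) \<longlonglongrightarrow> ennreal (((\<Sum>i<Suc m ^ 2. a i) / real (Suc m ^ 2))\<^sup>2)"
        by (rule tendsto_eventually)
      then show ?thesis unfolding G_def by (rule lim_imp_Liminf[OF sequentially_bot])
    qed
    then have "(\<lambda>m. ((\<Sum>i<Suc m ^ 2. a i) / real (Suc m ^ 2))\<^sup>2) \<longlonglongrightarrow> 0"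
      using lim by (simp only: enn2real_ennreal[OF zero_le_power2])
    then have "(\<lambda>m. (\<Sum>i<Suc m ^ 2. a i) / real (Suc m ^ 2)) \<longlonglongrightarrow> 0" by (rule power2_tendsto_0_imp)
    then show "(\<lambda>M. (\<Sum>i<M. return_deviation n (enumerate {t. \<omega> t = v} i) \<omega>) / M) \<longlonglongrightarrow> 0"
      unfolding a_def by (intro bounded_average_tendsto_0 abs_return_deviation_le_1)
  qed
qed

end

section \<open>Numbers of visits on exponential scales\<close>

text \<open>The sequence \<open>u\<close> is a parameter so that the estimator can form the same
  scales from estimated return probabilities.\<close>

definition scale :: "(nat \<Rightarrow> real) \<Rightarrow> nat \<Rightarrow> nat" where
  "scale u i = (LEAST b. 2 ^ i \<le> (\<Sum>t<b. u t))"

lemma sum_half_powers_le: "(\<Sum>i<n. (1/2::real) ^ (n - i)) \<le> 1"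
proof (induction n)
  case (Suc n)
  have "(\<Sum>i<Suc n. (1/2::real) ^ (Suc n - i)) = (\<Sum>i<n. (1/2) ^ (n - i) * (1/2)) + 1/2"
    by (simp add: Suc_diff_le mult.commute)
  also have "\<dots> = (\<Sum>i<n. (1/2::real) ^ (n - i)) * (1/2) + 1/2"
    by (simp only: sum_distrib_right)
  finally show ?case using Suc by simp
qed simp

text \<open>Each induction step adds two geometric series of sum at most 1 and one diagonal
  term.\<close>

lemma sum_half_powers_pairs_le: "(\<Sum>i<n. \<Sum>j<n. (1/2::real) ^ (max i j - min i j)) \<le> 3 * real n"
proof (induction n)
  case (Suc n)
  have "(\<Sum>i<Suc n. \<Sum>j<Suc n. (1/2::real) ^ (max i j - min i j)) =
     (\<Sum>i<n. \<Sum>j<n. (1/2) ^ (max i j - min i j)) + (\<Sum>i<n. (1/2) ^ (max i n - min i n))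
     + (\<Sum>j<n. (1/2) ^ (max n j - min n j)) + 1"
    by (simp add: sum.distrib)
  also have "(\<Sum>i<n. (1/2::real) ^ (max i n - min i n)) = (\<Sum>i<n. (1/2) ^ (n - i))"
    by (intro sum.cong refl) (simp add: max_def min_def)
  also have "(\<Sum>j<n. (1/2::real) ^ (max n j - min n j)) = (\<Sum>i<n. (1/2) ^ (n - i))"
    by (intro sum.cong refl) (simp add: max_def min_def)
  finally show ?case using Suc sum_half_powers_le[of n] by simp
qed simp

context recurrent_rooted_graph begin

abbreviation time_scale :: "nat \<Rightarrow> nat" where
  "time_scale \<equiv> scale return_prob"

lemma green_time_scale_ge: "2 ^ i \<le> green (time_scale i)"
proof -
  have "\<exists>b. 2 ^ i \<le> green b"
    using green_at_top by (auto simp: filterlim_at_top eventually_sequentially)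
  then show ?thesis
    unfolding scale_def green_def[symmetric] by (rule LeastI_ex)
qed

lemma green_time_scale_pos: "0 < green (time_scale i)"
  by (rule less_le_trans[OF _ green_time_scale_ge]) simp

text \<open>By minimality the value one step earlier is below \<open>2 ^ i\<close>, and a single
  term adds at most 1.\<close>

lemma green_time_scale_le: "green (time_scale i) \<le> 2 * 2 ^ i"
proof (cases "time_scale i")
  case 0
  then show ?thesis by (simp add: green_def)
next
  case (Suc b)
  then have "\<not> 2 ^ i \<le> green b"
    unfolding scale_def green_def[symmetric] by (metis lessI not_less_Least)
  moreover have "green (Suc b) \<le> green b + 1" by (simp add: green_def)
  moreover have "(1::real) \<le> 2 ^ i" by simp
  ultimately show ?thesis unfolding Suc by linarith
qed

lemma time_scale_mono: "i \<le> j \<Longrightarrow> time_scale i \<le> time_scale j"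
proof -
  assume "i \<le> j"
  then have "2 ^ i \<le> green (time_scale j)"
    using green_time_scale_ge[of j] power_increasing[of i j "2::real"] by linarith
  then show ?thesis
    unfolding scale_def[of _ i] green_def[symmetric] by (rule Least_le)
qed

lemma time_scale_at_top: "filterlim time_scale at_top sequentially"
  unfolding filterlim_at_top eventually_sequentially
proof (intro allI)
  fix Z
  show "\<exists>N. \<forall>n\<ge>N. Z \<le> time_scale n"
  proof (intro exI allI impI)
    fix n assume "Z \<le> n"
    have "real n \<le> 2 ^ n" using of_nat_mono[OF less_imp_le[OF less_exp[of n]]] by simp
    also have "\<dots> \<le> green (time_scale n)" by (rule green_time_scale_ge)
    also have "\<dots> \<le> (\<Sum>t<time_scale n. 1)" unfolding green_def by (intro sum_mono) simp
    finally show "Z \<le> time_scale n" using \<open>Z \<le> n\<close> by simp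
  qed
qed

lemma expectation_visits:
  "integrable (srw E v) (\<lambda>\<omega>. real (visits a \<omega>))" "expectation (\<lambda>\<omega>. real (visits a \<omega>)) = green a"
proof -
  show "integrable (srw E v) (\<lambda>\<omega>. real (visits a \<omega>))"
    unfolding visits_eq_sum by (intro Bochner_Integration.integrable_sum integral_of_bool_visit events_visit)
  have "expectation (\<lambda>\<omega>. \<Sum>t<a. of_bool (\<omega> t = v)) = (\<Sum>t<a. expectation (\<lambda>\<omega>. of_bool (\<omega> t = v)) :: real)"
    by (intro Bochner_Integration.integral_sum integral_of_bool_visit events_visit)
  also have "\<dots> = green a"
    by (simp only: integral_of_bool_visit(2)[OF events_visit] green_def return_prob_def)
  finally show "expectation (\<lambda>\<omega>. real (visits a \<omega>)) = green a"
    unfolding visits_eq_sum .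
qed

lemma expectation_visits_mult:
  "integrable (srw E v) (\<lambda>\<omega>. real (visits a \<omega>) * real (visits b \<omega>))"
  "a \<le> b \<Longrightarrow> expectation (\<lambda>\<omega>. real (visits a \<omega>) * real (visits b \<omega>)) \<le> green a * green b + (green a)\<^sup>2"
proof -
  show "integrable (srw E v) (\<lambda>\<omega>. real (visits a \<omega>) * real (visits b \<omega>))"
    unfolding visits_eq_sum by (rule second_moment_visits) auto
  have "expectation (\<lambda>\<omega>. real (visits a \<omega>) * real (visits b \<omega>)) =
      (\<Sum>s<a. \<Sum>t<b. return_prob (min s t) * return_prob (max s t - min s t))"
    unfolding visits_eq_sum by (rule second_moment_visits) auto
  then show "expectation (\<lambda>\<omega>. real (visits a \<omega>) * real (visits b \<omega>)) \<le> green a * green b + (green a)\<^sup>2" if "a \<le> b"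
    using sum_symmetric_pairs_le[of return_prob a b] that by (simp add: green_def)
qed

definition scaled_visits :: "nat \<Rightarrow> (nat \<Rightarrow> 'v) \<Rightarrow> real" where
  "scaled_visits i \<omega> = visits (time_scale i) \<omega> / green (time_scale i)"

text \<open>For i \<le> j the mean of the product exceeds 1 by at most the ratio of the two values
  of \<open>green\<close>, the share of pairs whose time counted for \<open>j\<close> comes first.
  The factor 2 is the overshoot of the scales.\<close>

lemma scaled_visits_covariance:
  "integrable (srw E v) (\<lambda>\<omega>. (scaled_visits i \<omega> - 1) * (scaled_visits j \<omega> - 1))"
  "expectation (\<lambda>\<omega>. (scaled_visits i \<omega> - 1) * (scaled_visits j \<omega> - 1)) \<le> 2 * (1/2) ^ (max i j - min i j)"
proof -
  have int1: "integrable (srw E v) (scaled_visits i)" for i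
    unfolding scaled_visits_def[abs_def] by (intro integrable_divide_zero expectation_visits)
  have E1: "expectation (scaled_visits i) = 1" for i
    unfolding scaled_visits_def[abs_def] integral_divide_zero expectation_visits(2)
    using green_time_scale_pos[of i] by simp
  have prod: "scaled_visits i \<omega> * scaled_visits j \<omega> =
      (real (visits (time_scale i) \<omega>) * real (visits (time_scale j) \<omega>)) / (green (time_scale i) * green (time_scale j))" for i j \<omega>
    by (simp add: scaled_visits_def)
  have int2: "integrable (srw E v) (\<lambda>\<omega>. scaled_visits i \<omega> * scaled_visits j \<omega>)" for i j
    unfolding prod by (intro integrable_divide_zero expectation_visits_mult)
  have eq: "(\<lambda>\<omega>. (scaled_visits i \<omega> - 1) * (scaled_visits j \<omega> - 1)) =
      (\<lambda>\<omega>. scaled_visits i \<omega> * scaled_visits j \<omega> - scaled_visits i \<omega> - scaled_visits j \<omega> + 1)" for i j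
    by (simp add: algebra_simps)
  show int: "integrable (srw E v) (\<lambda>\<omega>. (scaled_visits i \<omega> - 1) * (scaled_visits j \<omega> - 1))"
    unfolding eq by (intro Bochner_Integration.integrable_add Bochner_Integration.integrable_diff int1 int2 integrable_const)
  have le: "expectation (\<lambda>\<omega>. (scaled_visits i \<omega> - 1) * (scaled_visits j \<omega> - 1)) \<le> 2 * (1/2) ^ (j - i)" if "i \<le> j" for i j
  proof -
    let ?a = "green (time_scale i)" and ?b = "green (time_scale j)"
    have "expectation (\<lambda>\<omega>. scaled_visits i \<omega> * scaled_visits j \<omega>) \<le> (?a * ?b + ?a\<^sup>2) / (?a * ?b)"
      unfolding prod integral_divide_zero
      using green_time_scale_pos[of i] green_time_scale_pos[of j]
      by (intro divide_right_mono expectation_visits_mult time_scale_mono that) simp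
    also have "\<dots> = 1 + ?a / ?b"
      using green_time_scale_pos[of i] green_time_scale_pos[of j]
      by (simp add: add_divide_distrib power2_eq_square)
    finally have "expectation (\<lambda>\<omega>. scaled_visits i \<omega> * scaled_visits j \<omega>) \<le> 1 + ?a / ?b" .
    moreover have "?a / ?b \<le> (2 * 2 ^ i) / 2 ^ j"
      using green_time_scale_pos[of i]
      by (intro frac_le green_time_scale_ge green_time_scale_le) auto
    moreover have "(2 * 2 ^ i) / 2 ^ j = (2 * (1/2) ^ (j - i) :: real)"
      using that by (simp add: power_diff power_divide)
    moreover have "expectation (\<lambda>\<omega>. (scaled_visits i \<omega> - 1) * (scaled_visits j \<omega> - 1)) =
        expectation (\<lambda>\<omega>. scaled_visits i \<omega> * scaled_visits j \<omega>) - 1"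
      unfolding eq using int1 int2 E1 prob_space by simp
    ultimately show ?thesis by linarith
  qed
  have "(\<lambda>\<omega>. (scaled_visits i \<omega> - 1) * (scaled_visits j \<omega> - 1)) = (\<lambda>\<omega>. (scaled_visits j \<omega> - 1) * (scaled_visits i \<omega> - 1))"
    by (simp only: mult.commute)
  then show "expectation (\<lambda>\<omega>. (scaled_visits i \<omega> - 1) * (scaled_visits j \<omega> - 1)) \<le> 2 * (1/2) ^ (max i j - min i j)"
    using le[of i j] le[of j i] by (cases i j rule: le_cases) (auto simp: max_def min_def)
qed

text \<open>Geometric covariances make the variance of a sum of \<open>n\<close> terms linear in
  \<open>n\<close>, with 6 = 2 * 3; for square \<open>n\<close> the relative variances are summable.
  The estimator uses the same squares, so no interpolation follows.\<close>

proposition AE_average_scaled_visits: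
  "AE \<omega> in srw E v. (\<lambda>m. (\<Sum>i<Suc m ^ 2. scaled_visits i \<omega>) / real (Suc m ^ 2)) \<longlonglongrightarrow> 1"
proof -
  define D where "D n \<omega> = (\<Sum>i<n. scaled_visits i \<omega> - 1)" for n \<omega>
  have sq: "(D n \<omega>)\<^sup>2 = (\<Sum>i<n. \<Sum>j<n. (scaled_visits i \<omega> - 1) * (scaled_visits j \<omega> - 1))" for n \<omega>
    by (simp only: D_def power2_eq_square sum_product)
  have D_int: "integrable (srw E v) (\<lambda>\<omega>. (D n \<omega>)\<^sup>2)" for n
    unfolding sq by (intro Bochner_Integration.integrable_sum scaled_visits_covariance)
  have D_le: "expectation (\<lambda>\<omega>. (D n \<omega>)\<^sup>2) \<le> 6 * real n" for n
  proof -
    have "expectation (\<lambda>\<omega>. (D n \<omega>)\<^sup>2) = (\<Sum>i<n. \<Sum>j<n. expectation (\<lambda>\<omega>. (scaled_visits i \<omega> - 1) * (scaled_visits j \<omega> - 1)))"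
      unfolding sq
      by (subst Bochner_Integration.integral_sum, intro Bochner_Integration.integrable_sum scaled_visits_covariance)
         (intro sum.cong refl Bochner_Integration.integral_sum scaled_visits_covariance)
    also have "\<dots> \<le> (\<Sum>i<n. \<Sum>j<n. 2 * (1/2) ^ (max i j - min i j))"
      by (intro sum_mono scaled_visits_covariance)
    also have "\<dots> = 2 * (\<Sum>i<n. \<Sum>j<n. (1/2) ^ (max i j - min i j))"
      by (simp only: sum_distrib_left)
    finally show ?thesis using sum_half_powers_pairs_le[of n] by linarith
  qed
  have [measurable]: "(\<lambda>\<omega>. scaled_visits i \<omega>) \<in> borel_measurable (srw E v)" for i
    unfolding scaled_visits_def[abs_def]
    using borel_measurable_integrable[OF expectation_visits(1)] by measurable
  have [measurable]: "D n \<in> borel_measurable (srw E v)" for n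
    unfolding D_def[abs_def] by measurable
  have "AE \<omega> in srw E v. (\<lambda>m. (D (Suc m ^ 2) \<omega> / real (Suc m ^ 2))\<^sup>2) \<longlonglongrightarrow> 0"
  proof (rule AE_tendsto_0_if_summable[OF _ _ _ summable_const_over_Suc_squared[of 6]])
    fix m
    have "(\<integral>\<^sup>+\<omega>. ennreal ((D (Suc m ^ 2) \<omega> / real (Suc m ^ 2))\<^sup>2) \<partial>srw E v) =
        ennreal (expectation (\<lambda>\<omega>. (D (Suc m ^ 2) \<omega> / real (Suc m ^ 2))\<^sup>2))"
      unfolding power_divide by (rule nn_integral_eq_integral) (auto intro!: D_int)
    also have "expectation (\<lambda>\<omega>. (D (Suc m ^ 2) \<omega> / real (Suc m ^ 2))\<^sup>2) =
        expectation (\<lambda>\<omega>. (D (Suc m ^ 2) \<omega>)\<^sup>2) / (real (Suc m ^ 2))\<^sup>2"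
      unfolding power_divide by (rule integral_divide_zero)
    also have "\<dots> \<le> 6 * real (Suc m ^ 2) / (real (Suc m ^ 2))\<^sup>2"
      by (intro divide_right_mono D_le) simp
    also have "\<dots> = 6 / real (Suc m) ^ 2"
    proof -
      have "6 * x ^ 2 / (x ^ 2)\<^sup>2 = 6 / x ^ 2" if "x \<noteq> 0" for x :: real
        using that by (simp add: field_simps)
      from this[of "real (Suc m)"] show ?thesis by (simp add: of_nat_power del: of_nat_Suc)
    qed
    finally show "(\<integral>\<^sup>+\<omega>. ennreal ((D (Suc m ^ 2) \<omega> / real (Suc m ^ 2))\<^sup>2) \<partial>srw E v) \<le> ennreal (6 / real (Suc m) ^ 2)"
      by (simp add: ennreal_leI)
  qed auto
  then show ?thesis
  proof eventually_elim
    fix \<omega> assume "(\<lambda>m. (D (Suc m ^ 2) \<omega> / real (Suc m ^ 2))\<^sup>2) \<longlonglongrightarrow> 0"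
    then have "(\<lambda>m. D (Suc m ^ 2) \<omega> / real (Suc m ^ 2)) \<longlonglongrightarrow> 0" by (rule power2_tendsto_0_imp)
    then have "(\<lambda>m. D (Suc m ^ 2) \<omega> / real (Suc m ^ 2) + 1) \<longlonglongrightarrow> 0 + 1" by (intro tendsto_intros)
    moreover have "D (Suc m ^ 2) \<omega> / real (Suc m ^ 2) + 1 = (\<Sum>i<Suc m ^ 2. scaled_visits i \<omega>) / real (Suc m ^ 2)" for m
    proof -
      have "D n \<omega> / real n + 1 = (\<Sum>i<n. scaled_visits i \<omega>) / real n" if "n > 0" for n
        using that by (simp add: D_def sum_subtractf diff_divide_distrib)
      from this[of "Suc m ^ 2"] show ?thesis by (simp only: zero_less_power zero_less_Suc)
    qed
    ultimately show "(\<lambda>m. (\<Sum>i<Suc m ^ 2. scaled_visits i \<omega>) / real (Suc m ^ 2)) \<longlonglongrightarrow> 1" by (simp only: add_0)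
  qed
qed

section \<open>Limits along time instead of visit index\<close>

lemma visits_at_top:
  assumes "infinite {t. \<omega> t = v}"
  shows "filterlim (\<lambda>T. visits T \<omega>) at_top sequentially"
  using card_Int_lessThan_at_top[OF assms] by (simp add: visits_def)

lemma tendsto_over_visits:
  fixes f :: "nat \<Rightarrow> real"
  assumes inf: "infinite {t. \<omega> t = v}"
    and lim: "(\<lambda>M. (\<Sum>i<M. f (enumerate {t. \<omega> t = v} i)) / M) \<longlonglongrightarrow> l"
  shows "(\<lambda>T. (\<Sum>s<T. of_bool (\<omega> s = v) * f s) / visits T \<omega>) \<longlonglongrightarrow> l"
proof -
  have "(\<Sum>s<T. of_bool (\<omega> s = v) * f s) = (\<Sum>i<visits T \<omega>. f (enumerate {t. \<omega> t = v} i))" for T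
    unfolding visits_def sum_Int_lessThan_enumerate[OF inf, symmetric]
    by (rule sum.mono_neutral_cong_right) auto
  then show ?thesis
    using filterlim_compose[OF lim visits_at_top[OF inf]] by simp
qed

proposition AE_return_frequency:
  "AE \<omega> in srw E v. \<forall>n. (\<lambda>T. (\<Sum>s<T. of_bool (\<omega> s = v) * of_bool (\<omega> (s + n) = v)) / visits T \<omega>) \<longlonglongrightarrow> return_prob n"
proof (subst AE_all_countable, intro allI)
  fix n
  from AE_infinitely_many_visits AE_average_return_deviation[of n]
  show "AE \<omega> in srw E v. (\<lambda>T. (\<Sum>s<T. of_bool (\<omega> s = v) * of_bool (\<omega> (s + n) = v)) / visits T \<omega>) \<longlonglongrightarrow> return_prob n"
  proof eventually_elim
    fix \<omega> :: "nat \<Rightarrow> 'v"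
    assume inf: "infinite {t. \<omega> t = v}"
      and lim: "(\<lambda>M. (\<Sum>i<M. return_deviation n (enumerate {t. \<omega> t = v} i) \<omega>) / M) \<longlonglongrightarrow> 0"
    have "(\<lambda>T. (\<Sum>s<T. of_bool (\<omega> s = v) * return_deviation n s \<omega>) / visits T \<omega>) \<longlonglongrightarrow> 0"
      by (rule tendsto_over_visits[OF inf lim])
    then have "(\<lambda>T. (\<Sum>s<T. of_bool (\<omega> s = v) * return_deviation n s \<omega>) / visits T \<omega> + return_prob n) \<longlonglongrightarrow> 0 + return_prob n"
      by (intro tendsto_intros)
    \<comment> \<open>The two sides agree only after the first visit: before it, division by zero
      makes the quotients 0.\<close>
    moreover have "\<forall>\<^sub>F T in sequentially. (\<Sum>s<T. of_bool (\<omega> s = v) * return_deviation n s \<omega>) / visits T \<omega> + return_prob n =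
        (\<Sum>s<T. of_bool (\<omega> s = v) * of_bool (\<omega> (s + n) = v)) / visits T \<omega>"
    proof -
      have "\<forall>\<^sub>F T in sequentially. 1 \<le> visits T \<omega>"
        using visits_at_top[OF inf] by (simp add: filterlim_at_top)
      then show ?thesis
      proof eventually_elim
        fix T assume "1 \<le> visits T \<omega>"
        moreover have "(\<Sum>s<T. of_bool (\<omega> s = v) * return_deviation n s \<omega>) =
            (\<Sum>s<T. of_bool (\<omega> s = v) * of_bool (\<omega> (s + n) = v)) - return_prob n * visits T \<omega>"
          unfolding visits_eq_sum return_deviation_def
          by (simp only: right_diff_distrib sum_subtractf sum_distrib_left mult.commute)
        ultimately show "(\<Sum>s<T. of_bool (\<omega> s = v) * return_deviation n s \<omega>) / visits T \<omega> + return_prob n =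
            (\<Sum>s<T. of_bool (\<omega> s = v) * of_bool (\<omega> (s + n) = v)) / visits T \<omega>"
          by (simp add: diff_divide_distrib)
      qed
    qed
    ultimately show "(\<lambda>T. (\<Sum>s<T. of_bool (\<omega> s = v) * of_bool (\<omega> (s + n) = v)) / visits T \<omega>) \<longlonglongrightarrow> return_prob n"
      by (simp add: Lim_transform_eventually)
  qed
qed

text \<open>Here \<open>x\<close> is fixed and \<open>y\<close> is an independent walk observed at
  the visit times of \<open>x\<close>. The delay \<open>d\<close> is there because the estimator
  pairs times \<open>s\<close> and \<open>s + n\<close>, which different walkers may occupy.\<close>

proposition AE_few_collisions:
  assumes inf: "infinite {t. x t = v}"
  shows "AE y in srw E v. \<forall>d. (\<lambda>T. (\<Sum>s<T. of_bool (x s = v) * of_bool (y (s + d) = v)) / visits T x) \<longlonglongrightarrow> (0 :: real)"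
proof (subst AE_all_countable, intro allI)
  fix d
  have "strict_mono (\<lambda>i. enumerate {t. x t = v} i + d)"
    using enumerate_mono[OF _ inf] by (auto simp: strict_mono_def)
  from AE_few_visits_at_given_times[OF this]
  show "AE y in srw E v. (\<lambda>T. (\<Sum>s<T. of_bool (x s = v) * of_bool (y (s + d) = v)) / visits T x) \<longlonglongrightarrow> (0 :: real)"
    by eventually_elim (rule tendsto_over_visits[OF inf])
qed

end

section \<open>The estimator\<close>

text \<open>Where the limit does not exist, \<open>lim\<close> has an unspecified value; this keeps
  the estimator a total function of the observation.\<close>

definition estimated_return_prob :: "(nat \<Rightarrow> bool) \<Rightarrow> nat \<Rightarrow> real" where
  "estimated_return_prob \<xi> n =
    lim (\<lambda>T. (\<Sum>s<T. of_bool (\<xi> s \<and> \<xi> (s + n))) / (\<Sum>s<T. of_bool (\<xi> s)))"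

text \<open>For the sequences of interest the limit is already an integer, and \<open>round\<close>
  only converts its type.\<close>

definition estimated_number_of_walkers :: "(nat \<Rightarrow> bool) \<Rightarrow> nat" where
  "estimated_number_of_walkers \<xi> = (let u = estimated_return_prob \<xi> in
    nat (round (lim (\<lambda>m. (\<Sum>i<Suc m ^ 2. (\<Sum>t<scale u i. of_bool (\<xi> t)) / (\<Sum>t<scale u i. u t)) / real (Suc m ^ 2)))))"

text \<open>To be read with \<open>a\<close> and \<open>b\<close> as presence of each walker at
  times \<open>s\<close> and \<open>s + n\<close>. With the totals \<open>A\<close>,
  \<open>B\<close> and the diagonal \<open>q\<close>, the error terms are \<open>A * A - A\<close>
  and \<open>A * B - q\<close>, both arising from two distinct walkers.\<close>

lemma union_of_pairs_error:
  fixes a b :: "'j \<Rightarrow> bool"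
  assumes J: "finite J"
  shows "\<bar>of_bool ((\<exists>j\<in>J. a j) \<and> (\<exists>j\<in>J. b j)) - (\<Sum>j\<in>J. of_bool (a j) * of_bool (b j))\<bar>
    \<le> (\<Sum>i\<in>J. \<Sum>j\<in>J - {i}. of_bool (a i) * of_bool (a j)) + (\<Sum>i\<in>J. \<Sum>j\<in>J - {i}. of_bool (a i) * of_bool (b j) :: real)"
proof -
  define A B q :: real where "A = (\<Sum>j\<in>J. of_bool (a j))" and "B = (\<Sum>j\<in>J. of_bool (b j))"
    and "q = (\<Sum>j\<in>J. of_bool (a j) * of_bool (b j))"
  have off: "(\<Sum>i\<in>J. \<Sum>j\<in>J - {i}. of_bool (x i) * of_bool (y j)) =
     (\<Sum>i\<in>J. of_bool (x i)) * (\<Sum>j\<in>J. of_bool (y j)) - (\<Sum>j\<in>J. of_bool (x j) * of_bool (y j) :: real)"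
    for x y :: "'j \<Rightarrow> bool"
  proof -
    have "(\<Sum>j\<in>J - {i}. of_bool (x i) * of_bool (y j)) =
       (\<Sum>j\<in>J. of_bool (x i) * of_bool (y j)) - (of_bool (x i) * of_bool (y i) :: real)" if "i \<in> J" for i
      using J that by (simp only: sum_diff1 if_True)
    then have "(\<Sum>i\<in>J. \<Sum>j\<in>J - {i}. of_bool (x i) * of_bool (y j)) =
       (\<Sum>i\<in>J. (\<Sum>j\<in>J. of_bool (x i) * of_bool (y j)) - (of_bool (x i) * of_bool (y i) :: real))"
      by (intro sum.cong refl)
    then show ?thesis by (simp only: sum_subtractf sum_product)
  qed
  have aa: "(\<Sum>j\<in>J. of_bool (a j) * of_bool (a j)) = A"
    unfolding A_def by (intro sum.cong refl) simp
  have ge1: "1 \<le> (\<Sum>j\<in>J. of_bool (x j) :: real)" if ex: "\<exists>j\<in>J. x j" for x :: "'j \<Rightarrow> bool"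
  proof -
    from ex obtain j where j: "j \<in> J" "x j" by blast
    then have "of_bool (x j) \<le> (\<Sum>j\<in>J. of_bool (x j) :: real)" using J by (intro member_le_sum) auto
    then show ?thesis using j by simp
  qed
  have qA: "q \<le> A" unfolding q_def A_def by (intro sum_mono) auto
  have q0: "0 \<le> q" unfolding q_def by (intro sum_nonneg) auto
  consider "\<not> (\<exists>j\<in>J. a j)" | "\<exists>j\<in>J. a j" "\<not> (\<exists>j\<in>J. b j)" | "\<exists>j\<in>J. a j" "\<exists>j\<in>J. b j" by blast
  then show ?thesis
  proof cases
    case 1
    then have "A = 0" "q = 0" unfolding A_def q_def by (auto intro!: sum.neutral)
    then show ?thesis using 1 unfolding off aa A_def[symmetric] B_def[symmetric] q_def[symmetric] by simp
  next
    case 2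
    then have "B = 0" "q = 0" unfolding B_def q_def by (auto intro!: sum.neutral)
    moreover have "A \<le> A * A" using ge1[OF 2(1)] unfolding A_def[symmetric] by (simp add: mult_le_cancel_left1)
    ultimately show ?thesis using 2 unfolding off aa A_def[symmetric] B_def[symmetric] q_def[symmetric] by simp
  next
    case 3
    have A1: "1 \<le> A" and B1: "1 \<le> B" using ge1[OF 3(1)] ge1[OF 3(2)] by (simp_all add: A_def B_def)
    have "A \<le> A * A" "A \<le> A * B" using A1 B1 by (simp_all add: mult_le_cancel_left1)
    \<comment> \<open>This covers \<open>q\<close> larger than 1, where the excess is at most
      \<open>A - 1\<close> and is charged to coincidences at the first time.\<close>
    moreover have "A - 1 \<le> A * A - A" using zero_le_square[of "A - 1"] by (simp add: algebra_simps)
    ultimately have "\<bar>1 - q\<bar> \<le> A * A - A + (A * B - q)" using A1 qA q0 by (intro abs_leI) linarith+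
    then show ?thesis using 3 unfolding off aa A_def[symmetric] B_def[symmetric] q_def[symmetric] by simp
  qed
qed

text \<open>The weights \<open>w\<close> converge only on average and may be unbounded, so smallness
  of \<open>r\<close> relative to \<open>w\<close> is passed to averages directly; the finitely many
  initial terms vanish after division.\<close>

lemma average_negligible:
  fixes r w :: "nat \<Rightarrow> real" and N :: "nat \<Rightarrow> nat"
  assumes r: "\<And>i. 0 \<le> r i" and w: "\<And>i. 0 \<le> w i"
    and small: "\<And>\<delta>. \<delta> > 0 \<Longrightarrow> \<forall>\<^sub>F i in sequentially. r i \<le> \<delta> * w i"
    and N: "filterlim N at_top sequentially"
    and lim: "(\<lambda>m. (\<Sum>i<N m. w i) / N m) \<longlonglongrightarrow> L"
  shows "(\<lambda>m. (\<Sum>i<N m. r i) / N m) \<longlonglongrightarrow> 0"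
proof (rule tendstoI)
  fix e :: real assume e: "e > 0"
  have L: "0 \<le> L" by (rule LIMSEQ_le_const[OF lim]) (auto intro!: divide_nonneg_nonneg sum_nonneg w)
  \<comment> \<open>\<open>L + 1\<close> instead of \<open>L\<close> keeps the denominator positive
    when the limit is 0.\<close>
  define \<delta> where "\<delta> = e / (2 * (L + 1))"
  have \<delta>: "\<delta> > 0" using e L by (simp add: \<delta>_def)
  obtain I where I: "\<And>i. i \<ge> I \<Longrightarrow> r i \<le> \<delta> * w i"
    using small[OF \<delta>] by (auto simp: eventually_sequentially)
  define c where "c = (\<Sum>i<I. r i)"
  have Nr: "filterlim (\<lambda>m. real (N m)) at_top sequentially"
    by (rule filterlim_compose[OF filterlim_real_sequentially N])
  have "(\<lambda>m. c / real (N m) + \<delta> * ((\<Sum>i<N m. w i) / N m)) \<longlonglongrightarrow> 0 + \<delta> * L"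
    by (intro tendsto_intros lim tendsto_divide_0[OF tendsto_const] filterlim_at_top_imp_at_infinity Nr)
  moreover have "0 + \<delta> * L < e"
  proof -
    have "\<delta> * L < \<delta> * (2 * (L + 1))" using \<delta> L by simp
    then show ?thesis using L by (simp add: \<delta>_def)
  qed
  ultimately have "\<forall>\<^sub>F m in sequentially. c / real (N m) + \<delta> * ((\<Sum>i<N m. w i) / N m) < e"
    by (rule order_tendstoD(2))
  then show "\<forall>\<^sub>F m in sequentially. dist ((\<Sum>i<N m. r i) / real (N m)) 0 < e"
  proof eventually_elim
    fix m assume less: "c / real (N m) + \<delta> * ((\<Sum>i<N m. w i) / N m) < e"
    have "(\<Sum>i<N m. r i) \<le> (\<Sum>i<N m. of_bool (i < I) * r i + \<delta> * w i)"
      using I r w \<delta> by (intro sum_mono) (auto simp: not_less)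
    also have "\<dots> = (\<Sum>i<N m. of_bool (i < I) * r i) + \<delta> * (\<Sum>i<N m. w i)"
      by (simp only: sum.distrib sum_distrib_left)
    also have "(\<Sum>i<N m. of_bool (i < I) * r i) \<le> c"
    proof -
      have "(\<Sum>i<N m. of_bool (i < I) * r i) = (\<Sum>i\<in>{..<N m} \<inter> {..<I}. r i)"
        by (rule sum.mono_neutral_cong_right) auto
      also have "\<dots> \<le> c" unfolding c_def using r by (intro sum_mono2) auto
      finally show ?thesis .
    qed
    finally have "(\<Sum>i<N m. r i) / N m \<le> (c + \<delta> * (\<Sum>i<N m. w i)) / N m"
      by (intro divide_right_mono) auto
    also have "\<dots> < e" using less by (simp add: add_divide_distrib)
    finally show "dist ((\<Sum>i<N m. r i) / real (N m)) 0 < e"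
      using r by (simp add: sum_nonneg)
  qed
qed

context recurrent_rooted_graph begin

definition typical_path :: "(nat \<Rightarrow> 'v) \<Rightarrow> bool" where
  "typical_path x \<longleftrightarrow> infinite {t. x t = v} \<and>
    (\<forall>n. (\<lambda>T. (\<Sum>s<T. of_bool (x s = v) * of_bool (x (s + n) = v)) / visits T x) \<longlonglongrightarrow> return_prob n) \<and>
    (\<lambda>m. (\<Sum>i<Suc m ^ 2. scaled_visits i x) / real (Suc m ^ 2)) \<longlonglongrightarrow> 1"

text \<open>Asymmetric, since normalised by the visits of \<open>x\<close> alone; it is used for
  both orders of each pair of walks.\<close>

definition rarely_collide :: "(nat \<Rightarrow> 'v) \<Rightarrow> (nat \<Rightarrow> 'v) \<Rightarrow> bool" where
  "rarely_collide x y \<longleftrightarrow>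
    (\<forall>d. (\<lambda>T. (\<Sum>s<T. of_bool (x s = v) * of_bool (y (s + d) = v)) / visits T x) \<longlonglongrightarrow> (0 :: real))"

lemma AE_typical_path: "AE x in srw E v. typical_path x"
  using AE_infinitely_many_visits AE_return_frequency AE_average_scaled_visits
proof eventually_elim
  fix x :: "nat \<Rightarrow> 'v"
  assume "infinite {t. x t = v}"
    and "\<forall>n. (\<lambda>T. (\<Sum>s<T. of_bool (x s = v) * of_bool (x (s + n) = v)) / visits T x) \<longlonglongrightarrow> return_prob n"
    and "(\<lambda>m. (\<Sum>i<Suc m ^ 2. scaled_visits i x) / real (Suc m ^ 2)) \<longlonglongrightarrow> 1"
  then show "typical_path x" unfolding typical_path_def by (intro conjI)
qed

lemma AE_rarely_collide: "typical_path x \<Longrightarrow> AE y in srw E v. rarely_collide x y"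
  unfolding rarely_collide_def typical_path_def by (elim conjE) (rule AE_few_collisions)

text \<open>Purely deterministic: all randomness is contained in the two hypotheses on the paths.
  Coincidences are negligible relative to the total number of visits, so the observation behaves
  like the sum of the individual walks.\<close>

proposition estimated_number_of_walkers_eq:
  fixes X :: "'j \<Rightarrow> nat \<Rightarrow> 'v"
  assumes J: "finite J" "J \<noteq> {}"
    and typical: "\<And>j. j \<in> J \<Longrightarrow> typical_path (X j)"
    and rare: "\<And>i j. i \<in> J \<Longrightarrow> j \<in> J \<Longrightarrow> i \<noteq> j \<Longrightarrow> rarely_collide (X i) (X j)"
    and \<xi>: "\<And>t. \<xi> t \<longleftrightarrow> (\<exists>j\<in>J. X j t = v)"
  shows "estimated_number_of_walkers \<xi> = card J"
proof -
  \<comment> \<open>The common normaliser, which dominates the count of each single walk.\<close>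
  define S where "S T = (\<Sum>j\<in>J. real (visits T (X j)))" for T
  define p where "p i j d T = (\<Sum>s<T. of_bool (X i s = v) * of_bool (X j (s + d) = v) :: real)" for i j d T
  define C where "C d T = (\<Sum>i\<in>J. \<Sum>j\<in>J - {i}. p i j d T)" for d T
  define O1 where "O1 T = (\<Sum>s<T. of_bool (\<xi> s) :: real)" for T
  define O2 where "O2 n T = (\<Sum>s<T. of_bool (\<xi> s \<and> \<xi> (s + n)) :: real)" for n T
  have visits_le_S: "visits T (X j) \<le> S T" if "j \<in> J" for j T
    unfolding S_def using J that by (intro member_le_sum) auto
  obtain j0 where j0: "j0 \<in> J" using J by blast
  have S_pos: "\<forall>\<^sub>F T in sequentially. S T > 0"
  proof -
    have "\<forall>\<^sub>F T in sequentially. 1 \<le> visits T (X j0)"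
      using visits_at_top[of "X j0"] typical[OF j0] by (simp add: filterlim_at_top typical_path_def)
    then show ?thesis
    proof eventually_elim
      fix T assume "1 \<le> visits T (X j0)"
      then show "S T > 0" using visits_le_S[OF j0, of T] by linarith
    qed
  qed
  \<comment> \<open>The ratio of one walk's visits to \<open>S\<close> has no known limit, so
    \<open>l\<close> times the visits is subtracted before dividing by \<open>S\<close>.\<close>
  have over_S: "(\<lambda>T. (g T - l * visits T (X j)) / S T) \<longlonglongrightarrow> 0"
    if j: "j \<in> J" and lim: "(\<lambda>T. g T / visits T (X j)) \<longlonglongrightarrow> l" for g :: "nat \<Rightarrow> real" and l j
  proof (rule tendsto_0_le[where K = 1])
    have "(\<lambda>T. g T / visits T (X j) - l) \<longlonglongrightarrow> l - l" by (intro tendsto_intros lim)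
    then show "(\<lambda>T. g T / visits T (X j) - l) \<longlonglongrightarrow> 0" by simp
    have "\<forall>\<^sub>F T in sequentially. 1 \<le> visits T (X j)"
      using visits_at_top[of "X j"] typical[OF j] by (simp add: filterlim_at_top typical_path_def)
    then show "\<forall>\<^sub>F T in sequentially. norm ((g T - l * visits T (X j)) / S T) \<le> norm (g T / visits T (X j) - l) * 1"
    proof eventually_elim
      fix T assume 1: "1 \<le> visits T (X j)"
      then have N: "0 < real (visits T (X j))" by simp
      have "g T / visits T (X j) - l = (g T - l * visits T (X j)) / visits T (X j)"
        using N by (simp add: field_simps)
      then show "norm ((g T - l * visits T (X j)) / S T) \<le> norm (g T / visits T (X j) - l) * 1"
        using N visits_le_S[OF j, of T] by (simp add: frac_le)
    qed
  qed
  have p_lim: "(\<lambda>T. p i j d T / visits T (X i)) \<longlonglongrightarrow> 0" if "i \<in> J" "j \<in> J" "i \<noteq> j" for i j d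
    using rare[OF that] unfolding rarely_collide_def p_def by blast
  have p_lim_same: "(\<lambda>T. p j j n T / visits T (X j)) \<longlonglongrightarrow> return_prob n" if "j \<in> J" for j n
    using typical[OF that] unfolding typical_path_def p_def by blast
  have C0: "(\<lambda>T. C d T / S T) \<longlonglongrightarrow> 0" for d
  proof -
    have "(\<lambda>T. \<Sum>i\<in>J. \<Sum>j\<in>J - {i}. (p i j d T - (0::real) * visits T (X i)) / S T) \<longlonglongrightarrow> (\<Sum>i\<in>J. \<Sum>j\<in>J - {i}. 0)"
      by (rule tendsto_sum, rule tendsto_sum, rule over_S, assumption, rule p_lim) auto
    then show ?thesis
      by (simp only: C_def sum_divide_distrib mult_zero_left diff_zero sum.neutral_const)
  qed
  have Q: "(\<lambda>T. (\<Sum>j\<in>J. p j j n T) / S T) \<longlonglongrightarrow> return_prob n" for n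
  proof -
    have "(\<lambda>T. \<Sum>j\<in>J. (p j j n T - return_prob n * visits T (X j)) / S T) \<longlonglongrightarrow> (\<Sum>j\<in>J. 0)"
      by (intro tendsto_sum over_S p_lim_same)
    moreover have "(\<Sum>j\<in>J. (p j j n T - return_prob n * visits T (X j)) / S T) =
        ((\<Sum>j\<in>J. p j j n T) - return_prob n * S T) / S T" for T
    proof -
      have "(\<Sum>j\<in>J. p j j n T - return_prob n * visits T (X j)) = (\<Sum>j\<in>J. p j j n T) - return_prob n * S T"
        unfolding S_def by (simp only: sum_subtractf sum_distrib_left)
      then show ?thesis unfolding sum_divide_distrib[symmetric] by (rule arg_cong)
    qed
    ultimately have "(\<lambda>T. ((\<Sum>j\<in>J. p j j n T) - return_prob n * S T) / S T) \<longlonglongrightarrow> 0" by simp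
    then have "(\<lambda>T. ((\<Sum>j\<in>J. p j j n T) - return_prob n * S T) / S T + return_prob n) \<longlonglongrightarrow> 0 + return_prob n"
      by (intro tendsto_intros)
    moreover have "\<forall>\<^sub>F T in sequentially. ((\<Sum>j\<in>J. p j j n T) - return_prob n * S T) / S T + return_prob n = (\<Sum>j\<in>J. p j j n T) / S T"
      using S_pos by eventually_elim (simp add: field_simps)
    ultimately show ?thesis by (simp add: Lim_transform_eventually)
  qed
  have O2_err: "\<bar>O2 n T - (\<Sum>j\<in>J. p j j n T)\<bar> \<le> C 0 T + C n T" for n T
  proof -
    have swap: "C d T = (\<Sum>s<T. \<Sum>i\<in>J. \<Sum>j\<in>J - {i}. of_bool (X i s = v) * of_bool (X j (s + d) = v))" for d
    proof -
      have "C d T = (\<Sum>i\<in>J. \<Sum>s<T. \<Sum>j\<in>J - {i}. of_bool (X i s = v) * of_bool (X j (s + d) = v))"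
        unfolding C_def p_def by (intro sum.cong refl sum.swap)
      also have "\<dots> = (\<Sum>s<T. \<Sum>i\<in>J. \<Sum>j\<in>J - {i}. of_bool (X i s = v) * of_bool (X j (s + d) = v))"
        by (rule sum.swap)
      finally show ?thesis .
    qed
    have "(\<Sum>j\<in>J. p j j n T) = (\<Sum>s<T. \<Sum>j\<in>J. of_bool (X j s = v) * of_bool (X j (s + n) = v))"
      unfolding p_def by (rule sum.swap)
    then have "\<bar>O2 n T - (\<Sum>j\<in>J. p j j n T)\<bar> \<le>
      (\<Sum>s<T. \<bar>of_bool (\<xi> s \<and> \<xi> (s + n)) - (\<Sum>j\<in>J. of_bool (X j s = v) * of_bool (X j (s + n) = v))\<bar>)"
      unfolding O2_def by (simp only: sum_subtractf[symmetric] sum_abs)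
    also have "\<dots> \<le> (\<Sum>s<T. (\<Sum>i\<in>J. \<Sum>j\<in>J - {i}. of_bool (X i s = v) * of_bool (X j (s + 0) = v)) +
        (\<Sum>i\<in>J. \<Sum>j\<in>J - {i}. of_bool (X i s = v) * of_bool (X j (s + n) = v)))"
      unfolding \<xi> add_0_right by (intro sum_mono union_of_pairs_error J)
    also have "\<dots> = C 0 T + C n T" unfolding swap by (rule sum.distrib)
    finally show ?thesis .
  qed
  have C_nonneg: "0 \<le> C d T" for d T
    unfolding C_def p_def by (intro sum_nonneg) auto
  have S_nonneg: "0 \<le> S T" for T unfolding S_def by (intro sum_nonneg) auto
  have O2_lim: "(\<lambda>T. O2 n T / S T) \<longlonglongrightarrow> return_prob n" for n
  proof -
    have "(\<lambda>T. (O2 n T - (\<Sum>j\<in>J. p j j n T)) / S T) \<longlonglongrightarrow> 0"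
    proof (rule tendsto_0_le[where K = 1])
      have "(\<lambda>T. C 0 T / S T + C n T / S T) \<longlonglongrightarrow> 0 + 0" by (intro tendsto_intros C0)
      then show "(\<lambda>T. (C 0 T + C n T) / S T) \<longlonglongrightarrow> 0" by (simp add: add_divide_distrib)
      show "\<forall>\<^sub>F T in sequentially. norm ((O2 n T - (\<Sum>j\<in>J. p j j n T)) / S T) \<le> norm ((C 0 T + C n T) / S T) * 1"
        using O2_err[of n] C_nonneg S_nonneg
        by (intro always_eventually allI) (simp add: divide_right_mono)
    qed
    from tendsto_add[OF this Q[of n]] show ?thesis by (simp add: add_divide_distrib[symmetric])
  qed
  have O1_eq: "O1 T = O2 0 T" for T by (simp add: O1_def O2_def)
  have est: "estimated_return_prob \<xi> = return_prob"
  proof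
    fix n
    \<comment> \<open>The unobservable \<open>S\<close> cancels, and the denominator is the case of
      delay 0, with limit 1.\<close>
    have "(\<lambda>T. (O2 n T / S T) / (O2 0 T / S T)) \<longlonglongrightarrow> return_prob n / return_prob 0"
      by (intro tendsto_divide O2_lim) simp
    moreover have "\<forall>\<^sub>F T in sequentially. (O2 n T / S T) / (O2 0 T / S T) = O2 n T / O1 T"
      using S_pos by eventually_elim (simp add: O1_eq)
    ultimately have "(\<lambda>T. O2 n T / O1 T) \<longlonglongrightarrow> return_prob n"
      by (simp add: Lim_transform_eventually)
    then show "estimated_return_prob \<xi> n = return_prob n"
      unfolding estimated_return_prob_def O2_def O1_def by (rule limI)
  qed
  define w where "w i = (\<Sum>j\<in>J. scaled_visits i (X j))" for i
  have w_eq: "w i = S (time_scale i) / green (time_scale i)" for i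
    by (simp add: w_def scaled_visits_def S_def sum_divide_distrib)
  have w_lim: "(\<lambda>m. (\<Sum>i<Suc m ^ 2. w i) / real (Suc m ^ 2)) \<longlonglongrightarrow> card J"
  proof -
    have lim: "(\<lambda>m. \<Sum>j\<in>J. (\<Sum>i<Suc m ^ 2. scaled_visits i (X j)) / real (Suc m ^ 2)) \<longlonglongrightarrow> (\<Sum>j\<in>J. 1)"
      using typical unfolding typical_path_def by (intro tendsto_sum) auto
    have eq: "(\<Sum>j\<in>J. (\<Sum>i<n. scaled_visits i (X j)) / real n) = (\<Sum>i<n. w i) / real n" for n
      unfolding w_def sum_divide_distrib[symmetric] by (subst sum.swap) (rule refl)
    show ?thesis using lim unfolding eq by simp
  qed
  \<comment> \<open>The two error terms of \<open>O2_err\<close> coincide for delay 0, hence the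
    factor 2.\<close>
  define r where "r i = 2 * C 0 (time_scale i) / green (time_scale i)" for i
  have squares: "filterlim (\<lambda>m. Suc m ^ 2) at_top sequentially"
    unfolding filterlim_at_top eventually_sequentially
  proof (intro allI exI impI)
    fix Z m :: nat assume "Z \<le> m"
    then show "Z \<le> Suc m ^ 2" using self_le_power[of "Suc m" 2] by simp
  qed
  have r_lim: "(\<lambda>m. (\<Sum>i<Suc m ^ 2. r i) / real (Suc m ^ 2)) \<longlonglongrightarrow> 0"
  proof (rule average_negligible[OF _ _ _ squares w_lim])
    show "0 \<le> r i" for i unfolding r_def using C_nonneg green_nonneg by simp
    show "0 \<le> w i" for i unfolding w_eq using S_nonneg green_nonneg by simp
    fix \<delta> :: real assume \<delta>: "\<delta> > 0"
    have "\<forall>\<^sub>F T in sequentially. C 0 T / S T < \<delta> / 2"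
      by (rule order_tendstoD(2)[OF C0]) (use \<delta> in simp)
    with S_pos have "\<forall>\<^sub>F T in sequentially. 2 * C 0 T \<le> \<delta> * S T"
      by eventually_elim (simp add: field_simps)
    from eventually_compose_filterlim[OF this time_scale_at_top]
    show "\<forall>\<^sub>F i in sequentially. r i \<le> \<delta> * w i"
      by eventually_elim (simp add: r_def w_eq divide_right_mono green_nonneg)
  qed
  have "(\<lambda>m. (\<Sum>i<Suc m ^ 2. O1 (time_scale i) / green (time_scale i) - w i) / real (Suc m ^ 2)) \<longlonglongrightarrow> 0"
  proof (rule tendsto_0_le[OF r_lim, where K = 1])
    have le: "\<bar>O1 (time_scale i) / green (time_scale i) - w i\<bar> \<le> r i" for i
    proof -
      have "(\<Sum>j\<in>J. p j j 0 T) = S T" for T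
        unfolding p_def S_def visits_eq_sum by (intro sum.cong refl) simp
      then have "\<bar>O1 T - S T\<bar> \<le> 2 * C 0 T" for T using O2_err[of 0 T] by (simp add: O1_eq)
      then show ?thesis
        unfolding w_eq r_def diff_divide_distrib[symmetric] using green_nonneg
        by (simp add: divide_right_mono)
    qed
    have "\<bar>\<Sum>i<n. O1 (time_scale i) / green (time_scale i) - w i\<bar> \<le> (\<Sum>i<n. r i)" for n
      by (intro order.trans[OF sum_abs] sum_mono le)
    then have "\<bar>(\<Sum>i<n. O1 (time_scale i) / green (time_scale i) - w i) / real n\<bar> \<le> \<bar>(\<Sum>i<n. r i) / real n\<bar>" for n
      by (simp add: divide_right_mono) (meson abs_ge_self divide_right_mono of_nat_0_le_iff order.trans)
    then show "\<forall>\<^sub>F m in sequentially. norm ((\<Sum>i<Suc m ^ 2. O1 (time_scale i) / green (time_scale i) - w i) / real (Suc m ^ 2))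
        \<le> norm ((\<Sum>i<Suc m ^ 2. r i) / real (Suc m ^ 2)) * 1"
      by (intro always_eventually allI) (simp only: real_norm_def mult_1_right)
  qed
  from tendsto_add[OF this w_lim]
  have "(\<lambda>m. (\<Sum>i<Suc m ^ 2. O1 (time_scale i) / green (time_scale i)) / real (Suc m ^ 2)) \<longlonglongrightarrow> card J"
    by (simp only: add_divide_distrib[symmetric] sum.distrib[symmetric] diff_add_cancel add_0)
  then have "lim (\<lambda>m. (\<Sum>i<Suc m ^ 2. O1 (time_scale i) / green (time_scale i)) / real (Suc m ^ 2)) = card J"
    by (rule limI)
  then show ?thesis
    unfolding estimated_number_of_walkers_def Let_def est O1_def green_def by simp
qed

end

section \<open>Measurability, product measures and uniqueness of the law\<close>

text \<open>Countable quantifiers only, so that convergence becomes a measurable condition.\<close>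

lemma tendsto_0_iff_inverse_Suc:
  fixes f :: "nat \<Rightarrow> real"
  shows "f \<longlonglongrightarrow> 0 \<longleftrightarrow> (\<forall>k. \<exists>N. \<forall>T\<ge>N. \<bar>f T\<bar> < 1 / real (Suc k))"
proof
  assume "f \<longlonglongrightarrow> 0"
  then show "\<forall>k. \<exists>N. \<forall>T\<ge>N. \<bar>f T\<bar> < 1 / real (Suc k)"
    using LIMSEQ_D[of f 0] by (metis diff_zero divide_pos_pos of_nat_0_less_iff real_norm_def zero_less_Suc zero_less_one)
next
  assume *: "\<forall>k. \<exists>N. \<forall>T\<ge>N. \<bar>f T\<bar> < 1 / real (Suc k)"
  show "f \<longlonglongrightarrow> 0"
  proof (rule LIMSEQ_I)
    fix e :: real assume "e > 0"
    then obtain k where k: "inverse (real (Suc k)) < e" using reals_Archimedean by blast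
    obtain N where "\<forall>T\<ge>N. \<bar>f T\<bar> < 1 / real (Suc k)" using * by blast
    then have "norm (f T - 0) < e" if "T \<ge> N" for T
      using k that by (force simp: inverse_eq_divide intro: less_trans)
    then show "\<exists>N. \<forall>T\<ge>N. norm (f T - 0) < e" by blast
  qed
qed

text \<open>Splits coordinate \<open>i\<close> off the product and applies Fubini: for almost every
  value of it, the condition concerns coordinate \<open>j\<close> of the remaining product
  alone.\<close>

lemma AE_PiM_two_components:
  assumes M: "\<And>i. i \<in> K \<Longrightarrow> prob_space (M i)" and ij: "i \<in> K" "j \<in> K" "i \<noteq> j"
    and P: "{z \<in> space (M i \<Otimes>\<^sub>M M j). P (fst z) (snd z)} \<in> sets (M i \<Otimes>\<^sub>M M j)"
    and ae: "AE x in M i. AE y in M j. P x y"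
  shows "AE X in PiM K M. P (X i) (X j)"
proof -
  define I where "I = K - {i}"
  have K: "K = insert i I" using ij by (auto simp: I_def)
  have jI: "j \<in> I" using ij by (simp add: I_def)
  interpret Mi: prob_space "M i" by (rule M[OF ij(1)])
  interpret I: prob_space "PiM I M" by (intro prob_space_PiM) (auto simp: I_def M)
  interpret pair_sigma_finite "M i" "PiM I M" ..
  have [measurable]: "Measurable.pred (M i \<Otimes>\<^sub>M M j) (\<lambda>z. P (fst z) (snd z))"
    using P by (simp add: pred_def)
  have [measurable]: "(\<lambda>X. X j) \<in> PiM I M \<rightarrow>\<^sub>M M j" "(\<lambda>X. X j) \<in> PiM K M \<rightarrow>\<^sub>M M j" "(\<lambda>X. X i) \<in> PiM K M \<rightarrow>\<^sub>M M i"
    using jI ij by (auto intro: measurable_component_singleton)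
  have meas: "Measurable.pred (M i \<Otimes>\<^sub>M PiM I M) (\<lambda>z. P (fst z) (snd z j))"
    by (rule measurable_compose[of "\<lambda>z. (fst z, snd z j)" _ "M i \<Otimes>\<^sub>M M j" "\<lambda>z. P (fst z) (snd z)", simplified]) measurable
  have measK: "Measurable.pred (PiM K M) (\<lambda>X. P (X i) (X j))"
    by (rule measurable_compose[of "\<lambda>X. (X i, X j)" _ "M i \<Otimes>\<^sub>M M j" "\<lambda>z. P (fst z) (snd z)", simplified]) measurable
  have "AE x in M i. AE X in PiM I M. P x (X j)"
    using ae by eventually_elim (rule AE_PiM_component[OF _ jI], auto simp: I_def M)
  then have "AE z in M i \<Otimes>\<^sub>M PiM I M. P (fst z) (snd z j)"
    by (intro AE_pair_measure) (use meas in \<open>auto simp: pred_def\<close>)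
  then have *: "AE z in M i \<Otimes>\<^sub>M PiM I M. P ((\<lambda>(x, X). X(i := x)) z i) ((\<lambda>(x, X). X(i := x)) z j)"
    by eventually_elim (use ij in \<open>auto simp: case_prod_beta\<close>)
  have "AE X in distr (M i \<Otimes>\<^sub>M PiM I M) (PiM (insert i I) M) (\<lambda>(x, X). X(i := x)). P (X i) (X j)"
  proof (subst AE_distr_iff)
    show "(\<lambda>(x, X). X(i := x)) \<in> M i \<Otimes>\<^sub>M PiM I M \<rightarrow>\<^sub>M PiM (insert i I) M" by measurable
    show "{X \<in> space (PiM (insert i I) M). P (X i) (X j)} \<in> sets (PiM (insert i I) M)"
      using measK by (simp add: pred_def K)
  qed (rule *)
  moreover have "distr (M i \<Otimes>\<^sub>M PiM I M) (PiM (insert i I) M) (\<lambda>(x, X). X(i := x)) = PiM (insert i I) M"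
    by (rule distr_pair_PiM_eq_PiM) (auto simp: I_def M ij)
  ultimately have "AE X in PiM (insert i I) M. P (X i) (X j)" by (simp only:)
  then show ?thesis by (simp only: K[symmetric])
qed

text \<open>Summing over cylinders extends the inequality to all events determined by a prefix; on
  complements it reverses, as both total masses are 1. These events determine the law.\<close>

lemma prob_measure_eq_if_cylinder_le:
  fixes M N :: "(nat \<Rightarrow> 'v::countable) measure"
  assumes M: "prob_space M" "sets M = sets (PiM UNIV (\<lambda>_. count_space UNIV))"
    and N: "prob_space N" "sets N = sets (PiM UNIV (\<lambda>_. count_space UNIV))"
    and le: "\<And>n xs. length xs = Suc n \<Longrightarrow> emeasure M (cylinder xs) \<le> emeasure N (cylinder xs)"
  shows "M = N"
proof -
  interpret M: prob_space M by fact
  interpret N: prob_space N by fact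
  have space: "space M = UNIV" "space N = UNIV"
    using sets_eq_imp_space_eq[OF M(2)] sets_eq_imp_space_eq[OF N(2)] by (simp_all add: space_PiM)
  have det_sets: "B \<in> sets M" "B \<in> sets N" if "determined_by_prefix n B" for n and B :: "(nat \<Rightarrow> 'v) set"
    using sets_srw_determined[OF that] by (simp_all only: M(2) N(2) sets_srw)
  have le_det: "emeasure M B \<le> emeasure N B" if "determined_by_prefix n B" for n and B :: "(nat \<Rightarrow> 'v) set"
  proof -
    have "emeasure M (UNIV \<inter> B) \<le> emeasure N (UNIV \<inter> B)"
      using sets.top[of M] sets.top[of N] space
      by (subst (1 2) emeasure_Int_determined[OF _ that]) (auto simp: M N prefix_lists_def intro!: nn_integral_mono le)
    then show ?thesis by simp
  qed
  have eq_det: "emeasure M B = emeasure N B" if "determined_by_prefix n B" for n and B :: "(nat \<Rightarrow> 'v) set"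
  proof (rule antisym)
    show "emeasure M B \<le> emeasure N B" by (rule le_det[OF that])
    have "determined_by_prefix n (- B)" using that unfolding determined_by_prefix_def by (metis ComplD ComplI)
    then have "measure M (- B) \<le> measure N (- B)" 
      using le_det by (simp add: M.emeasure_eq_measure N.emeasure_eq_measure)
    moreover have "measure M (- B) = 1 - measure M B" "measure N (- B) = 1 - measure N B"
      using M.prob_compl[OF det_sets(1)[OF that]] N.prob_compl[OF det_sets(2)[OF that]]
      by (simp_all add: space Compl_eq_Diff_UNIV)
    ultimately show "emeasure N B \<le> emeasure M B"
      by (simp add: M.emeasure_eq_measure N.emeasure_eq_measure)
  qed
  show ?thesis
  proof (rule measure_eqI_PiM_infinite[OF M(2) N(2)])
    fix A :: "nat \<Rightarrow> 'v set" and J :: "nat set"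
    assume J: "finite J"
    have "determined_by_prefix (Max J) (prod_emb UNIV (\<lambda>_. count_space UNIV) J (Pi\<^sub>E J A))"
      unfolding determined_by_prefix_def prod_emb_def using Max_ge[OF J]
      by (auto simp: space_PiM PiE_iff)
    then show "emeasure M (prod_emb UNIV (\<lambda>_. count_space UNIV) J (Pi\<^sub>E J A)) =
        emeasure N (prod_emb UNIV (\<lambda>_. count_space UNIV) J (Pi\<^sub>E J A))"
      by (rule eq_det)
  qed (rule M.finite_measure_axioms)
qed

context recurrent_rooted_graph begin

lemma sets_rarely_collide:
  "{z \<in> space (srw E v \<Otimes>\<^sub>M srw E v). rarely_collide (fst z) (snd z)} \<in> sets (srw E v \<Otimes>\<^sub>M srw E v)"
proof -
  have [measurable]: "(\<lambda>z. of_bool (fst z s = v) :: real) \<in> borel_measurable (srw E v \<Otimes>\<^sub>M srw E v)"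
    "(\<lambda>z. of_bool (snd z s = v) :: real) \<in> borel_measurable (srw E v \<Otimes>\<^sub>M srw E v)" for s
    by (intro measurable_compose[OF measurable_fst] measurable_compose[OF measurable_snd]
        borel_measurable_integrable integral_of_bool_visit events_visit)+
  show ?thesis
    unfolding rarely_collide_def tendsto_0_iff_inverse_Suc visits_eq_sum by measurable
qed

proposition AE_estimated_number_of_walkers:
  assumes "k \<ge> 1"
  shows "AE X in srws E v k. estimated_number_of_walkers (observation v k X) = k"
proof -
  have typical: "AE X in srws E v k. \<forall>j\<in>{1..k}. typical_path (X j)"
    unfolding srws_def
    by (intro AE_finite_allI AE_PiM_component prob_space_srw AE_typical_path) auto
  have pair: "AE x in srw E v. AE y in srw E v. rarely_collide x y"
    using AE_typical_path by eventually_elim (rule AE_rarely_collide)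
  have rare: "AE X in srws E v k. \<forall>i\<in>{1..k}. \<forall>j\<in>{1..k} - {i}. rarely_collide (X i) (X j)"
    unfolding srws_def
    by (intro AE_finite_allI AE_PiM_two_components prob_space_srw sets_rarely_collide pair) auto
  from typical rare show ?thesis
  proof eventually_elim
    fix X assume "\<forall>j\<in>{1..k}. typical_path (X j)" "\<forall>i\<in>{1..k}. \<forall>j\<in>{1..k} - {i}. rarely_collide (X i) (X j)"
    then have "estimated_number_of_walkers (observation v k X) = card {1..k}"
      using assms by (intro estimated_number_of_walkers_eq[where X = X]) (auto simp: observation_def)
    then show "estimated_number_of_walkers (observation v k X) = k" by simp
  qed
qed

end

section \<open>Graphs with vertices of an arbitrary type\<close>

text \<open>The vertices reachable in exactly \<open>n\<close> steps form a finite set, and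
  connectedness exhausts \<open>V\<close> by these sets.\<close>

lemma countable_connected_graph:
  assumes "simple_graph V E" "connected_graph V E" "locally_finite_graph V E"
  shows "countable V"
proof -
  from assms(2) obtain v where v: "v \<in> V" by (auto simp: connected_graph_def)
  have "finite {y. (E ^^ n) v y} \<and> {y. (E ^^ n) v y} \<subseteq> V" for n
  proof (induction n)
    case 0
    have "{y. (E ^^ 0) v y} = {v}" by auto
    then show ?case using v by simp
  next
    case (Suc n)
    have "{y. (E ^^ Suc n) v y} = (\<Union>x\<in>{y. (E ^^ n) v y}. neighbours E x)"
      by (auto simp: neighbours_def relcompp_apply)
    moreover have "neighbours E x \<subseteq> V" "x \<in> V \<Longrightarrow> finite (neighbours E x)" for x
      using assms by (auto simp: simple_graph_def neighbours_def locally_finite_graph_def)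
    ultimately show ?case using Suc by auto
  qed
  moreover have "V \<subseteq> (\<Union>n. {y. (E ^^ n) v y})"
    using assms(2) v by (auto simp: connected_graph_def dest!: rtranclp_imp_relpowp)
  ultimately show ?thesis
    by (meson countable_UN countable_finite countable_subset UNIV_I countableI_type)
qed

text \<open>Cylinders of positive weight in the image graph stay in the image of \<open>V\<close>
  and pull back to a path with equal transition factors; the one-sided criterion for equality of
  laws then applies.\<close>

lemma srw_graph_image:
  fixes h :: "'v \<Rightarrow> 'w::countable"
  assumes simple: "simple_graph V E" and lf: "locally_finite_graph V E" and v: "v \<in> V"
    and nonempty: "\<And>x. x \<in> V \<Longrightarrow> neighbours E x \<noteq> {}" and h: "inj_on h V"
    and E': "\<And>x. x \<in> V \<Longrightarrow> neighbours E' (h x) = h ` neighbours E x"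
  shows "srw E' (h v) = distr (srw E v) (srw E' (h v)) (\<lambda>\<omega>. h \<circ> \<omega>)"
proof -
  let ?D = "distr (srw E v) (srw E' (h v)) (\<lambda>\<omega>. h \<circ> \<omega>)"
  have meas: "(\<lambda>\<omega>. h \<circ> \<omega>) \<in> srw E v \<rightarrow>\<^sub>M srw E' (h v)"
    unfolding measurable_cong_sets[OF refl sets_srw] comp_def
    by (intro measurable_PiM_single') (auto intro: measurable_compose[OF measurable_srw_coordinate])
  interpret prob_space "srw E v" by (rule prob_space_srw)
  have nb_V: "neighbours E x \<subseteq> V" for x
    using simple by (auto simp: simple_graph_def neighbours_def)
  have kernel: "pmf (pmf_of_set (neighbours E' (h x))) (h y) = pmf (pmf_of_set (neighbours E x)) y"
    if "x \<in> V" "y \<in> V" for x y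
  proof -
    have fin: "finite (neighbours E x)" using lf that by (simp add: locally_finite_graph_def)
    have "h y \<in> h ` neighbours E x \<longleftrightarrow> y \<in> neighbours E x"
      using inj_on_image_mem_iff[OF h that(2) nb_V[of x]] .
    moreover have "card (h ` neighbours E x) = card (neighbours E x)"
      by (rule card_image) (rule inj_on_subset[OF h nb_V])
    ultimately show ?thesis
      using fin nonempty[OF that(1)] by (simp add: E'[OF that(1)] pmf_of_set indicator_def)
  qed
  show ?thesis
  proof (rule prob_measure_eq_if_cylinder_le)
    show "prob_space ?D" by (rule prob_space_distr[OF meas])
    fix n and ys :: "'w list" assume ys: "length ys = Suc n"
    show "emeasure (srw E' (h v)) (cylinder ys) \<le> emeasure ?D (cylinder ys)"
    proof (cases "emeasure (srw E' (h v)) (cylinder ys) = 0")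
      case False
      then have y0: "ys ! 0 = h v"
        and nz: "(\<Prod>i<n. ennreal (pmf (pmf_of_set (neighbours E' (ys ! i))) (ys ! Suc i))) \<noteq> 0"
        using emeasure_srw_cylinder_list[OF ys, of E' "h v"] by (auto split: if_splits)
      \<comment> \<open>A nonzero product has no zero factor, so every step follows an edge and
        remains in the image.\<close>
      have in_V: "ys ! i \<in> h ` V" if "i \<le> n" for i
        using that
      proof (induction i)
        case 0
        then show ?case using y0 v by simp
      next
        case (Suc i)
        then obtain x where x: "x \<in> V" "ys ! i = h x" by auto
        have fin: "finite (neighbours E x)" using lf x by (simp add: locally_finite_graph_def)
        have "pmf (pmf_of_set (neighbours E' (ys ! i))) (ys ! Suc i) \<noteq> 0"
        proof
          assume "pmf (pmf_of_set (neighbours E' (ys ! i))) (ys ! Suc i) = 0"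
          then have "(\<Prod>i<n. ennreal (pmf (pmf_of_set (neighbours E' (ys ! i))) (ys ! Suc i))) = 0"
            using Suc.prems by (intro prod_zero) (auto intro!: bexI[of _ i])
          then show False using nz by contradiction
        qed
        then have "ys ! Suc i \<in> h ` neighbours E x"
          using fin nonempty[OF x(1)] by (auto simp: x(2) E'[OF x(1)] pmf_of_set indicator_def split: if_splits)
        then show ?case using nb_V[of x] by auto
      qed
      define g where "g i = inv_into V h (ys ! i)" for i
      have g: "g i \<in> V" "h (g i) = ys ! i" if "i \<le> n" for i
        using inv_into_into[OF in_V[OF that]] f_inv_into_f[OF in_V[OF that]] by (simp_all add: g_def)
      have g0: "g 0 = v" using y0 v h by (simp add: g_def)
      have "emeasure (srw E' (h v)) (cylinder ys) =
          (\<Prod>i<n. ennreal (pmf (pmf_of_set (neighbours E' (ys ! i))) (ys ! Suc i)))"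
        using emeasure_srw_cylinder_list[OF ys, of E' "h v"] y0 by simp
      also have "\<dots> = (\<Prod>i<n. ennreal (pmf (pmf_of_set (neighbours E (g i))) (g (Suc i))))"
        using g kernel[of "g i" "g (Suc i)" for i] by (intro prod.cong refl arg_cong[where f = ennreal]) (metis Suc_leI less_imp_le lessThan_iff)
      also have "\<dots> = emeasure (srw E v) {\<omega>. \<forall>i\<le>n. \<omega> i = g i}"
        using g0 by (simp add: emeasure_srw_cylinder)
      \<comment> \<open>Only an inclusion: outside \<open>V\<close> the map \<open>h\<close> need
        not be injective, so trajectories leaving \<open>V\<close> may also map into the
        cylinder.\<close>
      also have "\<dots> \<le> emeasure (srw E v) ((\<lambda>\<omega>. h \<circ> \<omega>) -` cylinder ys \<inter> space (srw E v))"
        using g ys by (intro emeasure_mono measurable_sets[OF meas] sets_srw_cylinder) (auto simp: cylinder_def)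
      also have "\<dots> = emeasure ?D (cylinder ys)"
        by (subst emeasure_distr[OF meas]) auto
      finally show ?thesis .
    qed simp
  qed (auto simp: sets_srw prob_space_srw)
qed

lemma rtranclp_image:
  assumes "E\<^sup>*\<^sup>* x y" and "\<And>x y. E x y \<Longrightarrow> E' (h x) (h y)"
  shows "E'\<^sup>*\<^sup>* (h x) (h y)"
  using assms(1)
proof (induction rule: rtranclp_induct)
  case (step y z)
  then show ?case using assms(2)[of y z] by (simp add: rtranclp.rtrancl_into_rtrancl)
qed simp

text \<open>The graph is copied into \<^typ>\<open>nat\<close>; the copying map sends the complement of \<open>V\<close> to the unused
  vertex \<open>0\<close>, so that it preserves observations even of trajectories that leave \<open>V\<close>.\<close>

lemma counts_walkers_transfer:
  fixes V :: "'v set"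
  assumes nat: "\<And>(V :: nat set) E. simple_graph V E \<and> infinite V \<and> connected_graph V E \<and>
      locally_finite_graph V E \<and> recurrent_graph V E \<Longrightarrow> counts_walkers A V E"
    and G: "simple_graph V E" "infinite V" "connected_graph V E" "locally_finite_graph V E" "recurrent_graph V E"
  shows "counts_walkers A V E"
proof -
  have "countable V" by (rule countable_connected_graph[OF G(1,3,4)])
  define h where "h x = (if x \<in> V then Suc (to_nat_on V x) else 0)" for x
  define V' where "V' = h ` V"
  define E' where "E' a b \<longleftrightarrow> (\<exists>x y. E x y \<and> a = h x \<and> b = h y)" for a b
  have inj: "inj_on h V"
    using inj_on_to_nat_on[OF \<open>countable V\<close>] by (auto simp: inj_on_def h_def)
  have EV: "x \<in> V" "y \<in> V" if "E x y" for x y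
    using G(1) that by (auto simp: simple_graph_def)
  have sym: "E y x" if "E x y" for x y
    using G(1) that by (auto simp: simple_graph_def symp_def)
  have h_eq: "h x = h v \<longleftrightarrow> x = v" if "v \<in> V" for x v
    using inj that by (auto simp: h_def inj_on_def)
  have nb: "neighbours E' (h x) = h ` neighbours E x" if "x \<in> V" for x
  proof -
    have "h x = h a \<longleftrightarrow> a = x" for a using h_eq[OF that, of a] by auto
    then show ?thesis by (auto simp: neighbours_def E'_def)
  qed
  have nonempty: "neighbours E x \<noteq> {}" if "x \<in> V" for x
  proof -
    have "\<not> V \<subseteq> {x}" using G(2) finite_subset by blast
    then obtain y where "y \<in> V" "y \<noteq> x" by blast
    then have "E\<^sup>*\<^sup>* x y" using G(3) that by (simp add: connected_graph_def)
    then show ?thesis using \<open>y \<noteq> x\<close> by (auto simp: neighbours_def elim: converse_rtranclpE)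
  qed
  have image: "srw E' (h v) = distr (srw E v) (srw E' (h v)) (\<lambda>\<omega>. h \<circ> \<omega>)" if "v \<in> V" for v
    by (rule srw_graph_image[OF G(1,4) that nonempty inj nb])
  have meas: "(\<lambda>\<omega>. h \<circ> \<omega>) \<in> srw E v \<rightarrow>\<^sub>M srw E' (h v)" for v
    unfolding measurable_cong_sets[OF refl sets_srw] comp_def
    by (intro measurable_PiM_single') (auto intro: measurable_compose[OF measurable_srw_coordinate])
  have irrefl: "\<not> E x x" for x using G(1) by (auto simp: simple_graph_def irreflp_def)
  have "\<not> E' a a" for a
  proof
    assume "E' a a"
    then obtain x y where xy: "E x y" "h x = h y" unfolding E'_def by metis
    then have "x = y" using h_eq[OF EV(2)[OF xy(1)]] by blast
    then show False using xy irrefl by blast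
  qed
  then have "simple_graph V' E'"
    using sym EV unfolding simple_graph_def symp_def irreflp_def E'_def V'_def by blast
  moreover have "infinite V'" using G(2) inj by (simp add: V'_def finite_image_iff)
  moreover have "connected_graph V' E'"
    unfolding connected_graph_def
  proof (intro conjI ballI)
    show "V' \<noteq> {}" using G(3) by (simp add: V'_def connected_graph_def)
    fix a b assume "a \<in> V'" "b \<in> V'"
    then obtain x y where "x \<in> V" "a = h x" "y \<in> V" "b = h y" by (auto simp: V'_def)
    moreover from this have "E\<^sup>*\<^sup>* x y" using G(3) by (simp add: connected_graph_def)
    ultimately show "E'\<^sup>*\<^sup>* a b" using rtranclp_image[of E x y E' h] E'_def by blast
  qed
  moreover have "locally_finite_graph V' E'"
    using G(4) nb by (auto simp: locally_finite_graph_def V'_def)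
  moreover have "recurrent_graph V' E'"
    unfolding recurrent_graph_def
  proof
    fix a assume "a \<in> V'"
    then obtain v where v: "v \<in> V" "a = h v" by (auto simp: V'_def)
    have ret: "AE \<omega> in srw E v. \<exists>t>0. (h \<circ> \<omega>) t = h v"
    proof -
      have "AE \<omega> in srw E v. \<exists>t>0. \<omega> t = v" using G(5) v by (simp add: recurrent_graph_def)
      then show ?thesis by eventually_elim auto
    qed
    have "{\<omega> \<in> space (srw E' (h v)). \<exists>t\<in>{0<..}. \<omega> t = h v} \<in> sets (srw E' (h v))" by measurable
    then have pred: "{\<omega> \<in> space (srw E' (h v)). \<exists>t>0. \<omega> t = h v} \<in> sets (srw E' (h v))"
      by (simp add: Bex_def)
    have "AE \<omega> in distr (srw E v) (srw E' (h v)) (\<lambda>\<omega>. h \<circ> \<omega>). \<exists>t>0. \<omega> t = h v"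
      by (subst AE_distr_iff[OF meas pred]) (rule ret)
    then show "AE \<omega> in srw E' a. \<exists>t>0. \<omega> t = a"
      unfolding v(2) image[OF v(1), symmetric] .
  qed
  ultimately have count: "counts_walkers A V' E'" by (intro nat) simp
  show ?thesis
    unfolding counts_walkers_def
  proof (intro ballI allI impI)
    fix v and k :: nat assume v: "v \<in> V" and k: "1 \<le> k"
    \<comment> \<open>\<open>compose\<close> is \<open>undefined\<close> outside
      \<open>{1..k}\<close>, as points of the product space must be.\<close>
    let ?f = "compose {1..k} (\<lambda>\<omega>. h \<circ> \<omega>)"
    have eq: "distr (srws E v k) (srws E' (h v) k) ?f = srws E' (h v) k"
      unfolding srws_def
      by (subst distr_PiM_finite_prob_space') (auto intro: prob_space_srw meas simp flip: image[OF v])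
    have f: "?f \<in> srws E v k \<rightarrow>\<^sub>M srws E' (h v) k"
      unfolding srws_def compose_def
      by (intro measurable_restrict measurable_compose[OF _ meas] measurable_component_singleton)
    have "AE X in srws E' (h v) k. A (observation (h v) k X) = k"
      using count v k by (auto simp: counts_walkers_def V'_def)
    then have "AE X in distr (srws E v k) (srws E' (h v) k) ?f. A (observation (h v) k X) = k"
      unfolding eq .
    then have "AE X in srws E v k. A (observation (h v) k (?f X)) = k"
      by (rule AE_distrD[OF f])
    moreover have "observation (h v) k (?f X) = observation v k X" for X
      using h_eq[OF v] by (auto simp: observation_def compose_def fun_eq_iff)
    ultimately show "AE X in srws E v k. A (observation v k X) = k" by simp
  qed
qed

theorem mainTheorem1:
  "(\<exists>A :: (nat \<Rightarrow> bool) \<Rightarrow> nat.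
      \<forall>(V :: nat set) E. simple_graph V E \<and> infinite V \<and> connected_graph V E \<and>
        locally_finite_graph V E \<and> recurrent_graph V E \<longrightarrow> counts_walkers A V E) \<and>
   (\<forall>A :: (nat \<Rightarrow> bool) \<Rightarrow> nat.
      (\<forall>(V :: nat set) E. simple_graph V E \<and> infinite V \<and> connected_graph V E \<and>
        locally_finite_graph V E \<and> recurrent_graph V E \<longrightarrow> counts_walkers A V E) \<longrightarrow>
      (\<forall>(V :: 'v set) E. simple_graph V E \<and> infinite V \<and> connected_graph V E \<and>
        locally_finite_graph V E \<and> recurrent_graph V E \<longrightarrow> counts_walkers A V E))"
proof (intro conjI exI allI impI)
  fix V :: "nat set" and E
  assume G: "simple_graph V E \<and> infinite V \<and> connected_graph V E \<and>
    locally_finite_graph V E \<and> recurrent_graph V E"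
  show "counts_walkers estimated_number_of_walkers V E"
    unfolding counts_walkers_def
  proof (intro ballI allI impI)
    fix v and k :: nat assume "v \<in> V" "1 \<le> k"
    then interpret recurrent_rooted_graph V E v using G by unfold_locales auto
    show "AE X in srws E v k. estimated_number_of_walkers (observation v k X) = k"
      using \<open>1 \<le> k\<close> by (rule AE_estimated_number_of_walkers)
  qed
next
  fix A :: "(nat \<Rightarrow> bool) \<Rightarrow> nat" and V :: "'v set" and E
  assume "\<forall>(V :: nat set) E. simple_graph V E \<and> infinite V \<and> connected_graph V E \<and>
      locally_finite_graph V E \<and> recurrent_graph V E \<longrightarrow> counts_walkers A V E"
    and "simple_graph V E \<and> infinite V \<and> connected_graph V E \<and>
      locally_finite_graph V E \<and> recurrent_graph V E"
  then show "counts_walkers A V E"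
    by (intro counts_walkers_transfer[of A V E]) blast+
qed

end
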